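(* Let $k\geq 3$ be an integer and let $\mathrm{And}(k)'$ be the Andrásfai graph from which the exterior cycle has been removed. Then: (1) if $\beta_{i,i+j}(I(\mathrm{And}(k)'))\neq 0$, then $2\leq j\leq 5$; (2) $\beta_{i,i+2}(I(\mathrm{And}(k)'))\neq 0$ if and only if $i\in\{0,\dots,k-3\}$; (3) $\beta_{i,i+3}(I(\mathrm{And}(k)'))\neq 0$ if and only if $i\in\{1,\dots,2k-5\}$; (4) $\beta_{i,i+4}(I(\mathrm{And}(k)'))\neq 0$ if and only if $i\in\{2,\dots,3k-7\}$; and (5) $\beta_{i,i+5}(I(\mathrm{And}(k)'))\neq 0$ if and only if $i=3k-6$.
   Context: $\mathrm{And}(k)'$ is the simple graph with vertex set $\mathbb Z_n$, $n=3k-1$, in which $a$ and $b$ are adjacent iff $b-a\in\{1+3j\mid j\in\{1,2,\dots,k-2\}\}$ modulo $n$ (this set is closed under negation modulo $n$). It is the Andrásfai graph $\mathrm{And}(k)$, i.e. the Cayley graph of $\mathbb Z_{3k-1}$ with connection set $\{1+3j\mid 0\le j\le k-1\}$, with the edges $\{i,i+1\}$, $i\in\mathbb Z_n$ (the exterior cycle), removed. Let $\mathbb K$ be an arbitrary field. For a graph $G$ with vertices $x_1,\dots,x_n$, the edge ideal is $I(G)=\langle x_ix_j \mid \{x_i,x_j\}\in E(G)\rangle\subseteq R=\mathbb K[x_1,\dots,x_n]$. $\beta_{i,j}(I(G))$ denotes the graded Betti number of the ideal $I(G)$ (not of $R/I(G)$): the number of generators of degree $j$ in the $i$-th free module ($i\ge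 0$) of the minimal graded free resolution $\cdots\to F_1\to F_0\to I(G)\to 0$. *)

theory Defs
  imports Complex_Main "HOL-Library.Poly_Mapping" "HOL-Number_Theory.Cong"
begin

section \<open>Polynomial rings and edge ideals\<close>

text \<open>
  A power product is a finitely supported exponent vector, a polynomial a finitely supported
  family of coefficients; addition and multiplication are those of \<^theory>\<open>HOL-Library.Poly_Mapping\<close>.
\<close>

type_synonym ('v, 'k) mpoly = "('v \<Rightarrow>\<^sub>0 nat) \<Rightarrow>\<^sub>0 'k"

definition Var :: "'v \<Rightarrow> ('v, 'k::field) mpoly" where
  "Var v = Poly_Mapping.single (Poly_Mapping.single v 1) 1"

text \<open>The polynomial ring over the field \<open>'k\<close> in the variables indexed by \<open>V\<close>, as a subring of
  the ring of polynomials in all variables indexed by the type.\<close>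

definition poly_ring :: "'v set \<Rightarrow> ('v, 'k::field) mpoly set" where
  "poly_ring V = {p. \<forall>m \<in> Poly_Mapping.keys p. Poly_Mapping.keys m \<subseteq> V}"

definition total_deg :: "('v \<Rightarrow>\<^sub>0 nat) \<Rightarrow> nat" where
  "total_deg m = (\<Sum>v \<in> Poly_Mapping.keys m. Poly_Mapping.lookup m v)"

text \<open>The zero polynomial is homogeneous of every degree, and the only homogeneous
  polynomial of negative degree.\<close>

definition homogeneous :: "int \<Rightarrow> ('v, 'k::field) mpoly \<Rightarrow> bool" where
  "homogeneous d p \<longleftrightarrow> (\<forall>m \<in> Poly_Mapping.keys p. int (total_deg m) = d)"

definition ideal_gen :: "'v set \<Rightarrow> ('v, 'k::field) mpoly set \<Rightarrow> ('v, 'k) mpoly set" where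
  "ideal_gen V S =
     {(\<Sum>s\<in>T. c s * s) | T c. finite T \<and> T \<subseteq> S \<and> (\<forall>s\<in>T. c s \<in> poly_ring V)}"

text \<open>A simple graph is a pair of its vertex set and its set of (two-element) edges.\<close>

type_synonym 'v sgraph = "'v set \<times> 'v set set"

definition edge_ideal :: "'v sgraph \<Rightarrow> ('v, 'k::field) mpoly set" where
  "edge_ideal G = ideal_gen (fst G) {Var u * Var v | u v. {u, v} \<in> snd G}"


section \<open>Minimal graded free resolutions and graded Betti numbers\<close>

text \<open>
  Data of a complex \<open>\<dots> \<rightarrow> F\<^sub>1 \<rightarrow> F\<^sub>0 \<rightarrow> I\<close> with based free modules of finite rank.
  The module \<open>F\<^sub>i\<close> has the basis \<open>e\<^sub>a\<close>, \<open>a < rk F i\<close>, where \<open>e\<^sub>a\<close> has degree \<open>gdeg F i a\<close>;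
  that is, \<open>F\<^sub>i\<close> is the direct sum of the twists \<open>R(- gdeg F i a)\<close>.
  The augmentation sends the basis element \<open>e\<^sub>a\<close> of \<open>F\<^sub>0\<close> to \<open>aug F a\<close>, and \<open>F\<^sub>i\<^sub>+\<^sub>1 \<rightarrow> F\<^sub>i\<close> sends
  \<open>e\<^sub>a\<close> to the sum of the \<open>diff F i a b * e\<^sub>b\<close>.
\<close>

record (overloaded) ('v, 'k) free_complex =
  rk :: "nat \<Rightarrow> nat"
  gdeg :: "nat \<Rightarrow> nat \<Rightarrow> int"
  aug :: "nat \<Rightarrow> ('v, 'k) mpoly"
  diff :: "nat \<Rightarrow> nat \<Rightarrow> nat \<Rightarrow> ('v, 'k) mpoly"

text \<open>Elements of a free module are coordinate vectors, extended by zero.\<close>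

definition free_mod :: "'v set \<Rightarrow> nat \<Rightarrow> (nat \<Rightarrow> ('v, 'k::field) mpoly) set" where
  "free_mod V r = {f. (\<forall>a<r. f a \<in> poly_ring V) \<and> (\<forall>a\<ge>r. f a = 0)}"

definition aug_map ::
  "('v, 'k::field) free_complex \<Rightarrow> (nat \<Rightarrow> ('v, 'k) mpoly) \<Rightarrow> ('v, 'k) mpoly" where
  "aug_map F f = (\<Sum>a<rk F 0. f a * aug F a)"

definition diff_map ::
  "('v, 'k::field) free_complex \<Rightarrow> nat \<Rightarrow> (nat \<Rightarrow> ('v, 'k) mpoly) \<Rightarrow> (nat \<Rightarrow> ('v, 'k) mpoly)" where
  "diff_map F i f = (\<lambda>b. if b < rk F i then \<Sum>a<rk F (Suc i). f a * diff F i a b else 0)"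

text \<open>The first two conditions say that all maps are defined over \<open>R\<close> and homogeneous of degree 0,
  the remaining ones that the augmented complex is exact.\<close>

definition graded_free_resolution ::
  "'v set \<Rightarrow> ('v, 'k::field) mpoly set \<Rightarrow> ('v, 'k) free_complex \<Rightarrow> bool" where
  "graded_free_resolution V I F \<longleftrightarrow>
     (\<forall>a < rk F 0. aug F a \<in> poly_ring V \<and> homogeneous (gdeg F 0 a) (aug F a)) \<and>
     (\<forall>i. \<forall>a < rk F (Suc i). \<forall>b < rk F i.
        diff F i a b \<in> poly_ring V \<and>
        homogeneous (gdeg F (Suc i) a - gdeg F i b) (diff F i a b)) \<and>
     aug_map F ` free_mod V (rk F 0) = I \<and>
     {f \<in> free_mod V (rk F 0). aug_map F f = 0} = diff_map F 0 ` free_mod V (rk F 1) \<and>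
     (\<forall>i. {f \<in> free_mod V (rk F (Suc i)). diff_map F i f = (\<lambda>_. 0)} =
          diff_map F (Suc i) ` free_mod V (rk F (Suc (Suc i))))"

text \<open>Minimality: the image of \<open>F\<^sub>i\<^sub>+\<^sub>1\<close> lies in \<open>\<mm> F\<^sub>i\<close> for the ideal \<open>\<mm>\<close> generated by the
  variables, i.e. the entries of the matrices have no constant term.\<close>

definition minimal_graded_free_resolution ::
  "'v set \<Rightarrow> ('v, 'k::field) mpoly set \<Rightarrow> ('v, 'k) free_complex \<Rightarrow> bool" where
  "minimal_graded_free_resolution V I F \<longleftrightarrow>
     graded_free_resolution V I F \<and>
     (\<forall>i. \<forall>a < rk F (Suc i). \<forall>b < rk F i. Poly_Mapping.lookup (diff F i a b) 0 = 0)"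

text \<open>A homogeneous ideal in finitely many variables has a minimal graded free resolution, unique up
  to isomorphism, so the choice made here does not affect the number.\<close>

definition graded_betti :: "'v set \<Rightarrow> ('v, 'k::field) mpoly set \<Rightarrow> nat \<Rightarrow> int \<Rightarrow> nat" where
  "graded_betti V I i d =
     (let F = (SOME F. minimal_graded_free_resolution V I F)
      in card {a. a < rk F i \<and> gdeg F i a = d})"


section \<open>Andrasfai graphs\<close>

text \<open>The integers modulo \<open>n\<close> are represented by \<open>0, \<dots>, n - 1\<close>. The connection set has to be
  closed under negation modulo \<open>n\<close> and must not contain 0.\<close>

definition circulant_graph :: "int \<Rightarrow> int set \<Rightarrow> int sgraph" where
  "circulant_graph n S =
     ({0..<n}, {{a, b} | a b. a \<in> {0..<n} \<and> b \<in> {0..<n} \<and> (\<exists>s\<in>S. [b - a = s] (mod n))})"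

definition andrasfai :: "nat \<Rightarrow> int sgraph" where
  "andrasfai k = circulant_graph (3 * int k - 1) {1 + 3 * j | j. 0 \<le> j \<and> j \<le> int k - 1}"

definition andrasfai' :: "nat \<Rightarrow> int sgraph" where
  "andrasfai' k = circulant_graph (3 * int k - 1) {1 + 3 * j | j. 1 \<le> j \<and> j \<le> int k - 2}"

lemma andrasfai'_simple:
  assumes "e \<in> snd (andrasfai' k)"
  shows "card e = 2 \<and> e \<subseteq> fst (andrasfai' k)"
proof -
  obtain a b j where e: "e = {a, b}" "a \<in> {0..<3 * int k - 1}" "b \<in> {0..<3 * int k - 1}"
    and j: "1 \<le> j" "j \<le> int k - 2" "[b - a = 1 + 3 * j] (mod (3 * int k - 1))"
    using assms unfolding andrasfai'_def circulant_graph_def by auto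
  have "a \<noteq> b"
  proof
    assume "a = b"
    hence "(1 + 3 * j) mod (3 * int k - 1) = 0"
      using j(3) by (simp add: cong_def)
    moreover have "(1 + 3 * j) mod (3 * int k - 1) = 1 + 3 * j"
      using j by (intro mod_pos_pos_trivial) auto
    ultimately show False using j by simp
  qed
  thus ?thesis using e by (auto simp: andrasfai'_def circulant_graph_def)
qed

lemma andrasfai'_eq:
  assumes "k \<ge> 3"
  defines "n \<equiv> 3 * int k - 1"
  shows "andrasfai' k = (fst (andrasfai k), snd (andrasfai k) - {{i, (i + 1) mod n} | i. i \<in> {0..<n}})"
proof -
  have n: "n \<ge> 8" using assms by auto
  have cyc: "{a, b} \<in> {{i, (i + 1) mod n} | i. i \<in> {0..<n}} \<longleftrightarrow>
      [b - a = 1] (mod n) \<or> [b - a = n - 1] (mod n)"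
    if "a \<in> {0..<n}" "b \<in> {0..<n}" for a b
  proof -
    have 1: "b = (a + 1) mod n \<longleftrightarrow> [b - a = 1] (mod n)"
    proof -
      have "b = (a + 1) mod n \<longleftrightarrow> [b = a + 1] (mod n)"
        using that by (simp add: cong_def)
      thus ?thesis by (simp add: cong_iff_dvd_diff algebra_simps)
    qed
    have 2: "a = (b + 1) mod n \<longleftrightarrow> [b - a = n - 1] (mod n)"
    proof -
      have "a = (b + 1) mod n \<longleftrightarrow> [a = b + 1] (mod n)"
        using that by (simp add: cong_def)
      also have "\<dots> \<longleftrightarrow> n dvd (b - a + 1)"
        by (metis cong_iff_dvd_diff cong_sym_eq add_diff_eq add.commute diff_add_eq)
      also have "\<dots> \<longleftrightarrow> n dvd (b - a + 1 - n)"
        using dvd_diff[of n "b - a + 1" n] dvd_add[of n "b - a + 1 - n" n] by auto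
      finally show ?thesis by (simp add: cong_iff_dvd_diff algebra_simps)
    qed
    have "{a, b} \<in> {{i, (i + 1) mod n} | i. i \<in> {0..<n}} \<longleftrightarrow>
       b = (a + 1) mod n \<or> a = (b + 1) mod n"
      using that by (auto simp: doubleton_eq_iff)
    thus ?thesis using 1 2 by simp
  qed
  have res: "j = l" if "[x = 1 + 3 * j] (mod n)" "[x = 1 + 3 * l] (mod n)"
    "0 \<le> j" "j \<le> int k - 1" "0 \<le> l" "l \<le> int k - 1" for x j l :: int
  proof -
    have "(1 + 3 * j) mod n = (1 + 3 * l) mod n"
      using that by (simp add: cong_def)
    moreover have "(1 + 3 * j) mod n = 1 + 3 * j" "(1 + 3 * l) mod n = 1 + 3 * l"
      using that by (auto intro!: mod_pos_pos_trivial simp: n_def)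
    ultimately show ?thesis by simp
  qed
  have key: "(\<exists>s\<in>{1 + 3 * j | j. 1 \<le> j \<and> j \<le> int k - 2}. [x = s] (mod n)) \<longleftrightarrow>
     (\<exists>s\<in>{1 + 3 * j | j. 0 \<le> j \<and> j \<le> int k - 1}. [x = s] (mod n)) \<and>
     \<not> ([x = 1] (mod n) \<or> [x = n - 1] (mod n))" (is "?L = ?R") for x
  proof
    assume ?L
    then obtain j where j: "1 \<le> j" "j \<le> int k - 2" "[x = 1 + 3 * j] (mod n)" by auto
    have "\<not> [x = 1] (mod n)" using res[of x j 0] j by auto
    moreover have "\<not> [x = n - 1] (mod n)" using res[of x j "int k - 1"] j by (auto simp: n_def)
    moreover have "\<exists>s\<in>{1 + 3 * j | j. 0 \<le> j \<and> j \<le> int k - 1}. [x = s] (mod n)"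
      using j by (intro bexI[of _ "1 + 3 * j"]) auto
    ultimately show ?R by blast
  next
    assume R: ?R
    then obtain j where j: "0 \<le> j" "j \<le> int k - 1" "[x = 1 + 3 * j] (mod n)" by auto
    have "j \<noteq> 0" using R j by auto
    moreover have "j \<noteq> int k - 1" using R j by (auto simp: n_def)
    ultimately have "1 \<le> j \<and> j \<le> int k - 2" using j by auto
    thus ?L using j by auto
  qed
  define C where "C = {{i, (i + 1) mod n} | i. i \<in> {0..<n}}"
  define S where "S = {1 + 3 * j | j. 0 \<le> j \<and> j \<le> int k - 1}"
  define S' where "S' = {1 + 3 * j | j. 1 \<le> j \<and> j \<le> int k - 2}"
  have iff: "(\<exists>s\<in>S'. [b - a = s] (mod n)) \<longleftrightarrow> (\<exists>s\<in>S. [b - a = s] (mod n)) \<and> {a, b} \<notin> C"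
    if "a \<in> {0..<n}" "b \<in> {0..<n}" for a b
    using cyc[OF that, folded C_def] key[of "b - a", folded S_def S'_def] by argo
  have "snd (circulant_graph n S') = snd (circulant_graph n S) - C"
  proof (intro set_eqI iffI)
    fix e assume "e \<in> snd (circulant_graph n S')"
    then obtain a b where ab: "e = {a, b}" "a \<in> {0..<n}" "b \<in> {0..<n}"
      "\<exists>s\<in>S'. [b - a = s] (mod n)"
      unfolding circulant_graph_def snd_conv by blast
    then show "e \<in> snd (circulant_graph n S) - C"
      using iff[OF ab(2,3)] unfolding circulant_graph_def snd_conv by blast
  next
    fix e assume e: "e \<in> snd (circulant_graph n S) - C"
    then obtain a b where ab: "e = {a, b}" "a \<in> {0..<n}" "b \<in> {0..<n}"
      "\<exists>s\<in>S. [b - a = s] (mod n)"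
      unfolding circulant_graph_def snd_conv by blast
    then show "e \<in> snd (circulant_graph n S')"
      using e iff[OF ab(2,3)] unfolding circulant_graph_def snd_conv by blast
  qed
  moreover have "fst (circulant_graph n S') = fst (circulant_graph n S)"
    by (simp add: circulant_graph_def)
  ultimately show ?thesis
    unfolding andrasfai'_def andrasfai_def n_def[symmetric] C_def[symmetric] S_def[symmetric] S'_def[symmetric]
    by (intro prod_eqI) (simp_all only: fst_conv snd_conv)
qed

end

theory Submission
  imports Defs "HOL-Library.Function_Algebras"
begin

text \<open>
  Write \<open>n = 3 k - 1\<close>, and for a set \<open>W\<close> of vertices let \<open>\<Delta>\<^sub>W\<close> be the complex of the independent
  subsets of \<open>W\<close>. By Hochster's formula, the Betti number in homological degree \<open>i\<close> and internal degree
  \<open>i + j\<close> does not vanish iff some \<open>W\<close> with \<open>i + j\<close> elements has nonzero reduced cohomology of \<open>\<Delta>\<^sub>W\<close> in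
  dimension \<open>j - 2\<close>. Faces are indexed by their size, so this is degree \<open>q = j - 1\<close> below.

  The topology. Since \<open>3 k = 1\<close> modulo \<open>n\<close>, multiplication by \<open>k\<close> turns the graph into the one in which
  two points of a cycle of length \<open>n\<close> are adjacent iff their distance exceeds \<open>k\<close>; independent sets are
  the sets of points that are pairwise at distance at most \<open>k\<close>. The tool is the exact sequence
  of a vertex \<open>u\<close>: the cohomology of \<open>\<Delta>\<^sub>W\<close> in degree \<open>q + 1\<close> sits between that of the deletion \<open>W - u\<close> in degree
  \<open>q + 1\<close> and that of the link in degree \<open>q\<close>, and the link is again the complex of a set, namely of the
  non-neighbours of \<open>u\<close> in \<open>W\<close>. These lie on two arcs of length \<open>k\<close>
  adjacent to \<open>u\<close>, each of which is independent, so the link comes from a bipartite graph. In it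
  neighbourhoods are nested up to two exceptional vertices, whence its cohomology stops at
  degree 3, and at degree 2 if one exceptional vertex is missing
  (\<open>no_coh_two_arcs\<close>). Hence degree 5 and above vanish for every \<open>W\<close>, and degree 4 survives only if all
  vertices are present. The sharp bounds on the size of \<open>W\<close> in degrees 1, 2 and 3 are \<open>coh_1_card\<close>,
  \<open>coh_2_card\<close> and \<open>coh_3_card\<close>. In degree 1 two gaps of length more than \<open>k\<close> are necessary. In degree 2 a triple
  of points that goes once around the cycle in steps of at most \<open>k\<close> kills the cohomology, and a set
  of more than \<open>2 k - 2\<close> vertices without such a triple is an interval. In degree 3 one uses that the deletion
  of one vertex makes the full complex acyclic. Conversely, an induced matching with a transversal that
  is a maximal independent set gives a nonzero class (\<open>coh_induced_matching\<close>), and suitable matchings exist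
  in all the asserted sizes.

  The algebra. The syzygies of a squarefree monomial ideal are determined by their components in
  squarefree multidegrees. A minimal resolution is therefore the same as an exact sequence
  of free functors on the subsets of \<open>V\<close> with values in finite-dimensional vector spaces, which can be
  built by choosing bases (\<open>squarefree_resolution_exists\<close>). A dimension shift in the Koszul complex shows that
  whether a multidegree \<open>W\<close> occurs among the generators of a syzygy functor depends on a single cohomology
  group of \<open>\<Delta>\<^sub>W\<close> (\<open>generator_iff_coh\<close>). Finally, \<open>graded_betti\<close> refers to an arbitrary minimal graded resolution; comparing two
  of them by chain maps whose composite is homotopic to the identity shows that the same degrees
  occur in both (\<open>graded_betti_nonzero_iff\<close>).
\<close>

section \<open>Cochains of simplicial complexes\<close>

definition pos_sign :: "'v::linorder \<Rightarrow> 'v set \<Rightarrow> 'k::field" where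
  "pos_sign v \<sigma> = (-1) ^ card {x \<in> \<sigma>. x < v}"

definition cobd :: "('v::linorder set \<Rightarrow> 'k::field) \<Rightarrow> 'v set \<Rightarrow> 'k" where
  "cobd \<phi> \<sigma> = (\<Sum>v\<in>\<sigma>. pos_sign v \<sigma> * \<phi> (\<sigma> - {v}))"

text \<open>
  Contraction with the vertex \<open>u\<close>, that is, the map to the cochains of the link of
  \<open>u\<close>, transposed to the cone operator on chains.
\<close>

definition contr :: "'v::linorder \<Rightarrow> ('v set \<Rightarrow> 'k::field) \<Rightarrow> 'v set \<Rightarrow> 'k" where
  "contr u \<phi> \<sigma> = (if u \<in> \<sigma> then 0 else pos_sign u \<sigma> * \<phi> (insert u \<sigma>))"

lemma pos_sign_square [simp]: "pos_sign v \<sigma> * pos_sign v \<sigma> = (1::'k::field)"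
  by (simp add: pos_sign_def flip: power_mult_distrib)

lemma pos_sign_square_left [simp]: "pos_sign v \<sigma> * (pos_sign v \<sigma> * x) = (x::'k::field)"
  by (simp flip: mult.assoc)

lemma pos_sign_nz [simp]: "pos_sign v \<sigma> \<noteq> (0::'k::field)"
  by (simp add: pos_sign_def)

lemma pos_sign_insert_self [simp]: "pos_sign u (insert u \<sigma>) = pos_sign u \<sigma>"
proof -
  have "{x \<in> insert u \<sigma>. x < u} = {x \<in> \<sigma>. x < u}" by auto
  then show ?thesis by (simp add: pos_sign_def)
qed

lemma pos_sign_insert_less:
  assumes "finite \<sigma>" "u \<notin> \<sigma>" "u < v"
  shows "pos_sign v (insert u \<sigma>) = - (pos_sign v \<sigma> :: 'k::field)"
proof -
  have "{x \<in> insert u \<sigma>. x < v} = insert u {x \<in> \<sigma>. x < v}" using assms by auto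
  then show ?thesis using assms by (simp add: pos_sign_def)
qed

lemma pos_sign_insert_greater:
  assumes "v < u"
  shows "pos_sign v (insert u \<sigma>) = (pos_sign v \<sigma> :: 'k::field)"
proof -
  have "{x \<in> insert u \<sigma>. x < v} = {x \<in> \<sigma>. x < v}" using assms by auto
  then show ?thesis by (simp add: pos_sign_def)
qed

lemma pos_sign_exchange:
  assumes "finite \<sigma>" "u \<notin> \<sigma>" "v \<in> \<sigma>"
  shows "pos_sign u \<sigma> * pos_sign v (insert u \<sigma>) = - (pos_sign v \<sigma> * pos_sign u (\<sigma> - {v}) :: 'k::field)"
proof -
  have \<sigma>: "\<sigma> = insert v (\<sigma> - {v})" using assms by auto
  have "u \<noteq> v" using assms by auto
  then consider "u < v" | "v < u" by fastforce
  then show ?thesis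
  proof cases
    case 1
    have "pos_sign u \<sigma> = (pos_sign u (\<sigma> - {v}) :: 'k)"
      using pos_sign_insert_greater[OF 1, of "\<sigma> - {v}"] \<sigma> by simp
    then show ?thesis using pos_sign_insert_less[OF assms(1,2) 1, where 'k='k] by simp
  next
    case 2
    have "pos_sign u \<sigma> = - (pos_sign u (\<sigma> - {v}) :: 'k)"
      using pos_sign_insert_less[OF _ _ 2, of "\<sigma> - {v}"] \<sigma> assms by simp
    then show ?thesis using pos_sign_insert_greater[OF 2, where 'k='k] by simp
  qed
qed

text \<open>
  All that is needed about signs is this Cartan formula: contraction with \<open>u\<close>
  followed by the coboundary, plus the two in the other order, is the identity on the sets that do
  not contain \<open>u\<close>.
\<close>

lemma cobd_insert:
  fixes \<phi> :: "'v::linorder set \<Rightarrow> 'k::field"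
  assumes "finite \<sigma>" "u \<notin> \<sigma>"
  shows "pos_sign u \<sigma> * cobd \<phi> (insert u \<sigma>) = \<phi> \<sigma> - cobd (contr u \<phi>) \<sigma>"
proof -
  have "pos_sign u \<sigma> * (\<Sum>v\<in>\<sigma>. pos_sign v (insert u \<sigma>) * \<phi> (insert u \<sigma> - {v}))
      = - cobd (contr u \<phi>) \<sigma>"
    unfolding cobd_def sum_distrib_left sum_negf[symmetric]
  proof (intro sum.cong refl)
    fix v assume v: "v \<in> \<sigma>"
    have "insert u \<sigma> - {v} = insert u (\<sigma> - {v})" using assms v by auto
    then show "pos_sign u \<sigma> * (pos_sign v (insert u \<sigma>) * \<phi> (insert u \<sigma> - {v}))
        = - (pos_sign v \<sigma> * contr u \<phi> (\<sigma> - {v}))"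
      using pos_sign_exchange[OF assms v, where 'k='k] assms
      by (simp add: contr_def flip: mult.assoc)
  qed
  moreover have "insert u \<sigma> - {u} = \<sigma>" using assms by auto
  ultimately show ?thesis using assms by (simp add: cobd_def distrib_left)
qed

lemma cobd_cong: "(\<And>v. v \<in> \<sigma> \<Longrightarrow> \<phi> (\<sigma> - {v}) = \<psi> (\<sigma> - {v})) \<Longrightarrow> cobd \<phi> \<sigma> = cobd \<psi> \<sigma>"
  unfolding cobd_def by (intro sum.cong) auto

lemma cobd_add: "cobd (\<lambda>\<sigma>. \<phi> \<sigma> + \<psi> \<sigma>) \<sigma> = cobd \<phi> \<sigma> + cobd \<psi> \<sigma>"
  by (simp add: cobd_def distrib_left sum.distrib)

lemma cobd_diff: "cobd (\<lambda>\<sigma>. \<phi> \<sigma> - \<psi> \<sigma>) \<sigma> = cobd \<phi> \<sigma> - cobd \<psi> \<sigma>"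
  by (simp add: cobd_def right_diff_distrib sum_subtractf)

lemma cobd_minus: "cobd (\<lambda>\<sigma>. - \<phi> \<sigma>) \<sigma> = - cobd \<phi> \<sigma>"
  by (simp add: cobd_def sum_negf)

lemma cobd_zero [simp]: "cobd (\<lambda>\<sigma>. 0) \<sigma> = 0"
  by (simp add: cobd_def)

lemma cobd_empty [simp]: "cobd \<phi> {} = 0"
  by (simp add: cobd_def)

text \<open>
  By the Cartan formula, the square of the coboundary at \<open>insert u \<sigma>\<close> reduces
  to the same square, for the contracted cochain, at the smaller set \<open>\<sigma>\<close>.
\<close>

lemma cobd_cobd:
  fixes \<phi> :: "'v::linorder set \<Rightarrow> 'k::field"
  assumes "finite \<sigma>"
  shows "cobd (cobd \<phi>) \<sigma> = 0"
  using assms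
proof (induction \<sigma> arbitrary: \<phi> rule: finite_induct)
  case empty
  then show ?case by simp
next
  case (insert u \<sigma>)
  have "cobd (contr u (cobd \<phi>)) \<sigma> = cobd (\<lambda>\<tau>. \<phi> \<tau> - cobd (contr u \<phi>) \<tau>) \<sigma>"
  proof (rule cobd_cong)
    fix v assume "v \<in> \<sigma>"
    then have *: "finite (\<sigma> - {v})" "u \<notin> \<sigma> - {v}" using insert by auto
    show "contr u (cobd \<phi>) (\<sigma> - {v}) = \<phi> (\<sigma> - {v}) - cobd (contr u \<phi>) (\<sigma> - {v})"
      using cobd_insert[OF *, of \<phi>] *(2) by (simp only: contr_def if_False)
  qed
  also have "\<dots> = cobd \<phi> \<sigma>"
    using insert.IH[of "contr u \<phi>"] by (simp add: cobd_diff)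
  finally have "pos_sign u \<sigma> * cobd (cobd \<phi>) (insert u \<sigma>) = 0"
    using cobd_insert[OF insert(1,2), of "cobd \<phi>"] by simp
  then show ?case by simp
qed

text \<open>
  The degree of a cochain is the size of the faces on which it is evaluated, one more than their
  dimension; the empty face is included, so the cohomology is reduced. Cochains are total
  functions and their values off the complex are irrelevant: a coboundary at a face involves only
  subsets of that face. The field is passed as a type.
\<close>

definition cocycle :: "nat \<Rightarrow> 'v::linorder set set \<Rightarrow> ('v set \<Rightarrow> 'k::field) \<Rightarrow> bool" where
  "cocycle q D \<phi> \<longleftrightarrow> (\<forall>\<tau>\<in>D. card \<tau> = Suc q \<longrightarrow> cobd \<phi> \<tau> = 0)"

definition coboundary :: "nat \<Rightarrow> 'v::linorder set set \<Rightarrow> ('v set \<Rightarrow> 'k::field) \<Rightarrow> bool" where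
  "coboundary q D \<phi> \<longleftrightarrow> (\<exists>\<psi>. \<forall>\<sigma>\<in>D. card \<sigma> = q \<longrightarrow> \<phi> \<sigma> = cobd \<psi> \<sigma>)"

definition has_coh :: "'k::field itself \<Rightarrow> nat \<Rightarrow> 'v::linorder set set \<Rightarrow> bool" where
  "has_coh K q D \<longleftrightarrow> (\<exists>\<phi> :: 'v set \<Rightarrow> 'k. cocycle q D \<phi> \<and> \<not> coboundary q D \<phi>)"

lemma no_cohE:
  assumes "\<not> has_coh (K :: 'k::field itself) q D" "cocycle q D (\<phi> :: 'v::linorder set \<Rightarrow> 'k)"
  obtains \<psi> where "\<And>\<sigma>. \<sigma> \<in> D \<Longrightarrow> card \<sigma> = q \<Longrightarrow> \<phi> \<sigma> = cobd \<psi> \<sigma>"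
  using assms unfolding has_coh_def coboundary_def by blast

definition simplicial :: "'v set set \<Rightarrow> bool" where
  "simplicial D \<longleftrightarrow> (\<forall>\<sigma>\<in>D. finite \<sigma> \<and> (\<forall>\<tau>. \<tau> \<subseteq> \<sigma> \<longrightarrow> \<tau> \<in> D))"

text \<open>
  Contraction with \<open>v\<close> is a contracting homotopy wherever \<open>\<phi>\<close> is
  closed on the cone with apex \<open>v\<close>.
\<close>

lemma cobd_contr:
  fixes \<phi> :: "'v::linorder set \<Rightarrow> 'k::field"
  assumes "finite \<sigma>" "v \<notin> \<sigma> \<Longrightarrow> cobd \<phi> (insert v \<sigma>) = 0"
  shows "cobd (contr v \<phi>) \<sigma> = \<phi> \<sigma>"
proof (cases "v \<in> \<sigma>")
  case False
  then show ?thesis using cobd_insert[OF assms(1) False, of \<phi>] assms(2) by simp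
next
  case True
  define \<tau> where "\<tau> = \<sigma> - {v}"
  have \<tau>: "finite \<tau>" "v \<notin> \<tau>" "\<sigma> = insert v \<tau>" using assms True by (auto simp: \<tau>_def)
  have "cobd (contr v (contr v \<phi>)) \<tau> = cobd (\<lambda>_. 0) \<tau>"
    using \<tau> by (intro cobd_cong) (auto simp: contr_def)
  then have "pos_sign v \<tau> * cobd (contr v \<phi>) \<sigma> = pos_sign v \<tau> * \<phi> \<sigma>"
    using cobd_insert[OF \<tau>(1,2), of "contr v \<phi>"] \<tau> by (simp add: contr_def)
  then show ?thesis by simp
qed

lemma cone_no_coh:
  assumes "simplicial D" "\<And>\<sigma>. \<sigma> \<in> D \<Longrightarrow> insert v \<sigma> \<in> D"
  shows "\<not> has_coh (K::'k::field itself) q D"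
proof
  assume "has_coh K q D"
  then obtain \<phi> :: "'a set \<Rightarrow> 'k" where \<phi>: "cocycle q D \<phi>" "\<not> coboundary q D \<phi>"
    by (auto simp: has_coh_def)
  have "\<phi> \<sigma> = cobd (contr v \<phi>) \<sigma>" if "\<sigma> \<in> D" "card \<sigma> = q" for \<sigma>
    using that assms \<phi>(1) by (intro cobd_contr[symmetric]) (auto simp: simplicial_def cocycle_def)
  then show False using \<phi>(2) unfolding coboundary_def by blast
qed

section \<open>Deletion and link of a vertex\<close>

text \<open>
  The inverse of the contraction with \<open>u\<close> on cochains that live on the open star of
  \<open>u\<close>.
\<close>

definition ext_by :: "'v::linorder \<Rightarrow> ('v set \<Rightarrow> 'k::field) \<Rightarrow> 'v set \<Rightarrow> 'k" where
  "ext_by u \<chi> \<sigma> = (if u \<in> \<sigma> then pos_sign u \<sigma> * \<chi> (\<sigma> - {u}) else 0)"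

lemma contr_ext_by: "u \<notin> \<sigma> \<Longrightarrow> contr u (ext_by u \<chi>) \<sigma> = \<chi> \<sigma>"
  by (simp add: contr_def ext_by_def)

lemma cobd_ext_by_notin: "u \<notin> \<sigma> \<Longrightarrow> cobd (ext_by u \<chi>) \<sigma> = 0"
  by (subst cobd_cong[of _ _ "\<lambda>_. 0"]) (auto simp: ext_by_def)

lemma cobd_ext_by_insert:
  assumes "finite \<sigma>" "u \<notin> \<sigma>"
  shows "pos_sign u \<sigma> * cobd (ext_by u \<chi>) (insert u \<sigma>) = - cobd \<chi> (\<sigma> :: 'v::linorder set) "
proof -
  have "cobd (contr u (ext_by u \<chi>)) \<sigma> = cobd \<chi> \<sigma>"
    using assms by (intro cobd_cong) (auto simp: contr_ext_by)
  then show ?thesis using assms cobd_insert[OF assms, of "ext_by u \<chi>"] by (simp add: ext_by_def)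
qed

definition vlink :: "'v \<Rightarrow> 'v set set \<Rightarrow> 'v set set" where
  "vlink u D = {\<sigma>. u \<notin> \<sigma> \<and> insert u \<sigma> \<in> D}"

definition vdel :: "'v \<Rightarrow> 'v set set \<Rightarrow> 'v set set" where
  "vdel u D = {\<sigma> \<in> D. u \<notin> \<sigma>}"

lemma simplicialD: "simplicial D \<Longrightarrow> \<sigma> \<in> D \<Longrightarrow> finite \<sigma>"
  "simplicial D \<Longrightarrow> \<sigma> \<in> D \<Longrightarrow> \<tau> \<subseteq> \<sigma> \<Longrightarrow> \<tau> \<in> D"
  by (auto simp: simplicial_def)

text \<open>
  Exactness of the sequence of the pair (complex, deletion) at its middle term: a cocycle that is
  a coboundary on the deletion may be changed to vanish there, and is then a cocycle of the link.
\<close>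

lemma vertex_vanishing:
  assumes D: "simplicial D"
    and del: "\<not> has_coh (K::'k::field itself) (Suc q) (vdel u D)"
    and link: "\<not> has_coh K q (vlink u D)"
  shows "\<not> has_coh K (Suc q) D"
proof
  assume "has_coh K (Suc q) D"
  then obtain \<phi> :: "'a set \<Rightarrow> 'k" where \<phi>: "cocycle (Suc q) D \<phi>" "\<not> coboundary (Suc q) D \<phi>"
    by (auto simp: has_coh_def)
  have "cocycle (Suc q) (vdel u D) \<phi>" using \<phi>(1) by (auto simp: cocycle_def vdel_def)
  from no_cohE[OF del this] obtain \<psi> where
    "\<And>\<sigma>. \<sigma> \<in> vdel u D \<Longrightarrow> card \<sigma> = Suc q \<Longrightarrow> \<phi> \<sigma> = cobd \<psi> \<sigma>" by blast
  then have \<psi>: "\<phi> \<sigma> = cobd \<psi> \<sigma>" if "\<sigma> \<in> D" "u \<notin> \<sigma>" "card \<sigma> = Suc q" for \<sigma>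
    using that by (simp add: vdel_def)
  define \<phi>' where "\<phi>' = (\<lambda>\<sigma>. \<phi> \<sigma> - cobd \<psi> \<sigma>)"
  have \<phi>'0: "\<phi>' \<sigma> = 0" if "\<sigma> \<in> D" "u \<notin> \<sigma>" "card \<sigma> = Suc q" for \<sigma>
    using \<psi>[OF that] by (simp add: \<phi>'_def)
  have \<phi>'c: "cobd \<phi>' \<tau> = 0" if "\<tau> \<in> D" "card \<tau> = Suc (Suc q)" for \<tau>
    using that \<phi>(1) cobd_cobd[of \<tau> \<psi>] simplicialD(1)[OF D]
    by (auto simp: \<phi>'_def cobd_diff cocycle_def)
  have "cocycle q (vlink u D) (contr u \<phi>')"
    unfolding cocycle_def
  proof (intro ballI impI)
    fix \<tau> assume \<tau>: "\<tau> \<in> vlink u D" "card \<tau> = Suc q"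
    have f: "finite \<tau>" "u \<notin> \<tau>" "insert u \<tau> \<in> D" "\<tau> \<in> D"
      using \<tau> simplicialD[OF D, of "insert u \<tau>"] by (auto simp: vlink_def)
    show "cobd (contr u \<phi>') \<tau> = 0"
      using cobd_insert[OF f(1,2), of \<phi>'] \<phi>'0[OF f(4,2)] \<phi>'c[OF f(3)] \<tau> f by simp
  qed
  then obtain \<chi> where \<chi>: "\<And>\<sigma>. \<sigma> \<in> vlink u D \<Longrightarrow> card \<sigma> = q \<Longrightarrow> contr u \<phi>' \<sigma> = cobd \<chi> \<sigma>"
    using no_cohE[OF link] by blast
  define \<psi>' where "\<psi>' = (\<lambda>\<sigma>. \<psi> \<sigma> + ext_by u (\<lambda>\<sigma>. - \<chi> \<sigma>) \<sigma>)"
  have "\<phi> \<sigma> = cobd \<psi>' \<sigma>" if \<sigma>: "\<sigma> \<in> D" "card \<sigma> = Suc q" for \<sigma>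
  proof (cases "u \<in> \<sigma>")
    case False
    then show ?thesis using \<psi>[OF \<sigma>(1) False \<sigma>(2)]
      by (simp add: \<psi>'_def cobd_add cobd_ext_by_notin)
  next
    case True
    define \<tau> where "\<tau> = \<sigma> - {u}"
    have \<tau>: "finite \<tau>" "u \<notin> \<tau>" "\<sigma> = insert u \<tau>" "\<tau> \<in> vlink u D" "card \<tau> = q"
      using True \<sigma> simplicialD[OF D \<sigma>(1)] by (auto simp: \<tau>_def vlink_def insert_absorb)
    have "pos_sign u \<tau> * cobd (ext_by u (\<lambda>\<sigma>. - \<chi> \<sigma>)) \<sigma> = contr u \<phi>' \<tau>"
      using cobd_ext_by_insert[OF \<tau>(1,2), of "\<lambda>\<sigma>. - \<chi> \<sigma>"] \<chi>[OF \<tau>(4,5)] \<tau>(3) by (simp add: cobd_minus)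
    also have "\<dots> = pos_sign u \<tau> * \<phi>' \<sigma>" using \<tau> by (simp add: contr_def)
    finally have "cobd (ext_by u (\<lambda>\<sigma>. - \<chi> \<sigma>)) \<sigma> = \<phi>' \<sigma>" by simp
    then show ?thesis by (simp add: \<psi>'_def cobd_add \<phi>'_def)
  qed
  then show False using \<phi>(2) unfolding coboundary_def by blast
qed

text \<open>
  The connecting map of the same sequence: a class of the link, extended by zero, can only become
  a coboundary if it is the restriction of a class of the deletion.
\<close>

lemma vertex_nonvanishing:
  assumes D: "simplicial D"
    and del: "\<not> has_coh (K::'k::field itself) q (vdel u D)"
    and link: "has_coh K q (vlink u D)"
  shows "has_coh K (Suc q) D"
proof (rule ccontr)
  assume no: "\<not> has_coh K (Suc q) D"
  from link obtain \<phi> :: "'a set \<Rightarrow> 'k" where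
    \<phi>: "cocycle q (vlink u D) \<phi>" "\<not> coboundary q (vlink u D) \<phi>"
    by (auto simp: has_coh_def)
  have sub: "\<tau> \<in> D" "finite \<tau>" if "\<tau> \<in> vlink u D" for \<tau>
    using that simplicialD[OF D, of "insert u \<tau>"] by (auto simp: vlink_def)
  have "cocycle (Suc q) D (ext_by u \<phi>)"
    unfolding cocycle_def
  proof (intro ballI impI)
    fix \<sigma> assume \<sigma>: "\<sigma> \<in> D" "card \<sigma> = Suc (Suc q)"
    show "cobd (ext_by u \<phi>) \<sigma> = 0"
    proof (cases "u \<in> \<sigma>")
      case True
      define \<tau> where "\<tau> = \<sigma> - {u}"
      have \<tau>: "finite \<tau>" "u \<notin> \<tau>" "\<sigma> = insert u \<tau>" "\<tau> \<in> vlink u D" "card \<tau> = Suc q"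
        using True \<sigma> simplicialD[OF D \<sigma>(1)] by (auto simp: \<tau>_def vlink_def insert_absorb)
      have "cobd \<phi> \<tau> = 0" using \<phi>(1) \<tau> by (auto simp: cocycle_def)
      then have "pos_sign u \<tau> * cobd (ext_by u \<phi>) \<sigma> = 0"
        using cobd_ext_by_insert[OF \<tau>(1,2), of \<phi>] \<tau>(3) by simp
      then show ?thesis by simp
    qed (simp add: cobd_ext_by_notin)
  qed
  from no_cohE[OF no this] obtain \<psi> where
    \<psi>: "\<And>\<sigma>. \<sigma> \<in> D \<Longrightarrow> card \<sigma> = Suc q \<Longrightarrow> ext_by u \<phi> \<sigma> = cobd \<psi> \<sigma>"
    by blast
  have "cocycle q (vdel u D) \<psi>"
    unfolding cocycle_def
  proof (intro ballI impI)
    fix \<sigma> assume "\<sigma> \<in> vdel u D" "card \<sigma> = Suc q"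
    then show "cobd \<psi> \<sigma> = 0" using \<psi>[of \<sigma>] by (auto simp: vdel_def ext_by_def)
  qed
  from no_cohE[OF del this] obtain \<chi> where
    "\<And>\<sigma>. \<sigma> \<in> vdel u D \<Longrightarrow> card \<sigma> = q \<Longrightarrow> \<psi> \<sigma> = cobd \<chi> \<sigma>" by blast
  then have \<chi>: "\<psi> \<sigma> = cobd \<chi> \<sigma>" if "\<sigma> \<in> D" "u \<notin> \<sigma>" "card \<sigma> = q" for \<sigma>
    using that by (simp add: vdel_def)
  have "\<phi> \<tau> = cobd (\<lambda>\<sigma>. \<chi> \<sigma> - contr u \<psi> \<sigma>) \<tau>" if \<tau>: "\<tau> \<in> vlink u D" "card \<tau> = q" for \<tau>
  proof -
    have u: "u \<notin> \<tau>" "insert u \<tau> \<in> D" using \<tau> by (auto simp: vlink_def)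
    have "\<phi> \<tau> = pos_sign u \<tau> * ext_by u \<phi> (insert u \<tau>)" using u by (simp add: ext_by_def)
    also have "\<dots> = pos_sign u \<tau> * cobd \<psi> (insert u \<tau>)"
      using \<psi>[OF u(2)] \<tau> u sub[OF \<tau>(1)] by simp
    also have "\<dots> = \<psi> \<tau> - cobd (contr u \<psi>) \<tau>" using cobd_insert sub[OF \<tau>(1)] u by blast
    also have "\<psi> \<tau> = cobd \<chi> \<tau>" using \<chi> sub[OF \<tau>(1)] u \<tau> by blast
    finally show ?thesis by (simp add: cobd_diff)
  qed
  then show False using \<phi>(2) unfolding coboundary_def by blast
qed

section \<open>Independence complexes of graphs\<close>

definition indep :: "('v \<Rightarrow> 'v \<Rightarrow> bool) \<Rightarrow> 'v set \<Rightarrow> 'v set set" where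
  "indep adj W = {\<sigma>. finite \<sigma> \<and> \<sigma> \<subseteq> W \<and> (\<forall>x\<in>\<sigma>. \<forall>y\<in>\<sigma>. \<not> adj x y)}"

text \<open>
  The link of \<open>u\<close> in the independence complex of \<open>W\<close> is the independence
  complex of the non-neighbours of \<open>u\<close> in \<open>W\<close>. All complexes below are
  thus given by vertex sets, and \<open>coh q W\<close> says that the one of \<open>W\<close> has
  cohomology in degree \<open>q\<close>.
\<close>

locale graph_rel =
  fixes adj :: "'v::linorder \<Rightarrow> 'v \<Rightarrow> bool" and K :: "'k::field itself"
  assumes sym: "adj x y \<Longrightarrow> adj y x" and irrefl: "\<not> adj x x"
begin

abbreviation coh :: "nat \<Rightarrow> 'v set \<Rightarrow> bool" where
  "coh q W \<equiv> has_coh K q (indep adj W)"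

definition nonnbrs :: "'v \<Rightarrow> 'v set \<Rightarrow> 'v set" where
  "nonnbrs u W = {w \<in> W. w \<noteq> u \<and> \<not> adj u w}"

lemma simplicial_indep: "simplicial (indep adj W)"
  by (auto simp: simplicial_def indep_def finite_subset)

lemma vdel_indep: "vdel u (indep adj W) = indep adj (W - {u})"
  by (auto simp: vdel_def indep_def)

lemma vlink_indep: "u \<in> W \<Longrightarrow> vlink u (indep adj W) = indep adj (nonnbrs u W)"
  using irrefl sym by (auto simp: vlink_def indep_def nonnbrs_def)

lemma coh_cases:
  assumes "coh (Suc q) W" "u \<in> W"
  obtains "coh (Suc q) (W - {u})" | "coh q (nonnbrs u W)"
  using vertex_vanishing[OF simplicial_indep, of K q u W] assms by (auto simp: vdel_indep vlink_indep)

lemma coh_from_nonnbrs: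
  assumes "u \<in> W" "\<not> coh q (W - {u})" "coh q (nonnbrs u W)"
  shows "coh (Suc q) W"
  using vertex_nonvanishing[OF simplicial_indep, of K q u W] assms by (auto simp: vdel_indep vlink_indep)

lemma no_coh_isolated:
  assumes "v \<in> W" "\<And>w. w \<in> W \<Longrightarrow> \<not> adj v w"
  shows "\<not> coh q W"
proof (rule cone_no_coh[of _ v, OF simplicial_indep])
  have "\<not> adj w v" if "w \<in> W" for w using sym[of w v] assms that by blast
  then show "insert v \<sigma> \<in> indep adj W" if "\<sigma> \<in> indep adj W" for \<sigma>
    using that assms by (auto simp: indep_def subset_iff)
qed

lemma coh_0_imp_empty: 
  assumes "coh 0 W" shows "W = {}"
proof (rule ccontr)
  assume "W \<noteq> {}"
  then obtain v where v: "v \<in> W" by auto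
  from assms obtain \<phi> :: "'v set \<Rightarrow> 'k" where
    \<phi>: "cocycle 0 (indep adj W) \<phi>" "\<not> coboundary 0 (indep adj W) \<phi>"
    by (auto simp: has_coh_def)
  have "{v} \<in> indep adj W" using v irrefl by (auto simp: indep_def)
  then have "cobd \<phi> {v} = 0" using \<phi>(1) by (auto simp: cocycle_def)
  then have "\<phi> {} = 0" by (simp add: cobd_def)
  then show False using \<phi>(2) by (auto simp: coboundary_def indep_def)
qed

lemma coh_empty_imp_0: assumes "coh q {}" shows "q = 0"
proof (rule ccontr)
  assume "q \<noteq> 0"
  then have "coboundary q (indep adj {}) \<phi>" for \<phi> :: "'v set \<Rightarrow> 'k"
    by (auto simp: coboundary_def indep_def)
  then show False using assms by (auto simp: has_coh_def)
qed

lemma no_coh_edgeless: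
  assumes "\<And>v w. v \<in> W \<Longrightarrow> w \<in> W \<Longrightarrow> \<not> adj v w"
  shows "\<not> coh (Suc q) W"
proof (cases "W = {}")
  case True
  then show ?thesis using coh_empty_imp_0 by blast
next
  case False
  then show ?thesis using assms no_coh_isolated by blast
qed

text \<open>
  If every neighbour of \<open>v\<close> is a neighbour of \<open>u\<close>, then the link of
  \<open>u\<close> is a cone with apex \<open>v\<close>.
\<close>

lemma coh_remove_dominated:
  assumes "coh q W" "u \<in> W" "v \<in> W" "u \<noteq> v"
    and dom: "\<And>w. w \<in> W \<Longrightarrow> adj v w \<Longrightarrow> adj u w"
  shows "coh q (W - {u})"
proof (cases q)
  case 0
  then show ?thesis using coh_0_imp_empty assms by blast
next
  case (Suc p)
  have "\<not> adj u v" using dom[of u] assms irrefl sym by blast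
  then have "\<not> coh p (nonnbrs u W)"
    using assms by (intro no_coh_isolated[of v]) (auto simp: nonnbrs_def)
  then show ?thesis using coh_cases assms Suc by metis
qed

text \<open>
  The link of a vertex \<open>u\<close> that has a neighbour has at least two vertices less,
  \<open>u\<close> and the neighbour, while the degree drops by one.
\<close>

lemma coh_card:
  assumes "coh q W" "finite W"
  shows "2 * q \<le> card W"
  using assms(2,1)
proof (induction W arbitrary: q rule: finite_psubset_induct)
  case (psubset W)
  show ?case
  proof (cases q)
    case (Suc p)
    have "\<exists>u\<in>W. \<exists>v\<in>W. adj u v" using no_coh_edgeless psubset.prems Suc by blast
    then obtain u v where uv: "u \<in> W" "v \<in> W" "adj u v" by blast
    have "u \<noteq> v" using uv irrefl by auto
    from psubset.prems[unfolded Suc] uv(1) show ?thesis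
    proof (cases rule: coh_cases)
      case 1
      have "2 * Suc p \<le> card (W - {u})" by (rule psubset.IH) (use 1 uv in auto)
      also have "\<dots> \<le> card W" by (simp add: card_Diff1_le)
      finally show ?thesis using Suc by simp
    next
      case 2
      have sub: "nonnbrs u W \<subseteq> W - {u, v}" using uv by (auto simp: nonnbrs_def)
      have "2 * p \<le> card (nonnbrs u W)" by (rule psubset.IH) (use 2 uv sub in auto)
      also have "\<dots> \<le> card (W - {u, v})" using sub psubset.hyps by (intro card_mono) auto
      also have "\<dots> = card W - 2" using uv \<open>u \<noteq> v\<close> psubset.hyps by (subst card_Diff_subset) auto
      finally have "2 * p \<le> card W - 2" .
      moreover have "card {u, v} \<le> card W" using uv psubset.hyps by (intro card_mono) auto
      ultimately show ?thesis using Suc \<open>u \<noteq> v\<close> by simp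
    qed
  qed simp
qed

text \<open>
  Deletion and link of a vertex of \<open>A\<close> both have a smaller part \<open>A\<close>, and
  without \<open>A\<close> the complex is a simplex.
\<close>

lemma no_coh_bipartite:
  assumes "finite A" "card A < q"
    "\<And>v w. v \<in> A \<Longrightarrow> w \<in> A \<Longrightarrow> \<not> adj v w" "\<And>v w. v \<in> B \<Longrightarrow> w \<in> B \<Longrightarrow> \<not> adj v w"
  shows "\<not> coh q (A \<union> B)"
  using assms
proof (induction "card A" arbitrary: A B q)
  case 0
  then have "A = {}" "q \<noteq> 0" by auto
  then show ?case using 0(5) no_coh_edgeless[of B "q - 1"] by auto
next
  case (Suc m)
  then obtain u where u: "u \<in> A" by fastforce
  obtain p where p: "q = Suc p" using Suc by (cases q) auto
  have m: "card (A - {u}) = m" "m < p" using Suc u p by auto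
  have 1: "\<not> coh q ((A - {u}) \<union> (B - {u}))" and 2: "\<not> coh p ((A - {u}) \<union> nonnbrs u B)"
    by (rule Suc.hyps(1); use m Suc p in \<open>auto simp: nonnbrs_def\<close>)+
  have "(A \<union> B) - {u} = (A - {u}) \<union> (B - {u})"
    "nonnbrs u (A \<union> B) = (A - {u}) \<union> nonnbrs u B"
    using u Suc.prems(3) by (auto simp: nonnbrs_def)
  then show ?case using 1 2 u p coh_cases[of p "A \<union> B" u] by auto
qed

text \<open>
  The complex is connected; as long as a vertex besides \<open>y\<close> and \<open>z\<close>
  remains, its link is not empty and it may be deleted.
\<close>

lemma no_coh_1_connected:
  assumes "finite X" "y \<in> X" "z \<in> X" "\<not> adj y z" "\<And>w. w \<in> X \<Longrightarrow> \<not> adj w y \<or> \<not> adj w z"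
  shows "\<not> coh (Suc 0) X"
  using assms
proof (induction X rule: finite_psubset_induct)
  case (psubset X)
  show ?case
  proof (cases "X \<subseteq> {y, z}")
    case True
    then show ?thesis using psubset.prems irrefl sym by (intro no_coh_isolated[of y]) auto
  next
    case False
    then obtain w where w: "w \<in> X" "w \<noteq> y" "w \<noteq> z" by auto
    have "\<not> coh (Suc 0) (X - {w})" by (rule psubset.IH) (use w psubset.prems in auto)
    moreover have "\<not> coh 0 (nonnbrs w X)"
    proof
      assume "coh 0 (nonnbrs w X)"
      then have "nonnbrs w X = {}" by (rule coh_0_imp_empty)
      moreover have "y \<in> nonnbrs w X \<or> z \<in> nonnbrs w X"
        using w psubset.prems by (auto simp: nonnbrs_def)
      ultimately show False by blast
    qed
    ultimately show ?thesis using w coh_cases by blast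
  qed
qed

text \<open>
  The complex is the boundary of a cross-polytope, a sphere with facet \<open>F\<close>, and the
  indicator cochain of a facet generates its top cohomology. For the induction, let
  \<open>u\<close> and \<open>v = p u\<close> be opposite vertices. If \<open>\<psi>\<close>
  bounds the indicator cochain, then on the equator \<open>\<psi>\<close> is the coboundary of its
  contraction with \<open>v\<close>, and differs from the coboundary of its contraction with
  \<open>u\<close> by a nonzero multiple of the indicator cochain of \<open>F - {u}\<close>, which
  is therefore a coboundary.
\<close>

lemma cross_polytope_facet:
  assumes "finite F" "inj_on p F" "F \<inter> p ` F = {}" "(c::'k) \<noteq> 0"
    and adj: "\<And>x y. x \<in> F \<union> p ` F \<Longrightarrow> y \<in> F \<union> p ` F \<Longrightarrow>
      adj x y \<longleftrightarrow> (x \<in> F \<and> y = p x) \<or> (y \<in> F \<and> x = p y)"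
  shows "\<not> coboundary (card F) (indep adj (F \<union> p ` F)) (\<lambda>\<sigma>. if \<sigma> = F then c else (0::'k))"
  using assms
proof (induction F arbitrary: c rule: finite_induct)
  case empty
  have "{} \<in> indep adj {}" by (simp add: indep_def)
  then show ?case using empty unfolding coboundary_def by fastforce
next
  case (insert u F)
  define v where "v = p u"
  define M where "M = F \<union> p ` F"
  have v: "v \<notin> F" "v \<noteq> u" "u \<notin> M" "v \<notin> M" using insert by (auto simp: v_def M_def)
  have M: "insert u F \<union> p ` insert u F = insert u (insert v M)" by (auto simp: M_def v_def)
  have iM: "\<not> adj u x" "\<not> adj v x" "\<not> adj x u" "\<not> adj x v" if "x \<in> M" for x
  proof -
    have "x \<noteq> u" "x \<noteq> v" using that v by auto
    moreover have "u \<noteq> p y" "p y \<noteq> v" if "y \<in> F" for y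
      using that v(3,4) unfolding M_def by (metis UnI2 imageI)+
    ultimately show "\<not> adj u x" "\<not> adj v x"
      using that insert.prems(4)[of u x] insert.prems(4)[of v x] v unfolding M_def v_def by auto
    then show "\<not> adj x u" "\<not> adj x v" using sym by blast+
  qed
  have ind: "insert u \<sigma> \<in> indep adj (insert u (insert v M))" "insert v \<sigma> \<in> indep adj (insert u (insert v M))"
    "u \<notin> \<sigma>" "v \<notin> \<sigma>" "finite \<sigma>"
    if "\<sigma> \<in> indep adj M" for \<sigma>
    using that iM irrefl v by (auto simp: indep_def)
  show ?case
  proof
    assume "coboundary (card (insert u F)) (indep adj (insert u F \<union> p ` insert u F))
      (\<lambda>\<sigma>. if \<sigma> = insert u F then c else 0)"
    then obtain \<psi> where \<psi>: "\<And>\<sigma>. \<sigma> \<in> indep adj (insert u (insert v M)) \<Longrightarrow> card \<sigma> = Suc (card F) \<Longrightarrow>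
      (if \<sigma> = insert u F then c else 0) = cobd \<psi> \<sigma>"
      unfolding M coboundary_def using insert by auto
    have "(if \<sigma> = F then pos_sign u F * c else 0) = cobd (\<lambda>\<sigma>. contr v \<psi> \<sigma> - contr u \<psi> \<sigma>) \<sigma>"
      if \<sigma>: "\<sigma> \<in> indep adj M" "card \<sigma> = card F" for \<sigma>
    proof -
      have "insert v \<sigma> \<noteq> insert u F" using v by auto
      then have "cobd \<psi> (insert v \<sigma>) = 0" using \<psi>[OF ind(2)[OF \<sigma>(1)]] \<sigma> ind[OF \<sigma>(1)] by simp
      then have 1: "\<psi> \<sigma> = cobd (contr v \<psi>) \<sigma>" using cobd_insert[of \<sigma> v \<psi>] ind[OF \<sigma>(1)] by simp
      have "insert u \<sigma> = insert u F \<longleftrightarrow> \<sigma> = F" using ind[OF \<sigma>(1)] insert by (metis Diff_insert_absorb)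
      then have "cobd \<psi> (insert u \<sigma>) = (if \<sigma> = F then c else 0)"
        using \<psi>[OF ind(1)[OF \<sigma>(1)]] \<sigma> ind[OF \<sigma>(1)] by simp
      then have "(if \<sigma> = F then pos_sign u F * c else 0) = \<psi> \<sigma> - cobd (contr u \<psi>) \<sigma>"
        using cobd_insert[of \<sigma> u \<psi>] ind[OF \<sigma>(1)] by (auto split: if_splits)
      then show ?thesis using 1 by (simp add: cobd_diff)
    qed
    then have "coboundary (card F) (indep adj (F \<union> p ` F)) (\<lambda>\<sigma>. if \<sigma> = F then pos_sign u F * c else 0)"
      unfolding coboundary_def M_def by blast
    moreover have "\<not> coboundary (card F) (indep adj (F \<union> p ` F)) (\<lambda>\<sigma>. if \<sigma> = F then pos_sign u F * c else 0)"
      using insert.prems by (intro insert.IH) auto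
    ultimately show False by blast
  qed
qed

text \<open>
  As \<open>F\<close> is a maximal face, its indicator cochain is a cocycle. It is not a
  coboundary since its restriction to the cross-polytope spanned by the matching is not.
\<close>

lemma coh_induced_matching:
  assumes "finite F" "inj_on p F" "F \<inter> p ` F = {}" "F \<union> p ` F \<subseteq> W"
    and adj: "\<And>x y. x \<in> F \<union> p ` F \<Longrightarrow> y \<in> F \<union> p ` F \<Longrightarrow>
      adj x y \<longleftrightarrow> (x \<in> F \<and> y = p x) \<or> (y \<in> F \<and> x = p y)"
    and maximal: "\<And>w. w \<in> W \<Longrightarrow> w \<notin> F \<Longrightarrow> \<exists>f\<in>F. adj w f"
  shows "coh (card F) W"
proof -
  let ?\<phi> = "\<lambda>\<sigma>. if \<sigma> = F then 1 else (0::'k)"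
  have "cocycle (card F) (indep adj W) ?\<phi>"
    unfolding cocycle_def
  proof (intro ballI impI)
    fix \<tau> assume \<tau>: "\<tau> \<in> indep adj W" "card \<tau> = Suc (card F)"
    have "\<tau> - {v} \<noteq> F" if "v \<in> \<tau>" for v
    proof
      assume F: "\<tau> - {v} = F"
      then have "v \<in> W" "v \<notin> F" using that \<tau> by (auto simp: indep_def)
      then obtain f where "f \<in> F" "adj v f" using maximal by blast
      then show False using \<tau> F that by (auto simp: indep_def)
    qed
    then show "cobd ?\<phi> \<tau> = 0" by (subst cobd_cong[of _ _ "\<lambda>_. 0"]) auto
  qed
  moreover have "\<not> coboundary (card F) (indep adj W) ?\<phi>"
  proof
    assume "coboundary (card F) (indep adj W) ?\<phi>"
    moreover have "indep adj (F \<union> p ` F) \<subseteq> indep adj W"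
      using assms(4) unfolding indep_def by blast
    ultimately have "coboundary (card F) (indep adj (F \<union> p ` F)) ?\<phi>"
      unfolding coboundary_def by (meson subsetD)
    then show False using cross_polytope_facet[OF assms(1,2,3) one_neq_zero adj] by blast
  qed
  ultimately show ?thesis by (auto simp: has_coh_def)
qed

end

section \<open>The graph as a complement of a power of a cycle\<close>

definition and_adj :: "int \<Rightarrow> int \<Rightarrow> int \<Rightarrow> bool" where
  "and_adj k a b \<longleftrightarrow> (\<exists>j. 1 \<le> j \<and> j \<le> k - 2 \<and> [b - a = 1 + 3 * j] (mod (3 * k - 1)))"

text \<open>
  Two coordinates relative to a base point \<open>x\<close> are used, \<open>step\<close> and
  \<open>off\<close>. The first counts in the original labelling of the vertices, the second in
  the labelling multiplied by \<open>k\<close>. As \<open>3 k = 1\<close>, an increment of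
  \<open>off\<close> by 1 is one of \<open>step\<close> by 3, and an increment of
  \<open>step\<close> by 1 is one of \<open>off\<close> by \<open>k\<close>. In both coordinates
  adjacency depends only on the absolute difference (\<open>adj_step\<close>,
  \<open>adj_off\<close>), so that no wrap-around has to be considered.
\<close>

locale andrasfai_cycle_free =
  fixes k :: int and K :: "'k::field itself"
  assumes k3: "3 \<le> k"
begin

abbreviation n :: int where "n \<equiv> 3 * k - 1"

abbreviation V :: "int set" where "V \<equiv> {0..<n}"

abbreviation adj :: "int \<Rightarrow> int \<Rightarrow> bool" where "adj \<equiv> and_adj k"

definition step :: "int \<Rightarrow> int \<Rightarrow> int" where "step x w = (w - x) mod n"

definition off :: "int \<Rightarrow> int \<Rightarrow> int" where "off x w = (k * (w - x)) mod n"

lemma n_pos: "0 < n" using k3 by simp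

lemma step_range: "0 \<le> step x w" "step x w < n"
  using k3 by (auto simp: step_def)

lemma off_range: "0 \<le> off x w" "off x w < n"
  using k3 by (auto simp: off_def)

lemma diff_eq_cases:
  assumes "0 \<le> s" "s < n" "0 \<le> t" "t < n" "[d = t - s] (mod n)" "0 < c" "c < n"
  shows "[d = c] (mod n) \<longleftrightarrow> t - s = c \<or> s - t = n - c"
proof -
  have "[d = c] (mod n) \<longleftrightarrow> [t - s = c] (mod n)"
    using assms(5) by (meson cong_sym cong_trans)
  also have "\<dots> \<longleftrightarrow> (t - s) mod n = c"
    using assms by (simp add: cong_def)
  also have "\<dots> \<longleftrightarrow> t - s = c \<or> s - t = n - c"
  proof (cases "s \<le> t")
    case True
    then have "(t - s) mod n = t - s" using assms by (intro mod_pos_pos_trivial) auto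
    then show ?thesis using assms True by auto
  next
    case False
    have "(t - s) mod n = (t - s + n) mod n" by simp
    also have "\<dots> = t - s + n" using assms False by (intro mod_pos_pos_trivial) auto
    finally show ?thesis using assms False by auto
  qed
  finally show ?thesis .
qed

lemma adj_step:
  "adj a b \<longleftrightarrow> \<bar>step x a - step x b\<bar> mod 3 = 1 \<and> 4 \<le> \<bar>step x a - step x b\<bar> \<and> \<bar>step x a - step x b\<bar> \<le> 3 * k - 5"
proof -
  let ?s = "step x a" and ?t = "step x b"
  have d: "[b - a = ?t - ?s] (mod n)"
    by (simp add: step_def cong_def mod_simps)
  have "[b - a = 1 + 3 * j] (mod n) \<longleftrightarrow> ?t - ?s = 1 + 3 * j \<or> ?s - ?t = n - (1 + 3 * j)"
    if "1 \<le> j" "j \<le> k - 2" for j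
    using that by (intro diff_eq_cases[OF _ _ _ _ d]) (auto simp: step_range)
  then have "adj a b \<longleftrightarrow> (\<exists>j. 1 \<le> j \<and> j \<le> k - 2 \<and> (?t - ?s = 1 + 3 * j \<or> ?s - ?t = n - (1 + 3 * j)))"
    unfolding and_adj_def by blast
  also have "\<dots> \<longleftrightarrow> \<bar>?s - ?t\<bar> mod 3 = 1 \<and> 4 \<le> \<bar>?s - ?t\<bar> \<and> \<bar>?s - ?t\<bar> \<le> 3 * k - 5"
  proof
    assume "\<exists>j. 1 \<le> j \<and> j \<le> k - 2 \<and> (?t - ?s = 1 + 3 * j \<or> ?s - ?t = n - (1 + 3 * j))"
    then obtain j where j: "1 \<le> j" "j \<le> k - 2" "?t - ?s = 1 + 3 * j \<or> ?s - ?t = 1 + 3 * (k - 1 - j)"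
      by auto
    then obtain i where i: "\<bar>?s - ?t\<bar> = 1 + 3 * i" "1 \<le> i" "i \<le> k - 2"
      by (elim disjE) (auto intro: that[of j] that[of "k - 1 - j"])
    have "(1 + 3 * i) mod 3 = 1" by presburger
    then show "\<bar>?s - ?t\<bar> mod 3 = 1 \<and> 4 \<le> \<bar>?s - ?t\<bar> \<and> \<bar>?s - ?t\<bar> \<le> 3 * k - 5"
      using i by (simp del: mod_mult_self1)
  next
    assume e: "\<bar>?s - ?t\<bar> mod 3 = 1 \<and> 4 \<le> \<bar>?s - ?t\<bar> \<and> \<bar>?s - ?t\<bar> \<le> 3 * k - 5"
    define i where "i = \<bar>?s - ?t\<bar> div 3"
    have i: "\<bar>?s - ?t\<bar> = 1 + 3 * i" using e mult_div_mod_eq[of 3 "\<bar>?s - ?t\<bar>"] unfolding i_def by linarith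
    show "\<exists>j. 1 \<le> j \<and> j \<le> k - 2 \<and> (?t - ?s = 1 + 3 * j \<or> ?s - ?t = n - (1 + 3 * j))"
    proof (cases "?s \<le> ?t")
      case True
      then show ?thesis using i e by (intro exI[of _ i]) auto
    next
      case False
      then show ?thesis using i e by (intro exI[of _ "k - 1 - i"]) auto
    qed
  qed
  finally show ?thesis .
qed

lemma three_k: "[3 * k = 1] (mod n)"
  by (simp add: cong_iff_dvd_diff)

lemma adj_off:
  "adj a b \<longleftrightarrow> k + 1 \<le> \<bar>off x a - off x b\<bar> \<and> \<bar>off x a - off x b\<bar> \<le> 2 * k - 2"
proof -
  let ?s = "off x a" and ?t = "off x b"
  have "[?t - ?s = k * (b - x) - k * (a - x)] (mod n)"
    by (simp add: off_def cong_def mod_simps)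
  then have d: "[k * (b - a) = ?t - ?s] (mod n)"
    by (simp add: cong_sym_eq algebra_simps)
  have "[b - a = 1 + 3 * j] (mod n) \<longleftrightarrow> ?t - ?s = k + j \<or> ?s - ?t = n - (k + j)"
    if "1 \<le> j" "j \<le> k - 2" for j
  proof -
    have "coprime k n"
      unfolding coprime_iff_invertible_int by (intro exI[of _ 3]) (simp add: three_k mult.commute[of k])
    then have "[b - a = 1 + 3 * j] (mod n) \<longleftrightarrow> [k * (b - a) = k * (1 + 3 * j)] (mod n)"
      by (simp add: cong_mult_lcancel)
    also have "\<dots> \<longleftrightarrow> [k * (b - a) = k + j] (mod n)"
    proof -
      have "[k * (1 + 3 * j) = k + j] (mod n)"
        using cong_add[OF cong_refl cong_mult[OF three_k cong_refl[of j]], of k]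
        by (simp add: algebra_simps)
      then show ?thesis by (meson cong_sym cong_trans)
    qed
    also have "\<dots> \<longleftrightarrow> ?t - ?s = k + j \<or> ?s - ?t = n - (k + j)"
      using that by (intro diff_eq_cases[OF _ _ _ _ d]) (auto simp: off_range)
    finally show ?thesis .
  qed
  then have "adj a b \<longleftrightarrow> (\<exists>j. 1 \<le> j \<and> j \<le> k - 2 \<and> (?t - ?s = k + j \<or> ?s - ?t = n - (k + j)))"
    unfolding and_adj_def by blast
  also have "\<dots> \<longleftrightarrow> k + 1 \<le> \<bar>?s - ?t\<bar> \<and> \<bar>?s - ?t\<bar> \<le> 2 * k - 2"
  proof
    assume "\<exists>j. 1 \<le> j \<and> j \<le> k - 2 \<and> (?t - ?s = k + j \<or> ?s - ?t = n - (k + j))"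
    then show "k + 1 \<le> \<bar>?s - ?t\<bar> \<and> \<bar>?s - ?t\<bar> \<le> 2 * k - 2" by auto
  next
    assume e: "k + 1 \<le> \<bar>?s - ?t\<bar> \<and> \<bar>?s - ?t\<bar> \<le> 2 * k - 2"
    show "\<exists>j. 1 \<le> j \<and> j \<le> k - 2 \<and> (?t - ?s = k + j \<or> ?s - ?t = n - (k + j))"
    proof (cases "?s \<le> ?t")
      case True
      then show ?thesis using e by (intro exI[of _ "?t - ?s - k"]) auto
    next
      case False
      then show ?thesis using e by (intro exI[of _ "n - k - (?s - ?t)"]) auto
    qed
  qed
  finally show ?thesis .
qed

lemma adj_sym: "adj x y \<Longrightarrow> adj y x"
  using adj_off[of x y 0] adj_off[of y x 0] by (simp add: abs_minus_commute)

lemma adj_irrefl: "\<not> adj x x"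
  using adj_off[of x x 0] k3 by simp

sublocale graph_rel adj K
  using adj_sym adj_irrefl by unfold_locales

lemma step_add [simp]: "step x ((x + s) mod n) = s mod n"
  by (simp add: step_def mod_simps)

lemma add_step: "w \<in> V \<Longrightarrow> (x + step x w) mod n = w"
  by (simp add: step_def mod_simps)

lemma vertex [simp]: "w mod n \<in> V"
  using n_pos by simp

lemma off_add: "off x ((w + s) mod n) = (off x w + k * s) mod n"
proof -
  have "[k * ((w + s) mod n - x) = k * (w + s - x)] (mod n)"
    by (intro cong_mult cong_diff cong_refl) simp
  moreover have "[off x w + k * s = k * (w - x) + k * s] (mod n)"
    by (intro cong_add cong_refl) (simp add: off_def)
  ultimately show ?thesis by (simp add: off_def cong_def algebra_simps)
qed

lemma off_self [simp]: "off x x = 0"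
  by (simp add: off_def)

lemma off_add3: "off x ((w + 3 * i) mod n) = (off x w + i) mod n"
proof -
  have "[off x w + k * (3 * i) = off x w + i] (mod n)"
    using cong_add[OF cong_refl cong_mult[OF three_k cong_refl[of i]], of "off x w"]
    by (simp add: algebra_simps)
  then show ?thesis by (simp add: off_add cong_def)
qed

lemma add3_off:
  assumes "w \<in> V" shows "(x + 3 * off x w) mod n = w"
proof -
  have "[3 * off x w = 3 * (k * (w - x))] (mod n)"
    unfolding off_def cong_def by (simp add: mod_simps)
  also have "[3 * (k * (w - x)) = w - x] (mod n)"
    using cong_mult[OF three_k cong_refl[of "w - x"]] by (simp add: algebra_simps)
  finally have "[x + 3 * off x w = x + (w - x)] (mod n)" by (intro cong_add cong_refl)
  then show ?thesis using assms by (simp add: cong_def)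
qed

lemma off_inj: "inj_on (off x) V"
  by (rule inj_onI) (metis add3_off)

lemma off_eqD: "off x a = off x b \<Longrightarrow> a \<in> V \<Longrightarrow> b \<in> V \<Longrightarrow> a = b"
  using inj_onD[OF off_inj] by blast

lemma nonnbrs_off:
  assumes "w \<in> nonnbrs u W" "W \<subseteq> V" "u \<in> V"
  shows "off u w \<in> {1..k} \<union> {2 * k - 1..3 * k - 2}"
proof -
  have w: "w \<in> V" "w \<noteq> u" "\<not> adj u w" using assms by (auto simp: nonnbrs_def)
  then have "off u w \<noteq> 0" using off_eqD[of u w u] assms by auto
  then show ?thesis using w adj_off[of u w u] off_range[of u w] by auto
qed

lemma finite_vertices: "W \<subseteq> V \<Longrightarrow> finite W" by (rule finite_subset) auto

section \<open>Vanishing in degrees 4 and above\<close>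

text \<open>
  The first arc consists of the points at offset at most \<open>k\<close>. The neighbours of a
  point at offset at most \<open>k - 2\<close> form an initial segment of the second arc, so of
  any two such points the later one is dominated by the earlier one and may be deleted. At most
  one of them remains, and the rest is \<open>no_coh_bipartite\<close>.
\<close>

lemma no_coh_two_arcs:
  assumes "W \<subseteq> V" "\<And>w. w \<in> W \<Longrightarrow> off x w \<in> {1..k} \<union> {2 * k - 1..3 * k - 2}"
    and "card {w \<in> W. off x w \<in> {k - 1, k}} + 2 \<le> q"
  shows "\<not> coh q W"
proof -
  have "finite W" using assms finite_vertices by auto
  then show ?thesis using assms
  proof (induction W rule: finite_psubset_induct)
    case (psubset W)
    show ?case
    proof (cases "\<exists>u\<in>W. \<exists>v\<in>W. off x v < off x u \<and> off x u \<le> k - 2")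
      case True
      then obtain u v where uv: "u \<in> W" "v \<in> W" "off x v < off x u" "off x u \<le> k - 2" by blast
      have "\<not> coh q (W - {u})"
      proof (rule psubset.IH)
        have "card {w \<in> W - {u}. off x w \<in> {k - 1, k}} \<le> card {w \<in> W. off x w \<in> {k - 1, k}}"
          using psubset.hyps by (intro card_mono) auto
        then show "card {w \<in> W - {u}. off x w \<in> {k - 1, k}} + 2 \<le> q"
          using psubset.prems by linarith
      qed (use uv psubset.prems in auto)
      moreover have "adj u w" if "w \<in> W" "adj v w" for w
        using that uv psubset.prems(2)[of w] psubset.prems(2)[of v]
        unfolding adj_off[of _ _ x] by auto
      ultimately show ?thesis using coh_remove_dominated[of q W u v] uv by blast
    next
      case False
      define A where "A = {w \<in> W. off x w \<le> k}"
      define T where "T = {w \<in> W. off x w \<in> {k - 1, k}}"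
      have "card {w \<in> W. off x w \<le> k - 2} \<le> 1"
      proof -
        have "u = v" if "u \<in> W" "v \<in> W" "off x u \<le> k - 2" "off x v \<le> k - 2" for u v
          using False that off_eqD[of x u v] psubset.prems(1) by (metis linorder_less_linear subsetD)
        then show ?thesis using psubset.hyps card_le_Suc0_iff_eq[of "{w \<in> W. off x w \<le> k - 2}"] by auto
      qed
      moreover have "A = {w \<in> W. off x w \<le> k - 2} \<union> T" by (auto simp: A_def T_def)
      then have "card A = card ({w \<in> W. off x w \<le> k - 2} \<union> T)" by simp
      moreover have "card ({w \<in> W. off x w \<le> k - 2} \<union> T) \<le> card {w \<in> W. off x w \<le> k - 2} + card T"
        by (rule card_Un_le)
      ultimately have "card A < q" using psubset.prems(3) unfolding T_def[symmetric] by linarith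
      then have "\<not> coh q (A \<union> (W - A))"
      proof (rule no_coh_bipartite[rotated])
        fix v w assume "v \<in> A" "w \<in> A"
        then show "\<not> adj v w"
          using psubset.prems(2)[of v] psubset.prems(2)[of w] unfolding adj_off[of _ _ x] A_def by auto
      next
        fix v w assume "v \<in> W - A" "w \<in> W - A"
        then show "\<not> adj v w"
          using psubset.prems(2)[of v] psubset.prems(2)[of w] unfolding adj_off[of _ _ x] A_def by auto
      qed (use psubset.hyps A_def in auto)
      moreover have "A \<union> (W - A) = W" by (auto simp: A_def)
      ultimately show ?thesis by simp
    qed
  qed
qed

lemma card_off_preimage:
  assumes "W \<subseteq> V" "finite S" shows "card {w \<in> W. off x w \<in> S} \<le> card S"
  using assms off_inj by (intro card_inj_on_le[of "off x"]) (auto intro: inj_on_subset)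

lemma no_coh_ge_5:
  assumes "W \<subseteq> V" "5 \<le> q" shows "\<not> coh q W"
proof -
  have "finite W" using assms finite_vertices by auto
  then show ?thesis using assms
  proof (induction W rule: finite_psubset_induct)
    case (psubset W)
    show ?case
    proof (cases "W = {}")
      case True
      then show ?thesis using coh_empty_imp_0 psubset.prems by fastforce
    next
      case False
      then obtain u where u: "u \<in> W" by auto
      obtain p where p: "q = Suc p" using psubset.prems by (cases q) auto
      have "\<not> coh q (W - {u})" using u psubset by auto
      moreover have "\<not> coh p (nonnbrs u W)"
      proof (rule no_coh_two_arcs)
        show s: "nonnbrs u W \<subseteq> V" using psubset.prems by (auto simp: nonnbrs_def)
        have "card {w \<in> nonnbrs u W. off u w \<in> {k - 1, k}} \<le> card {k - 1, k}"
          using s by (rule card_off_preimage) auto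
        then show "card {w \<in> nonnbrs u W. off u w \<in> {k - 1, k}} + 2 \<le> p"
          using psubset.prems p by simp
      qed (use nonnbrs_off psubset.prems u in blast)
      ultimately show ?thesis using coh_cases u p by blast
    qed
  qed
qed

lemma closed_under_add:
  assumes "W \<subseteq> V" "W \<noteq> {}" "\<And>u. u \<in> W \<Longrightarrow> (u + d) mod n \<in> W" "\<And>v w. v \<in> V \<Longrightarrow> w \<in> V \<Longrightarrow> \<exists>i\<ge>0. w = (v + d * i) mod n"
  shows "W = V"
proof -
  obtain w where w: "w \<in> W" using assms by auto
  have "(w + d * int i) mod n \<in> W" for i
  proof (induction i)
    case 0
    then show ?case using w assms(1) by auto
  next
    case (Suc i)
    have "((w + d * int i) mod n + d) mod n = (w + d * int (Suc i)) mod n"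
      by (simp add: mod_simps algebra_simps)
    then show ?case using assms(3)[OF Suc] by simp
  qed
  then have "v \<in> W" if "v \<in> V" for v
    using assms(4)[of w v] that w assms(1) by (metis nonneg_int_cases subsetD)
  then show ?thesis using assms(1) by blast
qed

text \<open>
  A proper nonempty subset contains a vertex \<open>u\<close> whose successor \<open>u +
  1\<close>, the point at offset \<open>k\<close> from \<open>u\<close>, is missing. The link of
  \<open>u\<close> has then no cohomology in degree 3, and \<open>u\<close> may be deleted.
\<close>

lemma coh_4_full:
  assumes "coh 4 W" "W \<subseteq> V" shows "W = V"
proof -
  have "finite W" using assms finite_vertices by auto
  then show ?thesis using assms
  proof (induction W rule: finite_psubset_induct)
    case (psubset W)
    show ?case
    proof (rule ccontr)
      assume "W \<noteq> V"
      moreover have "W \<noteq> {}" using coh_empty_imp_0 psubset.prems by fastforce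
      moreover have "\<exists>i\<ge>0. w = (v + 1 * i) mod n" if "v \<in> V" "w \<in> V" for v w
        using add_step[OF that(2), of v] step_range[of v w] by auto
      ultimately obtain u where u: "u \<in> W" "(u + 1) mod n \<notin> W"
        using closed_under_add[of W 1] psubset.prems by blast
      have uk: "off u ((u + 1) mod n) = k" using off_add[of u u 1] k3 by simp
      have "\<not> coh 3 (nonnbrs u W)"
      proof (rule no_coh_two_arcs)
        show s: "nonnbrs u W \<subseteq> V" using psubset.prems by (auto simp: nonnbrs_def)
        have "off u w \<noteq> k" if "w \<in> nonnbrs u W" for w
          using that off_eqD[of u w "(u + 1) mod n"] uk u s vertex by (auto simp: nonnbrs_def)
        then have "{w \<in> nonnbrs u W. off u w \<in> {k - 1, k}} = {w \<in> nonnbrs u W. off u w \<in> {k - 1}}"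
          by auto
        moreover have "card {w \<in> nonnbrs u W. off u w \<in> {k - 1}} \<le> card {k - 1}"
          using s by (rule card_off_preimage) auto
        ultimately show "card {w \<in> nonnbrs u W. off u w \<in> {k - 1, k}} + 2 \<le> 3" by simp
      qed (use nonnbrs_off psubset.prems u in blast)
      moreover have "4 = Suc 3" by simp
      ultimately have "coh 4 (W - {u})" using coh_cases[of 3 W u] u psubset.prems by metis
      then have "W - {u} = V" using psubset.IH[of "W - {u}"] u psubset.prems by blast
      then show False using u psubset.prems by auto
    qed
  qed
qed

section \<open>Degree 3\<close>

text \<open>
  The last vertex \<open>m\<close> of the segment is dominated by \<open>m - 3\<close>, the point
  next to it on the cycle: the only point within distance \<open>k\<close> of \<open>m\<close> but
  not of \<open>m - 3\<close> is the one at distance \<open>k\<close> after \<open>m\<close>,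
  whose label is \<open>m + 1\<close>. Deleting last vertices leads to segments with at most three
  elements, which are simplices.
\<close>

lemma no_coh_path:
  assumes "1 \<le> m" "m < n" shows "\<not> coh q {w \<in> V. step x w \<in> {1..m}}"
  using assms
proof (induction m rule: int_ge_induct)
  case base
  show ?case
    by (rule no_coh_isolated[of "(x + 1) mod n"]) (use base k3 in \<open>auto simp: adj_step[of _ _ x]\<close>)
next
  case (step m)
  show ?case
  proof (cases "m + 1 \<le> 3")
    case True
    show ?thesis
      by (rule no_coh_isolated[of "(x + 1) mod n"])
        (use True step k3 in \<open>auto simp: adj_step[of _ _ x]\<close>)
  next
    case False
    define u v where "u = (x + (m + 1)) mod n" and "v = (x + (m - 2)) mod n"
    have u: "u \<in> V" "step x u = m + 1" and v: "v \<in> V" "step x v = m - 2"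
      using step False vertex by (auto simp: u_def v_def simp del: atLeastLessThan_iff)
    have wu: "w = u \<longleftrightarrow> step x w = m + 1" if "w \<in> V" for w
      using that u add_step by metis
    have eq: "{w \<in> V. step x w \<in> {1..m}} = {w \<in> V. step x w \<in> {1..m+1}} - {u}"
    proof (rule set_eqI)
      show "w \<in> {w \<in> V. step x w \<in> {1..m}} \<longleftrightarrow> w \<in> {w \<in> V. step x w \<in> {1..m+1}} - {u}" for w
      proof (cases "w \<in> V")
        case True
        have "step x w \<in> {1..m} \<longleftrightarrow> step x w \<in> {1..m+1} \<and> step x w \<noteq> m + 1"
          unfolding atLeastAtMost_iff by linarith
        then show ?thesis using True wu[OF True] by blast
      qed blast
    qed
    show ?thesis
    proof
      assume "coh q {w \<in> V. step x w \<in> {1..m+1}}"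
      then have "coh q ({w \<in> V. step x w \<in> {1..m+1}} - {u})"
      proof (rule coh_remove_dominated)
        show "u \<noteq> v" using u v by auto
        show "adj u w" if "w \<in> {w \<in> V. step x w \<in> {1..m+1}}" "adj v w" for w
        proof -
          define t where "t = step x w"
          have t: "1 \<le> t" "t \<le> m + 1" using that by (auto simp: t_def)
          have vt: "\<bar>m - 2 - t\<bar> mod 3 = 1" "4 \<le> \<bar>m - 2 - t\<bar>"
            using that(2) unfolding adj_step[of _ _ x] v t_def by auto
          then have lt: "t \<le> m - 6" using t by linarith
          then have "(m - 2 - t) mod 3 = 1" using vt by simp
          then have "(m + 1 - t) mod 3 = 1 \<and> m + 1 - t \<le> 3 * k - 5"
            using t step.prems by presburger
          then show ?thesis using lt unfolding adj_step[of _ _ x] u t_def by simp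
        qed
      qed (use u v False in auto)
      then show False using step eq by simp
    qed
  qed
qed

lemma mod_wrap: "0 \<le> a \<Longrightarrow> a < 2 * n \<Longrightarrow> a mod n = (if a < n then a else a - n)"
  using mod_pos_pos_trivial[of a n] mod_pos_pos_trivial[of "a - n" n] minus_mod_self2[of a n] by simp

lemma no_coh_minus_vertex:
  assumes "x \<in> V" shows "\<not> coh q (V - {x})"
proof -
  have "step x w \<in> {1..n-1} \<longleftrightarrow> w \<noteq> x" if "w \<in> V" for w
  proof -
    have "step x w = 0 \<longleftrightarrow> w = x"
      using add_step[OF that, of x] assms by (auto simp: step_def)
    then show ?thesis using step_range[of x w] unfolding atLeastAtMost_iff by linarith
  qed
  then have "V - {x} = {w \<in> V. step x w \<in> {1..n-1}}" by blast
  then show ?thesis using no_coh_path[of "n - 1" q x] k3 by simp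
qed

section \<open>Degree 2\<close>

text \<open>
  Consecutive labels are points that go once around the cycle with gaps \<open>k\<close>,
  \<open>k\<close> and \<open>k - 1\<close>. Any other point \<open>u\<close> lies in one of these
  gaps, whose ends \<open>y\<close> and \<open>z\<close> connect the two arcs of the link of
  \<open>u\<close>; so \<open>u\<close> may be deleted until only the simplex on the three points
  is left.
\<close>

lemma no_coh_2_triangle:
  assumes "W \<subseteq> V" "x \<in> W" "(x + 1) mod n \<in> W" "(x + 2) mod n \<in> W"
  shows "\<not> coh 2 W"
proof -
  have "finite W" using assms finite_vertices by auto
  then show ?thesis using assms
  proof (induction W rule: finite_psubset_induct)
    case (psubset W)
    define x1 x2 where "x1 = (x + 1) mod n" and "x2 = (x + 2) mod n"
    have x: "x \<in> V" "x1 \<in> W" "x2 \<in> W" "x1 \<in> V" "x2 \<in> V" using psubset.prems vertex by (auto simp: x1_def x2_def)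
    have st: "step x x = 0" "step x x1 = 1" "step x x2 = 2"
      using k3 step_add[of x 1] step_add[of x 2] by (auto simp: step_def x1_def x2_def mod_simps)
    have clique: "\<not> adj a b" if "a \<in> {x, x1, x2}" "b \<in> {x, x1, x2}" for a b
      using that st unfolding adj_step[of _ _ x] by auto
    show ?case
    proof (cases "W = {x, x1, x2}")
      case True
      then show ?thesis using clique by (intro no_coh_isolated[of x]) auto
    next
      case False
      then obtain u where u: "u \<in> W" "u \<notin> {x, x1, x2}" using psubset.prems x by blast
      have uV: "u \<in> V" using u psubset.prems by auto
      define p where "p = off u x"
      have o1: "off u x1 = (p + k) mod n" and o2: "off u x2 = (p + 2 * k) mod n"
        unfolding x1_def x2_def p_def off_add by (simp_all only: mult_1_right mult.commute[of k])
      have nz: "off u x \<noteq> 0" "off u x1 \<noteq> 0" "off u x2 \<noteq> 0"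
        using off_eqD[of u u] u x uV by auto
      have p: "0 < p" "p < n" using off_range[of u x] nz by (auto simp: p_def)
      have m1: "off u x1 = (if p + k < n then p + k else p + k - n)"
        unfolding o1 by (rule mod_wrap) (use p k3 in auto)
      have m2: "off u x2 = (if p + 2 * k < n then p + 2 * k else p + 2 * k - n)"
        unfolding o2 by (rule mod_wrap) (use p k3 in auto)
      have "\<exists>y\<in>{x, x1, x2}. \<exists>z\<in>{x, x1, x2}. off u y \<in> {1..k} \<and> off u z \<in> {2 * k - 1..3 * k - 2}"
      proof -
        consider "p < k" | "p = k" | "k < p" "p < 2 * k - 1" | "p = 2 * k - 1" | "2 * k \<le> p" by linarith
        then show ?thesis
        proof cases
          case 1 then show ?thesis using p k3 m1 m2 nz by (intro bexI[of _ x] bexI[of _ x2]) (auto simp: p_def[symmetric] split: if_splits)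
        next
          case 2 then show ?thesis using p k3 m1 m2 by (intro bexI[of _ x] bexI[of _ x1]) (auto simp: p_def[symmetric])
        next
          case 3 then show ?thesis using p k3 m1 m2 by (intro bexI[of _ x2] bexI[of _ x1]) (auto simp: p_def[symmetric])
        next
          case 4 then show ?thesis using nz m1 by simp
        next
          case 5 then show ?thesis using p k3 m1 m2 by (intro bexI[of _ x1] bexI[of _ x]) (auto simp: p_def[symmetric])
        qed
      qed
      then obtain y z where yz: "y \<in> {x, x1, x2}" "z \<in> {x, x1, x2}"
        "off u y \<in> {1..k}" "off u z \<in> {2 * k - 1..3 * k - 2}" by blast
      have yzW: "y \<in> W" "z \<in> W" "y \<noteq> u" "z \<noteq> u" using yz x psubset.prems u by auto
      have "\<not> adj u y" "\<not> adj u z" using yz unfolding adj_off[of _ _ u] by auto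
      with yzW have yzL: "y \<in> nonnbrs u W" "z \<in> nonnbrs u W" by (auto simp: nonnbrs_def)
      have "\<not> coh (Suc 0) (nonnbrs u W)"
      proof (rule no_coh_1_connected[OF _ yzL])
        show "finite (nonnbrs u W)" using psubset.hyps by (simp add: nonnbrs_def)
        show "\<not> adj y z" using clique yz by blast
        show "\<not> adj w y \<or> \<not> adj w z" if "w \<in> nonnbrs u W" for w
          using nonnbrs_off[OF that psubset.prems(1) uV] yz unfolding adj_off[of _ _ u] by auto
      qed
      moreover have "\<not> coh 2 (W - {u})"
        using u x psubset.prems by (intro psubset.IH) (auto simp flip: x1_def x2_def)
      ultimately show ?thesis using coh_cases[of "Suc 0" W u] u unfolding numeral_2_eq_2 by blast
    qed
  qed
qed

text \<open>
  The points lie on an interval of length \<open>2 k - 1\<close>. On it no two points are near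
  each other around the back, so the link of the first point is a simplex.
\<close>

lemma no_coh_interval:
  assumes "W \<subseteq> V" "\<And>w. w \<in> W \<Longrightarrow> k \<le> off x w" "2 \<le> q"
  shows "\<not> coh q W"
proof -
  have "finite W" using assms finite_vertices by auto
  then show ?thesis using assms
  proof (induction W rule: finite_psubset_induct)
    case (psubset W)
    show ?case
    proof (cases "W = {}")
      case True
      then show ?thesis using coh_empty_imp_0 psubset.prems by fastforce
    next
      case False
      define u where "u = arg_min_on (off x) W"
      have u: "u \<in> W" "\<And>w. w \<in> W \<Longrightarrow> off x u \<le> off x w"
        using arg_min_if_finite[OF psubset.hyps(1) False, of "off x"] by (auto simp: u_def not_less)
      obtain p where p: "q = Suc (Suc p)" using psubset.prems by (metis Suc_1 add_2_eq_Suc le_Suc_ex)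
      have "\<not> coh (Suc p) (nonnbrs u W)"
      proof (rule no_coh_edgeless)
        fix v w assume "v \<in> nonnbrs u W" "w \<in> nonnbrs u W"
        then have vw: "v \<in> W" "w \<in> W" "\<not> adj u v" "\<not> adj u w" by (auto simp: nonnbrs_def)
        have "off x v < n" "off x w < n" "k \<le> off x u"
          using off_range psubset.prems u by auto
        then show "\<not> adj v w" using vw u(2)[of v] u(2)[of w] unfolding adj_off[of _ _ x] by auto
      qed
      moreover have "\<not> coh q (W - {u})" by (rule psubset.IH) (use u psubset.prems in auto)
      ultimately show ?thesis using coh_cases u p by blast
    qed
  qed
qed

text \<open>
  Otherwise at most \<open>k\<close> vertices are missing, and by \<open>no_coh_2_triangle\<close>
  every three consecutive labels contain a missing one. Counting blocks of three, no two missing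
  labels are \<open>3 j + 1\<close> steps apart with \<open>0 \<le> j < k\<close>
  (\<open>excl\<close>), and therefore they are \<open>z, z + 3, \<dots>, z + 3 (k - 1)\<close>,
  which are \<open>k\<close> neighbouring points of the cycle. What is left is an interval.
\<close>

lemma coh_2_card:
  assumes "coh 2 W" "W \<subseteq> V" shows "int (card W) \<le> 2 * k - 2"
proof (rule ccontr)
  assume "\<not> int (card W) \<le> 2 * k - 2"
  then have W: "2 * k - 1 \<le> int (card W)" by simp
  define M where "M = V - W"
  have fM: "finite M" by (simp add: M_def)
  have "int (card M) = n - int (card W)"
    using card_Diff_subset[OF finite_vertices[OF assms(2)] assms(2)] card_mono[OF _ assms(2)] k3
    by (simp add: M_def of_nat_diff)
  then have cM: "int (card M) \<le> k" using W by simp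
  have hit: "\<exists>w\<in>M. step y w \<in> {s, s + 1, s + 2}" if s: "0 \<le> s" "s + 2 < n" for y s
  proof -
    define x where "x = (y + s) mod n"
    have "x \<in> M \<or> (x + 1) mod n \<in> M \<or> (x + 2) mod n \<in> M"
      using no_coh_2_triangle[OF assms(2), of x] assms vertex unfolding M_def x_def by blast
    moreover have "step y ((x + i) mod n) = (s + i) mod n" for i
      using step_add[of y "s + i"] by (simp add: x_def mod_simps add.assoc)
    from this[of 0] this[of 1] this[of 2] have "step y x = s" "step y ((x + 1) mod n) = s + 1" "step y ((x + 2) mod n) = s + 2"
      using s by (auto simp: x_def)
    ultimately show ?thesis by blast
  qed
  have excl: "(y + (3 * j + 1)) mod n \<notin> M" if y: "y \<in> M" and j: "0 \<le> j" "j \<le> k - 1" for y j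
  proof
    assume z: "(y + (3 * j + 1)) mod n \<in> M"
    \<comment> \<open>\<open>g\<close> numbers the missing label \<open>y\<close>, the \<open>k - 1\<close> blocks
      of three that cover the steps other than 0 and \<open>3 j + 1\<close>, and that last
      step; all these \<open>k + 1\<close> numbers would occur.\<close>
    define g where "g = (\<lambda>t. if t = 0 then 0 else if t \<le> 3 * j then (t + 2) div 3
      else if t = 3 * j + 1 then k else (t + 1) div 3 :: int)"
    have "i \<in> (g \<circ> step y) ` M" if i: "i \<in> {0..k}" for i
    proof -
      consider "i = 0" | "i = k" | "1 \<le> i" "i \<le> j" | "j < i" "i < k" using i by fastforce
      then show ?thesis
      proof cases
        case 1
        have "step y y = 0" by (simp add: step_def)
        then show ?thesis using y 1 by (force simp: g_def image_iff)
      next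
        case 2
        have "step y ((y + (3 * j + 1)) mod n) = 3 * j + 1"
          unfolding step_add using j by (intro mod_pos_pos_trivial) auto
        then have "(g \<circ> step y) ((y + (3 * j + 1)) mod n) = k" using j by (simp add: g_def)
        then show ?thesis using z 2 by (metis imageI)
      next
        case 3
        obtain w where w: "w \<in> M" "step y w \<in> {3 * i - 2, 3 * i - 2 + 1, 3 * i - 2 + 2}"
          using hit[of "3 * i - 2" y] 3 j k3 by auto
        define t where "t = step y w"
        have t: "3 * i - 2 \<le> t" "t \<le> 3 * i" using w by (auto simp: t_def)
        then have "(t + 2) div 3 = i" by presburger
        then have "g t = i" using 3 t by (auto simp: g_def)
        then show ?thesis using w by (intro image_eqI[of _ _ w]) (auto simp: t_def)
      next
        case 4
        obtain w where w: "w \<in> M" "step y w \<in> {3 * i - 1, 3 * i - 1 + 1, 3 * i - 1 + 2}"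
          using hit[of "3 * i - 1" y] 4 j k3 by auto
        define t where "t = step y w"
        have t: "3 * i - 1 \<le> t" "t \<le> 3 * i + 1" using w by (auto simp: t_def)
        then have "(t + 1) div 3 = i" by presburger
        then have "g t = i" using 4 j t by (auto simp: g_def)
        then show ?thesis using w by (intro image_eqI[of _ _ w]) (auto simp: t_def)
      qed
    qed
    then have "card {0..k} \<le> card ((g \<circ> step y) ` M)" using fM by (intro card_mono) auto
    also have "\<dots> \<le> card M" using fM by (rule card_image_le)
    finally show False using cM by simp
  qed
  have "M \<noteq> {}" using hit[of 0 0] k3 by auto
  moreover have "M \<noteq> V"
  proof
    assume "M = V"
    then have "W = {}" using assms(2) unfolding M_def by blast
    then show False using W k3 by simp
  qed
  moreover have "\<exists>i\<ge>0. w = (v + 3 * i) mod n" if "v \<in> V" "w \<in> V" for v w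
    by (rule exI[of _ "off v w"]) (simp add: add3_off[OF that(2)] off_range)
  ultimately obtain y where y: "y \<in> M" "(y + 3) mod n \<notin> M"
    using closed_under_add[of M 3] unfolding M_def by blast
  have yV: "y \<in> V" using y by (simp add: M_def)
  define z where "z = (y + 2) mod n"
  have in_M: "(y + (3 * i + 2)) mod n \<in> M" if ex: "(y + (3 * i + 3)) mod n \<notin> M" and i: "0 \<le> i" "i \<le> k - 2" for i
  proof -
    obtain w where w: "w \<in> M" "step y w \<in> {3 * i + 1, 3 * i + 1 + 1, 3 * i + 1 + 2}"
      using hit[of "3 * i + 1" y] i by auto
    have wV: "(y + step y w) mod n = w" using w add_step by (auto simp: M_def)
    have "step y w \<noteq> 3 * i + 1" using excl[OF y(1), of i] i w wV by auto
    moreover have "step y w \<noteq> 3 * i + 3" using ex w wV by auto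
    ultimately have "step y w = 3 * i + 2" using w by auto
    then show ?thesis using w wV by simp
  qed
  have zM: "z \<in> M" using in_M[of 0] y(2) k3 by (simp add: z_def)
  have z_add: "(z + c) mod n = (y + (2 + c)) mod n" for c
    by (simp add: z_def mod_simps add.assoc)
  have arc: "(z + 3 * i) mod n \<in> M" if i: "0 \<le> i" "i \<le> k - 1" for i
  proof (cases "i = k - 1")
    case True
    then have e: "2 + 3 * i = n" by simp
    have "(z + 3 * i) mod n = (y + n) mod n" by (simp only: z_add e)
    also have "\<dots> = y" using yV by simp
    finally show ?thesis using y by simp
  next
    case False
    then have k2: "i \<le> k - 2" using i by simp
    have "(z + (3 * i + 1)) mod n \<notin> M" using excl[OF zM, of i] i by simp
    then have "(y + (3 * i + 3)) mod n \<notin> M" unfolding z_add by (simp add: add.commute)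
    then have "(y + (3 * i + 2)) mod n \<in> M" by (rule in_M) (use i k2 in auto)
    then show ?thesis unfolding z_add by (simp add: add.commute)
  qed
  have "k \<le> off z w" if "w \<in> W" for w
  proof (rule ccontr)
    assume "\<not> k \<le> off z w"
    then have "(z + 3 * off z w) mod n \<in> M" using arc off_range[of z w] by simp
    then show False using add3_off[of w z] that assms(2) by (auto simp: M_def)
  qed
  then show False using no_coh_interval[of W z 2] assms by auto
qed

lemma coh_3_card:
  assumes "coh 3 W" "W \<subseteq> V" shows "int (card W) \<le> 3 * k - 3"
proof (rule ccontr)
  assume "\<not> int (card W) \<le> 3 * k - 3"
  moreover have "int (card (V - W)) = n - int (card W)"
    using card_Diff_subset[OF finite_vertices[OF assms(2)] assms(2)] card_mono[OF _ assms(2)] k3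
    by (simp add: of_nat_diff)
  ultimately have "card (V - W) \<le> 1" by simp
  then consider "V - W = {}" | x where "V - W = {x}"
    by (metis One_nat_def card_0_eq card_1_singletonE finite_Diff finite_atLeastLessThan_int le_Suc_eq le_zero_eq)
  then show False
  proof cases
    case 1
    then have W: "W = V" using assms(2) by auto
    have 0: "0 \<in> V" using k3 by simp
    have three: "3 = Suc 2" by simp
    \<comment> \<open>The link of a vertex in the full complex has \<open>2 k\<close> vertices, too many for
      cohomology in degree 2.\<close>
    have "coh 2 (nonnbrs 0 V)"
      using coh_cases[of 2 V 0] assms(1) no_coh_minus_vertex[OF 0] 0 unfolding W three by blast
    moreover have "nonnbrs 0 V \<subseteq> V" by (auto simp: nonnbrs_def)
    ultimately have "int (card (nonnbrs 0 V)) \<le> 2 * k - 2" by (rule coh_2_card)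
    moreover have "(\<lambda>i. (3 * i) mod n) ` ({1..k} \<union> {2*k-1..3*k-2}) \<subseteq> nonnbrs 0 V"
    proof
      fix w assume "w \<in> (\<lambda>i. (3 * i) mod n) ` ({1..k} \<union> {2*k-1..3*k-2})"
      then obtain i where i: "i \<in> {1..k} \<union> {2*k-1..3*k-2}" "w = (3 * i) mod n" by blast
      have o: "off 0 w = i" using off_add3[of 0 0 i] i k3 by auto
      then have "w \<noteq> 0" using i by auto
      moreover have "\<not> adj 0 w" using i o unfolding adj_off[of _ _ 0] by auto
      moreover have "w \<in> V" unfolding i(2) by (rule vertex)
      ultimately show "w \<in> nonnbrs 0 V" by (simp add: nonnbrs_def)
    qed
    then have "card ((\<lambda>i. (3 * i) mod n) ` ({1..k} \<union> {2*k-1..3*k-2})) \<le> card (nonnbrs 0 V)"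
      using finite_vertices[OF \<open>nonnbrs 0 V \<subseteq> V\<close>] by (intro card_mono)
    moreover have "inj_on (\<lambda>i. (3 * i) mod n) ({1..k} \<union> {2*k-1..3*k-2})"
      using off_add3[of 0 0] k3 by (intro inj_on_inverseI[of _ "off 0"]) auto
    then have "card ((\<lambda>i. (3 * i) mod n) ` ({1..k} \<union> {2*k-1..3*k-2})) = card ({1..k} \<union> {2*k-1..3*k-2})"
      by (rule card_image)
    moreover have "card ({1..k} \<union> {2*k-1..3*k-2}) = card {1..k} + card {2*k-1..3*k-2}"
      using k3 by (intro card_Un_disjoint) auto
    ultimately show False using k3 by simp
  next
    case (2 x)
    then have "W = V - {x}" "x \<in> V" using assms(2) by auto
    then show False using no_coh_minus_vertex assms(1) by blast
  qed
qed

section \<open>Degree 1\<close>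

text \<open>
  The point with the smallest offset may be deleted because its successor lies in its link.
\<close>

lemma no_coh_1_if_gaps_small:
  assumes "X \<subseteq> V"
    "\<And>p. p \<in> X \<Longrightarrow> (\<forall>w\<in>X. off x w \<le> off x p) \<or> (\<exists>w\<in>X. off x p < off x w \<and> off x w \<le> off x p + k)"
  shows "\<not> coh 1 X"
proof -
  have "finite X" using assms finite_vertices by auto
  then show ?thesis using assms
  proof (induction X rule: finite_psubset_induct)
    case (psubset X)
    show ?case
    proof (cases "X = {}")
      case True
      then show ?thesis using coh_empty_imp_0 by fastforce
    next
      case False
      define u where "u = arg_min_on (off x) X"
      have u: "u \<in> X" "\<And>w. w \<in> X \<Longrightarrow> off x u \<le> off x w"
        using arg_min_if_finite[OF psubset.hyps(1) False, of "off x"] by (auto simp: u_def not_less)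
      from psubset.prems(2)[OF u(1)] show ?thesis
      proof
        assume "\<forall>w\<in>X. off x w \<le> off x u"
        then have "off x w = off x u" if "w \<in> X" for w using u that by force
        then have "X = {u}" using u(1) off_eqD psubset.prems(1) by blast
        then show ?thesis using irrefl by (intro no_coh_isolated[of u]) auto
      next
        assume "\<exists>w\<in>X. off x u < off x w \<and> off x w \<le> off x u + k"
        then obtain w where w: "w \<in> X" "off x u < off x w" "off x w \<le> off x u + k" by blast
        then have "w \<in> nonnbrs u X" by (auto simp: nonnbrs_def adj_off[of _ _ x])
        then have "\<not> coh 0 (nonnbrs u X)" using coh_0_imp_empty by blast
        moreover have "\<not> coh 1 (X - {u})"
        proof (rule psubset.IH)
          fix p assume p: "p \<in> X - {u}"
          then show "(\<forall>w\<in>X - {u}. off x w \<le> off x p) \<or> (\<exists>w\<in>X - {u}. off x p < off x w \<and> off x w \<le> off x p + k)"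
            using psubset.prems(2)[of p] u(2)[of p] by (metis DiffD1 DiffI leD singletonD)
        qed (use u psubset.prems in auto)
        ultimately show ?thesis using coh_cases[of 0 X u] u by auto
      qed
    qed
  qed
qed

text \<open>
  Applied with any base point, \<open>no_coh_1_if_gaps_small\<close> gives a gap of
  \<open>W\<close> of length more than \<open>k\<close>. Applied with the first point of that gap
  as base point, it gives a second one. The two gaps contain \<open>2 k\<close> missing points.
\<close>

lemma coh_1_card:
  assumes "coh 1 W" "W \<subseteq> V" shows "int (card W) \<le> k - 1"
proof -
  obtain p q where pq: "p \<in> W" "q \<in> W" "off 0 p < off 0 q"
    "\<And>w. w \<in> W \<Longrightarrow> off 0 p < off 0 w \<Longrightarrow> off 0 p + k < off 0 w"
    using no_coh_1_if_gaps_small[OF assms(2), of 0] assms(1) by (meson not_le)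
  have rebase: "off p w = (off 0 w - off 0 p) mod n" for w
    by (simp add: off_def mod_simps right_diff_distrib)
  have gap: "w = p \<or> k < off p w" if w: "w \<in> W" for w
  proof (cases "off 0 p \<le> off 0 w")
    case True
    then have "off p w = off 0 w - off 0 p"
      unfolding rebase using off_range[of 0 p] off_range[of 0 w] by (intro mod_pos_pos_trivial) auto
    moreover have "off 0 p = off 0 w \<Longrightarrow> w = p" using off_eqD[of 0 w p] w pq(1) assms(2) by (metis subsetD)
    ultimately show ?thesis using pq(4)[OF w] True by linarith
  next
    case False
    have "off p w = (off 0 w - off 0 p + n) mod n" unfolding rebase by simp
    also have "\<dots> = off 0 w - off 0 p + n"
      using False off_range[of 0 p] off_range[of 0 w] by (intro mod_pos_pos_trivial) auto
    finally show ?thesis using pq(4)[OF pq(2,3)] off_range[of 0 q] off_range[of 0 w] by linarith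
  qed
  \<comment> \<open>\<open>b\<close> is the point following \<open>p\<close> on the cycle, so that
    \<open>p\<close> itself has the last offset.\<close>
  define b where "b = (p + 3) mod n"
  have offb: "off b w = (off p w - 1) mod n" for w
  proof -
    have "[k * (w - (p + 3) mod n) = k * (w - (p + 3))] (mod n)"
      by (intro cong_mult cong_diff cong_refl) simp
    also have "k * (w - (p + 3)) = k * (w - p) - 3 * k" by (simp add: algebra_simps)
    also have "[k * (w - p) - 3 * k = k * (w - p) - 1] (mod n)"
      by (intro cong_diff three_k cong_refl)
    finally show ?thesis unfolding off_def b_def by (simp add: cong_def mod_simps)
  qed
  have bp: "off b p = n - 1" using offb[of p] k3 by (simp add: zmod_minus1)
  have bw: "k \<le> off b w" if "w \<in> W" for w
  proof (cases "w = p")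
    case False
    then have "k < off p w" using gap[OF that] by simp
    then have "off b w = off p w - 1"
      unfolding offb using off_range[of p w] k3 by (intro mod_pos_pos_trivial) auto
    then show ?thesis using \<open>k < off p w\<close> by simp
  qed (use bp k3 in simp)
  obtain s where s: "s \<in> W" "\<exists>w\<in>W. off b s < off b w"
    "\<And>w. w \<in> W \<Longrightarrow> off b s < off b w \<Longrightarrow> off b s + k < off b w"
    using no_coh_1_if_gaps_small[OF assms(2), of b] assms(1) by (meson not_le)
  define t where "t = off b s"
  obtain w where "off b s < off b w" using s(2) by blast
  then have "t \<noteq> n - 1" using off_range(2)[of b w] unfolding t_def by linarith
  then have "t < off b p" using bp off_range[of b s] unfolding t_def by simp
  then have tk: "t + k < n - 1" using s(3)[OF pq(1)] bp by (simp add: t_def)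
  have kt: "k \<le> t" using bw[OF s(1)] by (simp add: t_def)
  have "off b ` W \<subseteq> {k..t} \<union> {t + k + 1..n - 1}"
  proof
    fix i assume "i \<in> off b ` W"
    then obtain w where w: "w \<in> W" "i = off b w" by blast
    then show "i \<in> {k..t} \<union> {t + k + 1..n - 1}"
      using bw[OF w(1)] s(3)[OF w(1)] off_range(2)[of b w] unfolding t_def
      by (cases "off b s < off b w") auto
  qed
  then have "card (off b ` W) \<le> card ({k..t} \<union> {t + k + 1..n - 1})" by (intro card_mono) auto
  also have "\<dots> \<le> card {k..t} + card {t + k + 1..n - 1}" by (rule card_Un_le)
  finally have "int (card (off b ` W)) \<le> (t - k + 1) + (n - 1 - t - k)"
    using kt tk by (simp add: nat_diff_distrib)
  moreover have "card (off b ` W) = card W"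
    using assms(2) off_inj by (intro card_image) (auto intro: inj_on_subset)
  ultimately show ?thesis by simp
qed

section \<open>Nonvanishing\<close>

abbreviation far :: "int \<Rightarrow> int \<Rightarrow> bool" where
  "far i j \<equiv> k + 1 \<le> \<bar>i - j\<bar> \<and> \<bar>i - j\<bar> \<le> 2 * k - 2"

definition vtx :: "int \<Rightarrow> int" where "vtx i = (3 * i) mod n"

lemma off_vtx: "i \<in> {0..<n} \<Longrightarrow> off 0 (vtx i) = i"
  using off_add3[of 0 0 i] by (simp add: vtx_def)

lemma adj_vtx:
  "i \<in> {0..<n} \<Longrightarrow> j \<in> {0..<n} \<Longrightarrow> adj (vtx i) (vtx j) \<longleftrightarrow> far i j"
  by (simp add: adj_off[of _ _ 0] off_vtx)

lemma vtx_inj: "inj_on vtx {0..<n}"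
  by (rule inj_on_inverseI[of _ "off 0"]) (rule off_vtx)

lemma vtx_V: "vtx i \<in> V" using vertex by (simp add: vtx_def)

text \<open>
  \<open>coh_induced_matching\<close> expressed in the positions on the cycle; \<open>p\<close>
  maps the elements of the transversal \<open>F\<close> to their partners.
\<close>

lemma coh_matching_positions:
  assumes "finite F" "inj_on p F" "F \<inter> p ` F = {}" "F \<union> p ` F \<subseteq> P" "P \<subseteq> {0..<n}"
    and edges: "\<And>i j. i \<in> F \<union> p ` F \<Longrightarrow> j \<in> F \<union> p ` F \<Longrightarrow>
      far i j \<longleftrightarrow> (i \<in> F \<and> j = p i) \<or> (j \<in> F \<and> i = p j)"
    and maximal: "\<And>i. i \<in> P \<Longrightarrow> i \<notin> F \<Longrightarrow> \<exists>f\<in>F. far i f"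
  shows "coh (card F) (vtx ` P)"
proof -
  define p' where "p' = vtx \<circ> p \<circ> off 0"
  have FP: "F \<subseteq> {0..<n}" "p ` F \<subseteq> {0..<n}" using assms by auto
  have p': "p' (vtx i) = vtx (p i)" if "i \<in> F" for i
    using that FP by (simp add: p'_def off_vtx subset_iff)
  have im: "p' ` vtx ` F = vtx ` p ` F" using p' by (auto simp: image_iff)
  have eq: "vtx i = vtx j \<longleftrightarrow> i = j" if "i \<in> P" "j \<in> P" for i j
    using that assms(5) vtx_inj by (meson inj_on_eq_iff subsetD)
  have PF: "i \<in> P" "p i \<in> P" if "i \<in> F" for i using that assms(4) by auto
  have memF: "vtx i \<in> vtx ` F \<longleftrightarrow> i \<in> F" if "i \<in> P" for i
    using that eq PF by blast
  have "coh (card (vtx ` F)) (vtx ` P)"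
  proof (rule coh_induced_matching[where p = p'])
    show "inj_on p' (vtx ` F)"
      using assms(2) p' eq PF by (auto simp: inj_on_def)
    show "vtx ` F \<inter> p' ` vtx ` F = {}"
      unfolding im using assms(3) eq PF by blast
    show "vtx ` F \<union> p' ` vtx ` F \<subseteq> vtx ` P" unfolding im using assms(4) by auto
    show "\<exists>f\<in>vtx ` F. adj w f" if "w \<in> vtx ` P" "w \<notin> vtx ` F" for w
    proof -
      from that obtain i where i: "i \<in> P" "i \<notin> F" "w = vtx i" by auto
      then obtain f where "f \<in> F" "far i f" using maximal by blast
      then show ?thesis using i FP assms(5) by (intro bexI[of _ "vtx f"]) (auto simp: adj_vtx subset_iff)
    qed
    fix x y assume "x \<in> vtx ` F \<union> p' ` vtx ` F" "y \<in> vtx ` F \<union> p' ` vtx ` F"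
    then obtain i j where ij: "x = vtx i" "y = vtx j" "i \<in> F \<union> p ` F" "j \<in> F \<union> p ` F"
      unfolding im by blast
    then have P: "i \<in> P" "j \<in> P" using assms(4) by auto
    then have "adj x y \<longleftrightarrow> (i \<in> F \<and> j = p i) \<or> (j \<in> F \<and> i = p j)"
      using adj_vtx[of i j] edges[OF ij(3,4)] assms(5) ij by (simp add: subset_iff)
    also have "\<dots> \<longleftrightarrow> (x \<in> vtx ` F \<and> y = p' x) \<or> (y \<in> vtx ` F \<and> x = p' y)"
      using P ij p' eq PF memF by metis
    finally show "adj x y \<longleftrightarrow> (x \<in> vtx ` F \<and> y = p' x) \<or> (y \<in> vtx ` F \<and> x = p' y)" .
  qed (use assms in auto)
  moreover have "card (vtx ` F) = card F"
    using FP vtx_inj by (intro card_image) (auto intro: inj_on_subset)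
  ultimately show ?thesis by simp
qed

text \<open>
  The conditions on \<open>F\<close> are inherited by all sets between the matching and
  \<open>P\<close>.
\<close>

lemma coh_matching_all_sizes:
  assumes "finite F" "inj_on p F" "F \<inter> p ` F = {}" "F \<union> p ` F \<subseteq> P" "P \<subseteq> {0..<n}"
    and edges: "\<And>i j. i \<in> F \<union> p ` F \<Longrightarrow> j \<in> F \<union> p ` F \<Longrightarrow>
      far i j \<longleftrightarrow> (i \<in> F \<and> j = p i) \<or> (j \<in> F \<and> i = p j)"
    and maximal: "\<And>i. i \<in> P \<Longrightarrow> i \<notin> F \<Longrightarrow> \<exists>f\<in>F. far i f"
    and s: "2 * card F \<le> s" "s \<le> card P"
  shows "\<exists>W\<subseteq>V. card W = s \<and> coh (card F) W"
proof -
  have fP: "finite P" using assms(5) finite_subset by blast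
  have "card (F \<union> p ` F) = 2 * card F"
    using assms by (subst card_Un_disjoint) (auto simp: card_image)
  then obtain Q where Q: "F \<union> p ` F \<subseteq> Q" "Q \<subseteq> P" "card Q = s"
    using exists_subset_between[of "F \<union> p ` F" s P] s assms(4) fP by auto
  have "coh (card F) (vtx ` Q)"
  proof (rule coh_matching_positions[OF assms(1-3) Q(1) _ edges])
    show "Q \<subseteq> {0..<n}" using Q(2) assms(5) by (rule subset_trans)
    show "\<exists>f\<in>F. far i f" if "i \<in> Q" "i \<notin> F" for i
      using maximal[of i] that Q(2) by blast
  qed
  moreover have "card (vtx ` Q) = s"
    using card_image[OF inj_on_subset[OF vtx_inj], of Q] Q assms(5) by simp
  ultimately show ?thesis using vtx_V by blast
qed

text \<open>The largest set \<open>P\<close> consists of 0 and all its neighbours.\<close>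

lemma ex_coh_1:
  assumes "2 \<le> s" "int s \<le> k - 1" shows "\<exists>W\<subseteq>V. card W = s \<and> coh 1 W"
proof -
  have "\<exists>W\<subseteq>V. card W = s \<and> coh (card {0::int}) W"
  proof (rule coh_matching_all_sizes[where p = "\<lambda>_. k + 1" and P = "{0} \<union> {k+1..2*k-2}"])
    have "card ({0} \<union> {k+1..2*k-2}) = 1 + card {k+1..2*k-2}" using k3 by simp
    then show "s \<le> card ({0} \<union> {k+1..2*k-2})" using assms k3 by simp
  qed (use k3 assms in \<open>auto split: if_splits\<close>)
  then show ?thesis by simp
qed

text \<open>
  Two arcs on which the graph is bipartite with position \<open>i\<close> on the first and
  \<open>k + 1 + j\<close> on the second adjacent iff \<open>i \<le> j \<le> i + k - 3\<close>.
\<close>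

lemma ex_coh_2:
  assumes "4 \<le> s" "int s \<le> 2 * k - 2" shows "\<exists>W\<subseteq>V. card W = s \<and> coh 2 W"
proof -
  define p :: "int \<Rightarrow> int" where "p = (\<lambda>i. if i = 0 then k + 1 else k - 2)"
  define F where "F = {0, 2 * k - 1}"
  have p: "p 0 = k + 1" "p (2 * k - 1) = k - 2" using k3 by (simp_all add: p_def)
  have pF: "p ` F = {k + 1, k - 2}" by (simp add: F_def p)
  have c: "card F = 2" using k3 by (simp add: F_def card_insert_if)
  have "\<exists>W\<subseteq>V. card W = s \<and> coh (card F) W"
  proof (rule coh_matching_all_sizes[where p = p and P = "{0..k-2} \<union> {k+1..2*k-1}"])
    show "inj_on p F" "F \<inter> p ` F = {}" unfolding pF unfolding F_def using k3 by (simp_all add: p)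
    show "F \<union> p ` F \<subseteq> {0..k-2} \<union> {k+1..2*k-1}" unfolding pF unfolding F_def using k3 by simp
    show "{0..k-2} \<union> {k+1..2*k-1} \<subseteq> {0..<n}" using k3 by auto
    have "card ({0..k-2} \<union> {k+1..2*k-1}) = card {0..k-2} + card {k+1..2*k-1}" by (rule card_Un_disjoint) auto
    then show "s \<le> card ({0..k-2} \<union> {k+1..2*k-1})" using assms k3 by simp
    show "far i j \<longleftrightarrow> (i \<in> F \<and> j = p i) \<or> (j \<in> F \<and> i = p j)"
      if "i \<in> F \<union> p ` F" "j \<in> F \<union> p ` F" for i j
    proof -
      have "i = 0 \<or> i = 2 * k - 1 \<or> i = k + 1 \<or> i = k - 2" "j = 0 \<or> j = 2 * k - 1 \<or> j = k + 1 \<or> j = k - 2"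
        using that unfolding pF unfolding F_def by auto
      then show ?thesis using k3 unfolding F_def by (elim disjE; simp add: p)
    qed
    show "\<exists>f\<in>F. far i f" if "i \<in> {0..k-2} \<union> {k+1..2*k-1}" "i \<notin> F" for i
      using that k3 by (cases "i \<le> k - 2") (auto simp: F_def)
  qed (use assms c in \<open>auto simp: F_def\<close>)
  then show ?thesis unfolding c .
qed

text \<open>
  The points 0, \<open>k\<close> and \<open>2 k\<close> go once around the cycle, and apart from
  themselves their only common non-neighbours are 1 and \<open>2 k - 1\<close>. Without these two
  points they are a maximal independent set.
\<close>

lemma ex_coh_3:
  assumes "6 \<le> s" "int s \<le> 3 * k - 3" shows "\<exists>W\<subseteq>V. card W = s \<and> coh 3 W"
proof -
  define p :: "int \<Rightarrow> int" where "p = (\<lambda>i. if i = 0 then k + 1 else if i = k then 2 * k + 1 else 2)"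
  define F where "F = {0, k, 2 * k}"
  have p: "p 0 = k + 1" "p k = 2 * k + 1" "p (2 * k) = 2" using k3 by (simp_all add: p_def)
  have pF: "p ` F = {k + 1, 2 * k + 1, 2}" by (simp add: F_def p)
  have c: "card F = 3" using k3 by (simp add: F_def card_insert_if)
  have "\<exists>W\<subseteq>V. card W = s \<and> coh (card F) W"
  proof (rule coh_matching_all_sizes[where p = p and P = "{0..<n} - {1, 2*k-1}"])
    show "inj_on p F" "F \<inter> p ` F = {}" unfolding pF unfolding F_def using k3 by (simp_all add: p)
    show "F \<union> p ` F \<subseteq> {0..<n} - {1, 2*k-1}" unfolding pF unfolding F_def using k3 by simp
    have "card ({0..<n} - {1, 2*k-1}) = card {0..<n} - card {1, 2*k-1}"
      using k3 by (intro card_Diff_subset) auto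
    moreover have "card {1, 2*k-1} = 2" using k3 by (simp add: card_insert_if)
    ultimately show "s \<le> card ({0..<n} - {1, 2*k-1})" using assms k3 by simp
    show "far i j \<longleftrightarrow> (i \<in> F \<and> j = p i) \<or> (j \<in> F \<and> i = p j)"
      if "i \<in> F \<union> p ` F" "j \<in> F \<union> p ` F" for i j
    proof -
      have "i = 0 \<or> i = k \<or> i = 2 * k \<or> i = k + 1 \<or> i = 2 * k + 1 \<or> i = 2"
        "j = 0 \<or> j = k \<or> j = 2 * k \<or> j = k + 1 \<or> j = 2 * k + 1 \<or> j = 2"
        using that unfolding pF unfolding F_def by auto
      then show ?thesis using k3 unfolding F_def by (elim disjE; simp add: p)
    qed
    show "\<exists>f\<in>F. far i f" if "i \<in> {0..<n} - {1, 2*k-1}" "i \<notin> F" for i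
    proof -
      have i: "0 \<le> i" "i < n" "i \<noteq> 0" "i \<noteq> 1" "i \<noteq> k" "i \<noteq> 2 * k" "i \<noteq> 2 * k - 1"
        using that unfolding F_def by auto
      then consider "2 \<le> i" "i < k" | "k < i" "i < 2 * k - 1" | "2 * k < i" by linarith
      then show ?thesis
        using i by cases (simp_all add: F_def)
    qed
  qed (use assms c in \<open>auto simp: F_def\<close>)
  then show ?thesis unfolding c .
qed

text \<open>
  The deletion of 0 is acyclic, so the class comes from the link of 0, in which the three pairs
  \<open>(2 k - 1, 1)\<close>, \<open>(k - 1, 2 k)\<close> and \<open>(3 k - 2, k)\<close> form an
  induced matching.
\<close>

lemma coh_4_V: "coh 4 V"
proof -
  have 0: "0 \<in> V" using k3 by simp
  define p :: "int \<Rightarrow> int" where "p = (\<lambda>i. if i = 2 * k - 1 then 1 else if i = k - 1 then 2 * k else k)"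
  define F where "F = {2 * k - 1, k - 1, 3 * k - 2}"
  have p: "p (2 * k - 1) = 1" "p (k - 1) = 2 * k" "p (3 * k - 2) = k" using k3 by (simp_all add: p_def)
  have pF: "p ` F = {1, 2 * k, k}" by (simp add: F_def p)
  have c: "card F = 3" using k3 by (simp add: F_def card_insert_if)
  have "coh (card F) (vtx ` ({1..k} \<union> {2*k-1..3*k-2}))"
  proof (rule coh_matching_positions[where p = p])
    show "inj_on p F" "F \<inter> p ` F = {}" unfolding pF unfolding F_def using k3 by (simp_all add: p)
    show "F \<union> p ` F \<subseteq> {1..k} \<union> {2*k-1..3*k-2}" unfolding pF unfolding F_def using k3 by simp
    show "{1..k} \<union> {2*k-1..3*k-2} \<subseteq> {0..<n}" using k3 by auto
    show "far i j \<longleftrightarrow> (i \<in> F \<and> j = p i) \<or> (j \<in> F \<and> i = p j)"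
      if "i \<in> F \<union> p ` F" "j \<in> F \<union> p ` F" for i j
    proof -
      have "i = 2 * k - 1 \<or> i = k - 1 \<or> i = 3 * k - 2 \<or> i = 1 \<or> i = 2 * k \<or> i = k"
        "j = 2 * k - 1 \<or> j = k - 1 \<or> j = 3 * k - 2 \<or> j = 1 \<or> j = 2 * k \<or> j = k"
        using that unfolding pF unfolding F_def by auto
      then show ?thesis using k3 unfolding F_def by (elim disjE; simp add: p)
    qed
    show "\<exists>f\<in>F. far i f" if "i \<in> {1..k} \<union> {2*k-1..3*k-2}" "i \<notin> F" for i
    proof -
      have i: "1 \<le> i \<and> i < k - 1 \<or> i = k \<or> 2 * k - 1 < i \<and> i < 3 * k - 2"
        using that unfolding F_def by auto
      then show ?thesis
        using k3 by (elim disjE) (simp_all add: F_def)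
    qed
  qed (auto simp: F_def)
  moreover have "vtx ` ({1..k} \<union> {2*k-1..3*k-2}) = nonnbrs 0 V"
  proof (intro equalityI subsetI)
    fix w assume "w \<in> vtx ` ({1..k} \<union> {2*k-1..3*k-2})"
    then obtain i where i: "i \<in> {1..k} \<union> {2*k-1..3*k-2}" "w = vtx i" by blast
    then have o: "off 0 w = i" using k3 by (auto simp: off_vtx)
    then have "w \<noteq> 0" using i by auto
    moreover have "\<not> adj 0 w" using i o unfolding adj_off[of _ _ 0] by auto
    ultimately show "w \<in> nonnbrs 0 V" using i vtx_V by (simp add: nonnbrs_def)
  next
    fix w assume w: "w \<in> nonnbrs 0 V"
    then have "off 0 w \<in> {1..k} \<union> {2*k-1..3*k-2}" using nonnbrs_off 0 by blast
    moreover have "vtx (off 0 w) = w" using add3_off[of w 0] w by (simp add: vtx_def nonnbrs_def)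
    ultimately show "w \<in> vtx ` ({1..k} \<union> {2*k-1..3*k-2})" by (metis imageI)
  qed
  ultimately have "coh 3 (nonnbrs 0 V)" unfolding c by simp
  then have "coh (Suc 3) V" using coh_from_nonnbrs[OF 0] no_coh_minus_vertex[OF 0] by blast
  then show ?thesis by simp
qed

end

section \<open>Subfunctors of free functors and their minimal generators\<close>

text \<open>
  The value at \<open>W\<close> of the free functor with generators of multidegrees \<open>L
  a\<close>, \<open>a < r\<close>: the vector space spanned by the generators whose multidegree is
  contained in \<open>W\<close>. All its transition maps are inclusions.
\<close>

definition supp_mod :: "nat \<Rightarrow> (nat \<Rightarrow> 'v set) \<Rightarrow> 'v set \<Rightarrow> (nat \<Rightarrow> 'k::field) set" where
  "supp_mod r L W = {f. \<forall>a. f a \<noteq> 0 \<longrightarrow> a < r \<and> L a \<subseteq> W}"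

definition lincomb :: "nat \<Rightarrow> (nat \<Rightarrow> 'k::field) \<Rightarrow> (nat \<Rightarrow> nat \<Rightarrow> 'k) \<Rightarrow> nat \<Rightarrow> 'k" where
  "lincomb r f c = (\<lambda>b. \<Sum>a<r. f a * c a b)"

definition subfunctor :: "'v set \<Rightarrow> ('v set \<Rightarrow> (nat \<Rightarrow> 'k::field) set) \<Rightarrow> bool" where
  "subfunctor V Z \<longleftrightarrow>
     (\<forall>W. W \<subseteq> V \<longrightarrow> (\<lambda>_. 0) \<in> Z W \<and> (\<forall>f\<in>Z W. \<forall>g\<in>Z W. (\<lambda>b. f b + g b) \<in> Z W) \<and>
       (\<forall>x. \<forall>f\<in>Z W. (\<lambda>b. x * f b) \<in> Z W)) \<and>
     (\<forall>U W. U \<subseteq> W \<longrightarrow> W \<subseteq> V \<longrightarrow> Z U \<subseteq> Z W)"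

lemma subfunctorD:
  assumes "subfunctor V Z"
  shows subfunctor_zero: "W \<subseteq> V \<Longrightarrow> (\<lambda>_. 0) \<in> Z W"
    and subfunctor_add: "W \<subseteq> V \<Longrightarrow> f \<in> Z W \<Longrightarrow> g \<in> Z W \<Longrightarrow> (\<lambda>b. f b + g b) \<in> Z W"
    and subfunctor_scale: "W \<subseteq> V \<Longrightarrow> f \<in> Z W \<Longrightarrow> (\<lambda>b. x * f b) \<in> Z W"
    and subfunctor_mono: "U \<subseteq> W \<Longrightarrow> W \<subseteq> V \<Longrightarrow> Z U \<subseteq> Z W"
proof -
  have *: "\<forall>W. W \<subseteq> V \<longrightarrow> (\<lambda>_. 0) \<in> Z W \<and> (\<forall>f\<in>Z W. \<forall>g\<in>Z W. (\<lambda>b. f b + g b) \<in> Z W) \<and>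
       (\<forall>x. \<forall>f\<in>Z W. (\<lambda>b. x * f b) \<in> Z W)" "\<forall>U W. U \<subseteq> W \<longrightarrow> W \<subseteq> V \<longrightarrow> Z U \<subseteq> Z W"
    using assms unfolding subfunctor_def by auto
  show "W \<subseteq> V \<Longrightarrow> (\<lambda>_. 0) \<in> Z W" using *(1) by simp
  show "W \<subseteq> V \<Longrightarrow> f \<in> Z W \<Longrightarrow> g \<in> Z W \<Longrightarrow> (\<lambda>b. f b + g b) \<in> Z W" using *(1) by simp
  show "W \<subseteq> V \<Longrightarrow> f \<in> Z W \<Longrightarrow> (\<lambda>b. x * f b) \<in> Z W" using *(1) by simp
  show "U \<subseteq> W \<Longrightarrow> W \<subseteq> V \<Longrightarrow> Z U \<subseteq> Z W" using *(2) by simp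
qed

lemma subfunctor_sum:
  assumes "subfunctor V Z" "W \<subseteq> V" "\<And>a. a \<in> A \<Longrightarrow> x a \<noteq> 0 \<Longrightarrow> f a \<in> Z W"
  shows "(\<lambda>b. \<Sum>a\<in>A. x a * f a b) \<in> Z W"
  using assms(3)
proof (induction A rule: infinite_finite_induct)
  case (insert a A)
  have "(\<lambda>b. \<Sum>a\<in>A. x a * f a b) \<in> Z W" using insert by auto
  moreover have "(\<lambda>b. x a * f a b) \<in> Z W"
    using subfunctor_scale[OF assms(1,2), of "f a" "x a"] insert.prems[of a] subfunctor_zero[OF assms(1,2)]
    by (cases "x a = 0") auto
  ultimately show ?case using subfunctor_add[OF assms(1,2)] insert by simp
qed (use subfunctor_zero[OF assms(1,2)] in auto)

lemma subfunctor_diff: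
  assumes "subfunctor V Z" "W \<subseteq> V" "f \<in> Z W" "g \<in> Z W"
  shows "(\<lambda>b. f b - g b) \<in> Z W"
proof -
  have "(\<lambda>b. f b + (-1) * g b) \<in> Z W"
    by (rule subfunctor_add[OF assms(1,2,3) subfunctor_scale[OF assms(1,2,4)]])
  then show ?thesis by simp
qed

lemma subfunctor_supp_mod: "subfunctor V (supp_mod r L)"
  unfolding subfunctor_def supp_mod_def
proof (intro conjI allI impI ballI; clarsimp)
  fix W and f g :: "nat \<Rightarrow> 'b" and a
  assume "\<forall>a. f a \<noteq> 0 \<longrightarrow> a < r \<and> L a \<subseteq> W" "\<forall>a. g a \<noteq> 0 \<longrightarrow> a < r \<and> L a \<subseteq> W" "f a + g a \<noteq> 0"
  then show "a < r \<and> L a \<subseteq> W" by (metis add.right_neutral)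
qed blast

lemma lincomb_subfunctor:
  assumes "subfunctor V Z" "W \<subseteq> V" "f \<in> supp_mod r L W" "\<And>a. a < r \<Longrightarrow> c a \<in> Z (L a)"
  shows "lincomb r f c \<in> Z W"
  unfolding lincomb_def
proof (rule subfunctor_sum[OF assms(1,2)])
  fix a assume "a \<in> {..<r}" "f a \<noteq> 0"
  then show "c a \<in> Z W"
    using assms(3,4) subfunctor_mono[OF assms(1) _ assms(2), of "L a"] by (auto simp: supp_mod_def)
qed

lemma lincomb_unit: "a < r \<Longrightarrow> lincomb r (\<lambda>b. if b = a then 1 else 0) c = c a"
  unfolding lincomb_def by (simp add: if_distrib[of "\<lambda>x. x * _"] cong: if_cong)

lemma lincomb_diff: "lincomb r (\<lambda>a. f a - g a) c = (\<lambda>b. lincomb r f c b - lincomb r g c b)"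
  by (simp add: lincomb_def left_diff_distrib sum_subtractf)

text \<open>
  The third condition is minimality: a relation among the generators of multidegree at most
  \<open>W\<close> does not involve those of multidegree \<open>W\<close> itself. This is the
  functor version of the condition that a relation has coefficients in the ideal of the variables.
\<close>

definition minimally_generates ::
  "'v set \<Rightarrow> ('v set \<Rightarrow> (nat \<Rightarrow> 'k::field) set) \<Rightarrow> nat \<Rightarrow> (nat \<Rightarrow> 'v set) \<Rightarrow> (nat \<Rightarrow> nat \<Rightarrow> 'k) \<Rightarrow> bool" where
  "minimally_generates V Z r L c \<longleftrightarrow>
    (\<forall>a<r. L a \<subseteq> V \<and> c a \<in> Z (L a)) \<and>
    (\<forall>W\<subseteq>V. \<forall>z\<in>Z W. \<exists>f\<in>supp_mod r L W. z = lincomb r f c) \<and>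
    (\<forall>W\<subseteq>V. \<forall>f\<in>supp_mod r L W. lincomb r f c = (\<lambda>_. 0) \<longrightarrow> (\<forall>a. L a = W \<longrightarrow> f a = 0))"

text \<open>
  A basis of a finite-dimensional quotient \<open>Z / Y\<close>, lifted to \<open>Z\<close>.
\<close>

lemma basis_of_quotient:
  fixes Z Y :: "(nat \<Rightarrow> 'k::field) set"
  assumes Z: "(\<lambda>_. 0) \<in> Z" "\<And>f g. f \<in> Z \<Longrightarrow> g \<in> Z \<Longrightarrow> (\<lambda>b. f b + g b) \<in> Z" "\<And>x f. f \<in> Z \<Longrightarrow> (\<lambda>b. x * f b) \<in> Z"
    and Y: "(\<lambda>_. 0) \<in> Y" "\<And>f g. f \<in> Y \<Longrightarrow> g \<in> Y \<Longrightarrow> (\<lambda>b. f b + g b) \<in> Y" "\<And>x f. f \<in> Y \<Longrightarrow> (\<lambda>b. x * f b) \<in> Y"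
    and "Y \<subseteq> Z" "\<And>f b. f \<in> Z \<Longrightarrow> b \<ge> r \<Longrightarrow> f b = 0"
  shows "\<exists>G. finite G \<and> G \<subseteq> Z \<and>
    (\<forall>z\<in>Z. \<exists>y\<in>Y. \<exists>x. z = (\<lambda>b. y b + (\<Sum>g\<in>G. x g * g b))) \<and>
    (\<forall>x. (\<lambda>b. \<Sum>g\<in>G. x g * g b) \<in> Y \<longrightarrow> (\<forall>g\<in>G. x g = 0))"
proof -
  interpret vs: vector_space "\<lambda>x (f :: nat \<Rightarrow> 'k) b. x * f b"
    by unfold_locales (auto simp: algebra_simps)
  have sY: "vs.subspace Y" and sZ: "vs.subspace Z"
    using Y Z by (auto simp: vs.subspace_def zero_fun_def plus_fun_def)
  have spY: "vs.span Y = Y" using sY by (simp add: vs.span_eq_iff)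
  obtain B0 where B0: "B0 \<subseteq> Y" "vs.independent B0" "Y \<subseteq> vs.span B0"
    using vs.maximal_independent_subset by blast
  obtain B1 where B1: "B0 \<subseteq> B1" "B1 \<subseteq> Z" "vs.independent B1" "Z \<subseteq> vs.span B1"
    using vs.maximal_independent_subset_extend[of B0 Z] B0 \<open>Y \<subseteq> Z\<close> by blast
  define E where "E = (\<lambda>a b. if b = a then 1 else (0::'k)) ` {..<r}"
  have "Z \<subseteq> vs.span E"
  proof
    fix f assume f: "f \<in> Z"
    have "f = (\<Sum>a<r. (\<lambda>b. f a * (if b = a then 1 else 0)))"
    proof
      fix b
      have "(\<Sum>a<r. (\<lambda>b. f a * (if b = a then 1 else 0))) b = (\<Sum>a<r. f a * (if b = a then 1 else 0))"
        by (induction r) auto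
      also have "\<dots> = (if b < r then f b else 0)" by (simp add: if_distrib cong: if_cong)
      finally show "f b = (\<Sum>a<r. (\<lambda>b. f a * (if b = a then 1 else 0))) b"
        using assms(8)[OF f, of b] by auto
    qed
    also have "\<dots> \<in> vs.span E"
      by (intro vs.span_sum vs.span_scale vs.span_base) (auto simp: E_def)
    finally show "f \<in> vs.span E" .
  qed
  then have fB1: "finite B1"
    using vs.independent_span_bound[of E B1] B1 by (auto simp: E_def)
  define G where "G = B1 - B0"
  have fG: "finite G" using fB1 by (simp add: G_def)
  have sum_eq: "(\<Sum>g\<in>A. (\<lambda>b. x g * g b)) = (\<lambda>b. \<Sum>g\<in>A. x g * g b)" for A and x :: "(nat \<Rightarrow> 'k) \<Rightarrow> 'k"
    by (induction A rule: infinite_finite_induct) auto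
  show ?thesis
  proof (intro exI[of _ G] conjI ballI allI impI)
    show "finite G" "G \<subseteq> Z" using fG B1 by (auto simp: G_def)
  next
    fix z assume z: "z \<in> Z"
    then have "z \<in> vs.span (B0 \<union> G)" using B1 by (auto simp: G_def Un_absorb1)
    then obtain u v where uv: "z = u + v" "u \<in> vs.span B0" "v \<in> vs.span G"
      unfolding vs.span_Un by blast
    have "u \<in> Y" using uv(2) B0(1) vs.span_mono spY by blast
    moreover obtain x where "v = (\<Sum>g\<in>G. (\<lambda>b. x g * g b))"
      using uv(3) unfolding vs.span_finite[OF fG] by auto
    ultimately show "\<exists>y\<in>Y. \<exists>x. z = (\<lambda>b. y b + (\<Sum>g\<in>G. x g * g b))"
      unfolding uv(1) sum_eq plus_fun_def by blast
  next
    fix x g assume x: "(\<lambda>b. \<Sum>g\<in>G. x g * g b) \<in> Y" and g: "g \<in> G"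
    show "x g = 0"
    proof (rule ccontr)
      assume nz: "x g \<noteq> 0"
      let ?s = "\<lambda>A. \<Sum>g\<in>A. (\<lambda>b. x g * g b)"
      have "?s G \<in> vs.span (B1 - {g})"
        using x B0 B1 g vs.span_mono[of B0 "B1 - {g}"] unfolding sum_eq by (auto simp: G_def)
      moreover have "?s (G - {g}) \<in> vs.span (B1 - {g})"
        by (intro vs.span_sum vs.span_scale vs.span_base) (auto simp: G_def)
      ultimately have "?s G - ?s (G - {g}) \<in> vs.span (B1 - {g})" by (rule vs.span_diff)
      moreover have "?s G - ?s (G - {g}) = (\<lambda>b. x g * g b)"
        using sum.remove[OF fG g, of "\<lambda>g b. x g * g b"] by simp
      ultimately have "(\<lambda>b. inverse (x g) * (x g * g b)) \<in> vs.span (B1 - {g})"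
        using vs.span_scale by metis
      then have "g \<in> vs.span (B1 - {g})" using nz by simp
      then show False using B1(3) g unfolding vs.dependent_def G_def by blast
    qed
  qed
qed

text \<open>
  In each multidegree \<open>W\<close>, take a basis modulo the sum \<open>Y W\<close> of the
  values at the proper subsets of \<open>W\<close>. That these elements generate follows by
  induction on \<open>W\<close>.
\<close>

lemma minimal_generators:
  fixes Z :: "'v set \<Rightarrow> (nat \<Rightarrow> 'k::field) set"
  assumes V: "finite V" and Z: "subfunctor V Z"
    and bnd: "\<And>W f b. W \<subseteq> V \<Longrightarrow> f \<in> Z W \<Longrightarrow> b \<ge> r \<Longrightarrow> f b = 0"
  shows "\<exists>r' L' c. minimally_generates V Z r' L' c"
proof -
  define Y where "Y = (\<lambda>W. {y. \<exists>h. (\<forall>U\<subset>W. h U \<in> Z U) \<and> y = (\<lambda>b. \<Sum>U | U \<subset> W. h U b)})"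
  have finP: "finite {U. U \<subset> W}" if "W \<subseteq> V" for W
    using finite_subset[OF _ finite_Pow_iff[THEN iffD2, OF V], of "{U. U \<subset> W}"] that by auto
  have YI: "(\<lambda>b. \<Sum>U | U \<subset> W. h U b) \<in> Y W" if "\<And>U. U \<subset> W \<Longrightarrow> h U \<in> Z U" for W h
    unfolding Y_def using that by blast
  have YE: "\<exists>h. (\<forall>U. U \<subset> W \<longrightarrow> h U \<in> Z U) \<and> y = (\<lambda>b. \<Sum>U | U \<subset> W. h U b)" if "y \<in> Y W" for W y
    using that unfolding Y_def by blast
  have Y0: "(\<lambda>_. 0) \<in> Y W" if "W \<subseteq> V" for W
  proof -
    have "(\<lambda>b. \<Sum>U | U \<subset> W. (\<lambda>_ _. 0) U b) \<in> Y W"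
      by (rule YI) (rule subfunctor_zero[OF Z], use that in blast)
    then show ?thesis by simp
  qed
  have Yadd: "(\<lambda>b. f b + g b) \<in> Y W" if W: "W \<subseteq> V" and fg: "f \<in> Y W" "g \<in> Y W" for W f g
  proof -
    obtain h h' where h: "\<And>U. U \<subset> W \<Longrightarrow> h U \<in> Z U" "f = (\<lambda>b. \<Sum>U | U \<subset> W. h U b)"
      "\<And>U. U \<subset> W \<Longrightarrow> h' U \<in> Z U" "g = (\<lambda>b. \<Sum>U | U \<subset> W. h' U b)"
      using YE[OF fg(1)] YE[OF fg(2)] by blast
    have "(\<lambda>b. \<Sum>U | U \<subset> W. (\<lambda>U b. h U b + h' U b) U b) \<in> Y W"
      by (rule YI) (rule subfunctor_add[OF Z], use h W in auto)
    then show ?thesis using h by (simp add: sum.distrib)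
  qed
  have Yscale: "(\<lambda>b. x * f b) \<in> Y W" if W: "W \<subseteq> V" and f: "f \<in> Y W" for W f x
  proof -
    obtain h where h: "\<And>U. U \<subset> W \<Longrightarrow> h U \<in> Z U" "f = (\<lambda>b. \<Sum>U | U \<subset> W. h U b)"
      using YE[OF f] by blast
    have "(\<lambda>b. \<Sum>U | U \<subset> W. (\<lambda>U b. x * h U b) U b) \<in> Y W"
      by (rule YI) (rule subfunctor_scale[OF Z], use h W in auto)
    then show ?thesis using h by (simp add: sum_distrib_left)
  qed
  have YZ: "Y W \<subseteq> Z W" if W: "W \<subseteq> V" for W
  proof
    fix y assume "y \<in> Y W"
    then obtain h where h: "\<And>U. U \<subset> W \<Longrightarrow> h U \<in> Z U" "y = (\<lambda>b. \<Sum>U | U \<subset> W. h U b)"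
      using YE by blast
    have "(\<lambda>b. \<Sum>U | U \<subset> W. 1 * h U b) \<in> Z W"
    proof (rule subfunctor_sum[OF Z W])
      fix U assume "U \<in> {U. U \<subset> W}"
      then show "h U \<in> Z W" using h(1)[of U] subfunctor_mono[OF Z _ W, of U] by blast
    qed
    then show "y \<in> Z W" using h by simp
  qed
  have ZY: "Z U \<subseteq> Y W" if "U \<subset> W" "W \<subseteq> V" for U W
  proof
    fix z assume z: "z \<in> Z U"
    have "(\<lambda>b. \<Sum>T | T \<subset> W. (\<lambda>T b. if T = U then z b else 0) T b) \<in> Y W"
    proof (rule YI)
      fix T assume "T \<subset> W"
      then show "(\<lambda>b. if T = U then z b else 0) \<in> Z T"
        using z subfunctor_zero[OF Z, of T] that by (cases "T = U") auto
    qed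
    moreover have "(\<Sum>T | T \<subset> W. if T = U then z b else 0) = z b" for b
      using that finP[OF that(2)] by simp
    ultimately show "z \<in> Y W" by simp
  qed
  define good where "good = (\<lambda>W G. finite G \<and> G \<subseteq> Z W \<and>
     (\<forall>z\<in>Z W. \<exists>y\<in>Y W. \<exists>x. z = (\<lambda>b. y b + (\<Sum>g\<in>G. x g * g b))) \<and>
     (\<forall>x. (\<lambda>b. \<Sum>g\<in>G. x g * g b) \<in> Y W \<longrightarrow> (\<forall>g\<in>G. x g = 0)))"
  have "\<exists>G. good W G" if W: "W \<subseteq> V" for W
    unfolding good_def
  proof (rule basis_of_quotient[of "Z W" "Y W" r])
    show "(\<lambda>_. 0) \<in> Z W" "(\<lambda>_. 0) \<in> Y W" "Y W \<subseteq> Z W"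
      using subfunctor_zero[OF Z W] Y0[OF W] YZ[OF W] by auto
    show "(\<lambda>b. f b + g b) \<in> Z W" if "f \<in> Z W" "g \<in> Z W" for f g
      using subfunctor_add[OF Z W that] .
    show "(\<lambda>b. x * f b) \<in> Z W" if "f \<in> Z W" for x f
      using subfunctor_scale[OF Z W that] .
    show "(\<lambda>b. f b + g b) \<in> Y W" if "f \<in> Y W" "g \<in> Y W" for f g
      using Yadd[OF W that] .
    show "(\<lambda>b. x * f b) \<in> Y W" if "f \<in> Y W" for x f
      using Yscale[OF W that] .
    show "f b = 0" if "f \<in> Z W" "r \<le> b" for f b
      using bnd[OF W that] .
  qed
  then have "\<forall>W. \<exists>G. W \<subseteq> V \<longrightarrow> good W G" by blast
  from choice[OF this] obtain G where good: "\<And>W. W \<subseteq> V \<Longrightarrow> good W (G W)" by blast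
  have G: "\<And>W. W \<subseteq> V \<Longrightarrow> finite (G W)" "\<And>W. W \<subseteq> V \<Longrightarrow> G W \<subseteq> Z W"
    "\<And>W z. W \<subseteq> V \<Longrightarrow> z \<in> Z W \<Longrightarrow> \<exists>y\<in>Y W. \<exists>x. z = (\<lambda>b. y b + (\<Sum>g\<in>G W. x g * g b))"
    "\<And>W x g. W \<subseteq> V \<Longrightarrow> (\<lambda>b. \<Sum>g\<in>G W. x g * g b) \<in> Y W \<Longrightarrow> g \<in> G W \<Longrightarrow> x g = 0"
    using good unfolding good_def by simp_all
  define S where "S = Sigma (Pow V) G"
  have fS: "finite S" unfolding S_def using V G(1) by (intro finite_SigmaI) auto
  define r' where "r' = card S"
  obtain e where "bij_betw e {0..<card S} S" using ex_bij_betw_nat_finite[OF fS] by blast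
  then have e: "bij_betw e {..<r'} S" by (simp add: r'_def atLeast0LessThan)
  define L' where "L' = (\<lambda>a. fst (e a))"
  define c where "c = (\<lambda>a. snd (e a))"
  have eS: "L' a \<subseteq> V" "c a \<in> G (L' a)" if "a < r'" for a
  proof -
    have "e a \<in> S" using bij_betwE[OF e] that by simp
    then show "L' a \<subseteq> V" "c a \<in> G (L' a)" unfolding L'_def c_def by (auto simp: S_def)
  qed
  define idx where "idx = (\<lambda>W g. the_inv_into {..<r'} e (W, g))"
  have idx: "idx W g < r'" "L' (idx W g) = W" "c (idx W g) = g" if "W \<subseteq> V" "g \<in> G W" for W g
  proof -
    have im: "(W, g) \<in> e ` {..<r'}" using that bij_betw_imp_surj_on[OF e] by (simp add: S_def)
    note inj = bij_betw_imp_inj_on[OF e]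
    have "idx W g \<in> {..<r'}" "e (idx W g) = (W, g)"
      unfolding idx_def using the_inv_into_into[OF inj im] f_the_inv_into_f[OF inj im] by auto
    then show "idx W g < r'" "L' (idx W g) = W" "c (idx W g) = g" by (auto simp: L'_def c_def)
  qed
  have idx_c: "idx (L' a) (c a) = a" if "a < r'" for a
    unfolding idx_def L'_def c_def using that e by (simp add: bij_betw_def the_inv_into_f_f)
  have sum_level: "(\<lambda>b. \<Sum>a | a < r' \<and> L' a = W. f a * c a b) = (\<lambda>b. \<Sum>g\<in>G W. f (idx W g) * g b)"
    if W: "W \<subseteq> V" for W and f :: "nat \<Rightarrow> 'k"
  proof
    fix b
    show "(\<Sum>a | a < r' \<and> L' a = W. f a * c a b) = (\<Sum>g\<in>G W. f (idx W g) * g b)"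
      by (rule sum.reindex_bij_witness[of _ "idx W" c]) (use idx[OF W] idx_c eS in auto)
  qed
  define R where "R = (\<lambda>W. {lincomb r' f c | f. f \<in> supp_mod r' L' W})"
  have R0: "(\<lambda>_. 0) \<in> R W" for W
    unfolding R_def by (rule CollectI, rule exI[of _ "\<lambda>_. 0"]) (simp add: lincomb_def supp_mod_def)
  have Radd: "(\<lambda>b. f b + g b) \<in> R W" if fg: "f \<in> R W" "g \<in> R W" for W f g
  proof -
    obtain f' g' where "f' \<in> supp_mod r' L' W" "g' \<in> supp_mod r' L' W" "f = lincomb r' f' c" "g = lincomb r' g' c"
      using fg by (auto simp: R_def)
    then show ?thesis unfolding R_def using subfunctor_add[OF subfunctor_supp_mod subset_UNIV, of f' r' L' W g']
      by (auto simp: lincomb_def sum.distrib distrib_right intro!: exI[of _ "\<lambda>b. f' b + g' b"])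
  qed
  have ZR: "Z W \<subseteq> R W" if "W \<subseteq> V" for W
    using finite_subset[OF that V] that
  proof (induction W rule: finite_psubset_induct)
    case (psubset W)
    have YR: "y \<in> R W" if y: "y \<in> Y W" for y
    proof -
      obtain h where h: "\<And>U. U \<subset> W \<Longrightarrow> h U \<in> Z U" "y = (\<lambda>b. \<Sum>U | U \<subset> W. h U b)"
        using YE[OF y] by blast
      have hR: "h U \<in> R W" if "U \<subset> W" for U
      proof -
        have "h U \<in> R U" using psubset.IH[OF that] h that psubset.prems by blast
        then show ?thesis using that unfolding R_def supp_mod_def by blast
      qed
      have "(\<lambda>b. \<Sum>U\<in>A. h U b) \<in> R W" if "A \<subseteq> {U. U \<subset> W}" "finite A" for A
        using that(2,1) by (induction A rule: finite_induct) (use R0 Radd hR in auto)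
      then show ?thesis using h finP[OF psubset.prems] by blast
    qed
    show ?case
    proof
      fix z assume "z \<in> Z W"
      then obtain y x where yx: "y \<in> Y W" "z = (\<lambda>b. y b + (\<Sum>g\<in>G W. x g * g b))"
        using G(3)[OF psubset.prems] by blast
      define f where "f = (\<lambda>a. if a < r' \<and> L' a = W then x (c a) else 0)"
      have "lincomb r' f c = (\<lambda>b. \<Sum>a | a < r' \<and> L' a = W. f a * c a b)"
        unfolding lincomb_def f_def
        by (intro ext sum.mono_neutral_cong_right) auto
      also have "\<dots> = (\<lambda>b. \<Sum>g\<in>G W. x g * g b)"
        unfolding sum_level[OF psubset.prems] f_def
        by (intro ext sum.cong) (use idx[OF psubset.prems] in auto)
      finally have "(\<lambda>b. \<Sum>g\<in>G W. x g * g b) \<in> R W"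
        unfolding R_def by (intro CollectI exI[of _ f]) (auto simp: f_def supp_mod_def)
      then show "z \<in> R W" unfolding yx(2) using YR[OF yx(1)] by (rule Radd[rotated])
    qed
  qed
  have indep: "f a = 0" if W: "W \<subseteq> V" and f: "f \<in> supp_mod r' L' W" and 0: "lincomb r' f c = (\<lambda>_. 0)" and a: "L' a = W" for W f a
  proof (cases "a < r'")
    case False
    then show ?thesis using f by (auto simp: supp_mod_def)
  next
    case True
    let ?A = "{a. a < r' \<and> L' a = W}" and ?B = "{a. a < r' \<and> L' a \<noteq> W}"
    have "(\<lambda>b. \<Sum>a\<in>B. f a * c a b) \<in> Y W" if "B \<subseteq> ?B" "finite B" for B
      using that(2,1)
    proof (induction B rule: finite_induct)
      case empty
      then show ?case using Y0[OF W] by simp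
    next
      case (insert a B)
      have "(\<lambda>b. f a * c a b) \<in> Y W"
      proof (cases "f a = 0")
        case False
        then have "L' a \<subset> W" using f insert.prems by (auto simp: supp_mod_def)
        moreover have "c a \<in> Z (L' a)" using eS[of a] G(2)[of "L' a"] insert.prems by auto
        ultimately show ?thesis using Yscale[OF W] ZY[OF _ W] by blast
      qed (use Y0[OF W] in simp)
      then show ?case using Yadd[OF W] insert by simp
    qed
    then have "(\<lambda>b. \<Sum>a\<in>?B. f a * c a b) \<in> Y W" by simp
    then have "(\<lambda>b. (-1) * (\<Sum>a\<in>?B. f a * c a b)) \<in> Y W" by (rule Yscale[OF W])
    moreover have "(\<lambda>b. (-1) * (\<Sum>a\<in>?B. f a * c a b)) = (\<lambda>b. \<Sum>a\<in>?A. f a * c a b)"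
    proof
      fix b
      have "(\<Sum>a\<in>?A. f a * c a b) + (\<Sum>a\<in>?B. f a * c a b) = (\<Sum>a\<in>?A \<union> ?B. f a * c a b)"
        by (rule sum.union_disjoint[symmetric]) auto
      also have "?A \<union> ?B = {..<r'}" by auto
      also have "(\<Sum>a<r'. f a * c a b) = 0" using fun_cong[OF 0, of b] by (simp add: lincomb_def)
      finally show "(-1) * (\<Sum>a\<in>?B. f a * c a b) = (\<Sum>a\<in>?A. f a * c a b)"
        by (simp add: neg_eq_iff_add_eq_0 add.commute)
    qed
    ultimately have "(\<lambda>b. \<Sum>g\<in>G W. f (idx W g) * g b) \<in> Y W" by (simp only: sum_level[OF W])
    then have "f (idx W (c a)) = 0" using G(4)[OF W, of "\<lambda>g. f (idx W g)" "c a"] eS(2)[OF True] a by simp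
    then show ?thesis using idx_c[OF True] a by simp
  qed
  show ?thesis
    unfolding minimally_generates_def
  proof (intro exI[of _ r'] exI[of _ L'] exI[of _ c] conjI allI impI ballI)
    show "L' a \<subseteq> V" "c a \<in> Z (L' a)" if "a < r'" for a using eS[OF that] G(2)[of "L' a"] by auto
    show "\<exists>f\<in>supp_mod r' L' W. z = lincomb r' f c" if "W \<subseteq> V" "z \<in> Z W" for W z
      using ZR[OF that(1)] that(2) by (auto simp: R_def)
  qed (rule indep)
qed

section \<open>Squarefree resolutions\<close>

text \<open>
  A minimal resolution, by free functors, of the functor that is the field on the faces of
  \<open>D\<close> and zero elsewhere; this is the squarefree part of the Stanley-Reisner ring.
  Level 0 has one generator, of multidegree \<open>{}\<close>, the functor \<open>Z 0\<close> is
  the squarefree part of the ideal, \<open>Z (Suc i)\<close> is the kernel of the differential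
  \<open>d i\<close> from level \<open>Suc i\<close> to level \<open>i\<close>, whose matrix is
  \<open>c i\<close>, and \<open>Z i\<close> is the image of \<open>d i\<close>.
\<close>

locale squarefree_resolution =
  fixes V :: "'v::linorder set" and D :: "'v set set"
    and r :: "nat \<Rightarrow> nat" and L :: "nat \<Rightarrow> nat \<Rightarrow> 'v set"
    and c :: "nat \<Rightarrow> nat \<Rightarrow> nat \<Rightarrow> 'k::field" and Z :: "nat \<Rightarrow> 'v set \<Rightarrow> (nat \<Rightarrow> 'k) set"
  assumes finV: "finite V" and simp_D: "simplicial D" and empty_D: "{} \<in> D"
    and r0: "r 0 = 1" and L0: "L 0 0 = {}"
    and Z0: "W \<subseteq> V \<Longrightarrow> Z 0 W = (if W \<in> D then {\<lambda>_. 0} else supp_mod (r 0) (L 0) W)"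
    and ZSuc: "W \<subseteq> V \<Longrightarrow> Z (Suc i) W =
      {f \<in> supp_mod (r (Suc i)) (L (Suc i)) W. lincomb (r (Suc i)) f (c i) = (\<lambda>_. 0)}"
    and L_V: "a < r (Suc i) \<Longrightarrow> L (Suc i) a \<subseteq> V"
    and gen_in: "a < r (Suc i) \<Longrightarrow> c i a \<in> Z i (L (Suc i) a)"
    and gen_span: "W \<subseteq> V \<Longrightarrow> z \<in> Z i W \<Longrightarrow>
      \<exists>f\<in>supp_mod (r (Suc i)) (L (Suc i)) W. z = lincomb (r (Suc i)) f (c i)"
    and minimal: "W \<subseteq> V \<Longrightarrow> f \<in> Z (Suc i) W \<Longrightarrow> L (Suc i) a = W \<Longrightarrow> f a = 0"
begin

abbreviation S :: "nat \<Rightarrow> 'v set \<Rightarrow> (nat \<Rightarrow> 'k) set" where "S i \<equiv> supp_mod (r i) (L i)"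

abbreviation d :: "nat \<Rightarrow> (nat \<Rightarrow> 'k) \<Rightarrow> nat \<Rightarrow> 'k" where "d i f \<equiv> lincomb (r (Suc i)) f (c i)"

end

lemma subfunctor_kernel:
  assumes "\<And>W. W \<subseteq> V \<Longrightarrow> Z W = {f \<in> supp_mod r L W. lincomb r f c = (\<lambda>_. 0)}"
  shows "subfunctor V Z"
proof -
  have "subfunctor V (supp_mod r L :: _ \<Rightarrow> (nat \<Rightarrow> 'b) set)" by (rule subfunctor_supp_mod)
  note s = subfunctorD[OF this]
  show ?thesis
    unfolding subfunctor_def
  proof (intro conjI allI impI ballI)
    fix W assume W: "W \<subseteq> V"
    show "(\<lambda>_. 0) \<in> Z W" using s(1)[OF W] by (simp add: assms[OF W] lincomb_def)
    show "(\<lambda>b. f b + g b) \<in> Z W" if "f \<in> Z W" "g \<in> Z W" for f g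
    proof -
      have "lincomb r (\<lambda>b. f b + g b) c = (\<lambda>b. lincomb r f c b + lincomb r g c b)"
        by (simp add: lincomb_def distrib_right sum.distrib)
      then show ?thesis using that s(2)[OF W, of f g] by (simp add: assms[OF W])
    qed
    show "(\<lambda>b. x * f b) \<in> Z W" if "f \<in> Z W" for f x
    proof -
      have "lincomb r (\<lambda>b. x * f b) c = (\<lambda>b. x * lincomb r f c b)"
        by (simp add: lincomb_def sum_distrib_left mult.assoc)
      then show ?thesis using that s(3)[OF W, of f x] by (simp add: assms[OF W])
    qed
  next
    fix U W assume "U \<subseteq> W" "W \<subseteq> V"
    then show "Z U \<subseteq> Z W" using s(4)[of U W] assms[of U] assms[of W] by auto
  qed
qed

lemma subfunctor_base:
  assumes "simplicial D" "\<And>W. W \<subseteq> V \<Longrightarrow> Z W = (if W \<in> D then {\<lambda>_. 0} else supp_mod r L W)"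
  shows "subfunctor V Z"
proof -
  have "subfunctor V (supp_mod r L :: _ \<Rightarrow> (nat \<Rightarrow> 'b) set)" by (rule subfunctor_supp_mod)
  note s = subfunctorD[OF this]
  show ?thesis
    unfolding subfunctor_def
  proof (intro conjI allI impI ballI)
    fix W assume W: "W \<subseteq> V"
    show "(\<lambda>_. 0) \<in> Z W" using s(1)[OF W] by (simp add: assms(2)[OF W])
    show "(\<lambda>b. f b + g b) \<in> Z W" if "f \<in> Z W" "g \<in> Z W" for f g
      using that s(2)[OF W, of f g] by (auto simp: assms(2)[OF W] split: if_splits)
    show "(\<lambda>b. x * f b) \<in> Z W" if "f \<in> Z W" for f x
      using that s(3)[OF W, of f x] by (auto simp: assms(2)[OF W] split: if_splits)
  next
    fix U W assume UW: "U \<subseteq> W" "W \<subseteq> V"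
    then have "W \<in> D \<Longrightarrow> U \<in> D" using assms(1) by (auto simp: simplicial_def)
    then show "Z U \<subseteq> Z W" using s(4)[of U W] s(1)[of W] assms(2)[of U] assms(2)[of W] UW by auto
  qed
qed

lemma squarefree_resolution_exists:
  fixes V :: "'v::linorder set"
  assumes "finite V" "simplicial D" "{} \<in> D"
  shows "\<exists>r L (c :: nat \<Rightarrow> nat \<Rightarrow> nat \<Rightarrow> 'k::field) Z. squarefree_resolution V D r L c Z"
proof -
  define Z0 :: "'v set \<Rightarrow> (nat \<Rightarrow> 'k) set" where
    "Z0 = (\<lambda>W. if W \<in> D then {\<lambda>_. 0} else supp_mod 1 (\<lambda>_. {}) W)"
  define P where "P = (\<lambda>(n::nat) (r::nat, L::nat \<Rightarrow> 'v set, c::nat \<Rightarrow> nat \<Rightarrow> 'k, Z::'v set \<Rightarrow> (nat \<Rightarrow> 'k) set).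
    subfunctor V Z \<and> (\<forall>W\<subseteq>V. Z W \<subseteq> supp_mod r L W) \<and> (n = 0 \<longrightarrow> r = 1 \<and> L = (\<lambda>_. {}) \<and> Z = Z0))"
  define Q where "Q = (\<lambda>(n::nat) (r::nat, L::nat \<Rightarrow> 'v set, c::nat \<Rightarrow> nat \<Rightarrow> 'k, Z::'v set \<Rightarrow> (nat \<Rightarrow> 'k) set)
      (r'::nat, L'::nat \<Rightarrow> 'v set, c'::nat \<Rightarrow> nat \<Rightarrow> 'k, Z'::'v set \<Rightarrow> (nat \<Rightarrow> 'k) set).
    minimally_generates V Z r' L' c' \<and> Z' = (\<lambda>W. {f \<in> supp_mod r' L' W. lincomb r' f c' = (\<lambda>_. 0)}))"
  have "\<exists>F. \<forall>n. P n (F n) \<and> Q n (F n) (F (Suc n))"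
  proof (rule dependent_nat_choice)
    have "subfunctor V Z0" by (rule subfunctor_base[OF assms(2)]) (simp add: Z0_def)
    then show "\<exists>x. P 0 x"
      by (intro exI[of _ "(1, \<lambda>_. {}, \<lambda>_ _. 0, Z0)"]) (auto simp: P_def Z0_def supp_mod_def)
  next
    fix x n assume P: "P n x"
    obtain r L c Z where x: "x = (r, L, c, Z)" by (cases x) auto
    have Z: "subfunctor V Z" "\<And>W. W \<subseteq> V \<Longrightarrow> Z W \<subseteq> supp_mod r L W" using P by (simp_all add: P_def x)
    have bnd: "f b = 0" if "W \<subseteq> V" "f \<in> Z W" "b \<ge> r" for W f b
    proof -
      have "f \<in> supp_mod r L W" using Z(2)[OF that(1)] that(2) by blast
      then show ?thesis using that(3) by (auto simp: supp_mod_def)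
    qed
    have "\<exists>r' L' c'. minimally_generates V Z r' L' c'"
      by (rule minimal_generators[OF assms(1) Z(1), of r]) (rule bnd)
    then obtain r' L' c' where
      g: "minimally_generates V Z r' L' c'"
      by (elim exE) (rule that)
    define Z' where "Z' = (\<lambda>W. {f \<in> supp_mod r' L' W. lincomb r' f c' = (\<lambda>_. 0)})"
    have "subfunctor V Z'" by (rule subfunctor_kernel[of V Z' r' L' c']) (simp add: Z'_def)
    then have "P (Suc n) (r', L', c', Z')" unfolding P_def by (auto simp: Z'_def)
    moreover have "Q n x (r', L', c', Z')" unfolding Q_def x using g by (simp add: Z'_def)
    ultimately show "\<exists>y. P (Suc n) y \<and> Q n x y" by blast
  qed
  then obtain F where F: "\<And>n. P n (F n)" "\<And>n. Q n (F n) (F (Suc n))" by blast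
  define r where "r = (\<lambda>n. fst (F n))"
  define L where "L = (\<lambda>n. fst (snd (F n)))"
  define c where "c = (\<lambda>n. fst (snd (snd (F (Suc n)))))"
  define Z where "Z = (\<lambda>n. snd (snd (snd (F n))))"
  have F0: "r 0 = 1" "L 0 = (\<lambda>_. {})" "Z 0 = Z0"
    using F(1)[of 0] by (auto simp: P_def r_def L_def Z_def split: prod.splits)
  have FS: "\<forall>a<r (Suc i). L (Suc i) a \<subseteq> V \<and> c i a \<in> Z i (L (Suc i) a)"
    "\<forall>W\<subseteq>V. \<forall>z\<in>Z i W. \<exists>f\<in>supp_mod (r (Suc i)) (L (Suc i)) W. z = lincomb (r (Suc i)) f (c i)"
    "\<forall>W\<subseteq>V. \<forall>f\<in>supp_mod (r (Suc i)) (L (Suc i)) W. lincomb (r (Suc i)) f (c i) = (\<lambda>_. 0) \<longrightarrow> (\<forall>a. L (Suc i) a = W \<longrightarrow> f a = 0)"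
    "Z (Suc i) = (\<lambda>W. {f \<in> supp_mod (r (Suc i)) (L (Suc i)) W. lincomb (r (Suc i)) f (c i) = (\<lambda>_. 0)})" for i
    using F(2)[of i] by (simp_all add: Q_def minimally_generates_def r_def L_def Z_def c_def case_prod_beta)
  have "squarefree_resolution V D r L c Z"
  proof
    show "Z 0 W = (if W \<in> D then {\<lambda>_. 0} else supp_mod (r 0) (L 0) W)" for W
      by (simp add: F0 Z0_def)
  qed (use assms F0 FS in auto)
  then show ?thesis by blast
qed

section \<open>Koszul cohomology and dimension shifting\<close>

definition vcobd :: "('v::linorder set \<Rightarrow> nat \<Rightarrow> 'k::field) \<Rightarrow> 'v set \<Rightarrow> nat \<Rightarrow> 'k" where
  "vcobd \<phi> \<tau> = (\<lambda>b. cobd (\<lambda>\<sigma>. \<phi> \<sigma> b) \<tau>)"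

lemma vcobd_mem:
  assumes "subfunctor V Z" "\<tau> \<subseteq> V" "\<And>v. v \<in> \<tau> \<Longrightarrow> \<psi> (\<tau> - {v}) \<in> Z (\<tau> - {v})"
  shows "vcobd \<psi> \<tau> \<in> Z \<tau>"
  unfolding vcobd_def cobd_def
proof (rule subfunctor_sum[OF assms(1,2)])
  fix v assume "v \<in> \<tau>"
  then show "\<psi> (\<tau> - {v}) \<in> Z \<tau>"
    using assms(3) subfunctor_mono[OF assms(1) _ assms(2), of "\<tau> - {v}"] by blast
qed

lemma vcobd_cong: "(\<And>v. v \<in> \<sigma> \<Longrightarrow> \<phi> (\<sigma> - {v}) = \<psi> (\<sigma> - {v})) \<Longrightarrow> vcobd \<phi> \<sigma> = vcobd \<psi> \<sigma>"
  unfolding vcobd_def by (intro ext cobd_cong) simp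

lemma vcobd_diff: "vcobd (\<lambda>\<sigma> b. \<phi> \<sigma> b - \<psi> \<sigma> b) \<tau> = (\<lambda>b. vcobd \<phi> \<tau> b - vcobd \<psi> \<tau> b)"
  by (simp add: vcobd_def cobd_diff)

lemma vcobd_vcobd: "finite \<tau> \<Longrightarrow> vcobd (vcobd \<phi>) \<tau> = (\<lambda>_. 0)"
  by (simp add: vcobd_def cobd_cobd)

lemma vcobd_zero [simp]: "vcobd (\<lambda>_ _. 0) \<tau> = (\<lambda>_. 0)"
  by (simp add: vcobd_def)

lemma vcobd_lincomb: "vcobd (\<lambda>\<sigma>. lincomb r (\<psi> \<sigma>) c) \<tau> = lincomb r (vcobd \<psi> \<tau>) c"
proof
  fix b
  have "vcobd (\<lambda>\<sigma>. lincomb r (\<psi> \<sigma>) c) \<tau> b =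
      (\<Sum>v\<in>\<tau>. \<Sum>a<r. pos_sign v \<tau> * \<psi> (\<tau> - {v}) a * c a b)"
    by (simp add: vcobd_def lincomb_def cobd_def sum_distrib_left mult.assoc)
  also have "\<dots> = (\<Sum>a<r. \<Sum>v\<in>\<tau>. pos_sign v \<tau> * \<psi> (\<tau> - {v}) a * c a b)" by (rule sum.swap)
  also have "\<dots> = lincomb r (vcobd \<psi> \<tau>) c b"
    by (simp add: vcobd_def lincomb_def cobd_def sum_distrib_right)
  finally show "vcobd (\<lambda>\<sigma>. lincomb r (\<psi> \<sigma>) c) \<tau> b = lincomb r (vcobd \<psi> \<tau>) c b" .
qed

text \<open>
  The Koszul complex at \<open>W\<close> of a free functor splits into the parts of the
  generators. A generator of multidegree \<open>L b\<close> different from \<open>W\<close> misses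
  some \<open>v\<close> in \<open>W\<close>, and contraction with \<open>v\<close> is a
  contracting homotopy of its part.
\<close>

lemma vcobd_exact_free:
  fixes \<phi> :: "'v::linorder set \<Rightarrow> nat \<Rightarrow> 'k::field"
  assumes W: "finite W"
    and mem: "\<And>\<sigma>. \<sigma> \<subseteq> W \<Longrightarrow> card \<sigma> = q \<Longrightarrow> \<phi> \<sigma> \<in> supp_mod r L \<sigma>"
    and proper: "\<And>\<sigma> b. \<sigma> \<subseteq> W \<Longrightarrow> card \<sigma> = q \<Longrightarrow> \<phi> \<sigma> b \<noteq> 0 \<Longrightarrow> L b \<noteq> W"
    and cocycle: "\<And>\<tau>. \<tau> \<subseteq> W \<Longrightarrow> card \<tau> = Suc q \<Longrightarrow> vcobd \<phi> \<tau> = (\<lambda>_. 0)"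
  shows "\<exists>\<psi>. (\<forall>\<sigma>. \<sigma> \<subseteq> W \<longrightarrow> Suc (card \<sigma>) = q \<longrightarrow> \<psi> \<sigma> \<in> supp_mod r L \<sigma>) \<and>
    (\<forall>\<sigma>. \<sigma> \<subseteq> W \<longrightarrow> card \<sigma> = q \<longrightarrow> \<phi> \<sigma> = vcobd \<psi> \<sigma>)"
proof -
  define v where "v = (\<lambda>b. SOME v. v \<in> W - L b)"
  have v: "v b \<in> W" "v b \<notin> L b" if "L b \<subset> W" for b
    using someI_ex[of "\<lambda>v. v \<in> W - L b"] that unfolding v_def by blast+
  define \<psi> where "\<psi> = (\<lambda>\<sigma> b. if b < r \<and> L b \<subset> W then contr (v b) (\<lambda>\<sigma>. \<phi> \<sigma> b) \<sigma> else 0)"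
  have fin: "finite \<sigma>" if "\<sigma> \<subseteq> W" for \<sigma> using finite_subset[OF that W] .
  have "\<psi> \<sigma> \<in> supp_mod r L \<sigma>" if \<sigma>: "\<sigma> \<subseteq> W" "Suc (card \<sigma>) = q" for \<sigma>
    unfolding supp_mod_def
  proof (intro CollectI allI impI)
    fix b assume "\<psi> \<sigma> b \<noteq> 0"
    then have b: "b < r" "L b \<subset> W" "v b \<notin> \<sigma>" "\<phi> (insert (v b) \<sigma>) b \<noteq> 0"
      unfolding \<psi>_def contr_def by (auto split: if_splits)
    have "card (insert (v b) \<sigma>) = q" "insert (v b) \<sigma> \<subseteq> W" using \<sigma> b v[OF b(2)] fin by auto
    then have "L b \<subseteq> insert (v b) \<sigma>" using mem[of "insert (v b) \<sigma>"] b(4) by (auto simp: supp_mod_def)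
    then show "b < r \<and> L b \<subseteq> \<sigma>" using b v[OF b(2)] by auto
  qed
  moreover have "\<phi> \<sigma> = vcobd \<psi> \<sigma>" if \<sigma>: "\<sigma> \<subseteq> W" "card \<sigma> = q" for \<sigma>
  proof
    fix b
    show "\<phi> \<sigma> b = vcobd \<psi> \<sigma> b"
    proof (cases "b < r \<and> L b \<subset> W")
      case True
      have "cobd (contr (v b) (\<lambda>\<sigma>. \<phi> \<sigma> b)) \<sigma> = \<phi> \<sigma> b"
      proof (rule cobd_contr[OF fin[OF \<sigma>(1)]])
        assume "v b \<notin> \<sigma>"
        then have "card (insert (v b) \<sigma>) = Suc q" "insert (v b) \<sigma> \<subseteq> W" using \<sigma> v True fin by auto
        then show "cobd (\<lambda>\<sigma>. \<phi> \<sigma> b) (insert (v b) \<sigma>) = 0"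
          using fun_cong[OF cocycle[of "insert (v b) \<sigma>"], of b] by (simp add: vcobd_def)
      qed
      then show ?thesis using True by (simp add: \<psi>_def vcobd_def)
    next
      case False
      then have "\<phi> \<sigma> b = 0" using mem[OF \<sigma>] proper[OF \<sigma>, of b] \<sigma> by (auto simp: supp_mod_def)
      moreover have "(\<lambda>\<sigma>. \<psi> \<sigma> b) = (\<lambda>_. 0)" using False by (simp only: \<psi>_def if_False)
      ultimately show ?thesis by (simp add: vcobd_def)
    qed
  qed
  ultimately show ?thesis by (intro exI[of _ \<psi>]) simp
qed

text \<open>
  The Koszul homology of the functor \<open>Z\<close> in multidegree \<open>W\<close> does not
  vanish; here \<open>q\<close> is the size of the complement in \<open>W\<close> of the usual
  exterior index, so that the differential becomes a coboundary operator.
\<close>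

definition koszul :: "nat \<Rightarrow> ('v::linorder set \<Rightarrow> (nat \<Rightarrow> 'k::field) set) \<Rightarrow> 'v set \<Rightarrow> bool" where
  "koszul q Z W \<longleftrightarrow> (\<exists>\<phi>. (\<forall>\<sigma>. \<sigma> \<subseteq> W \<longrightarrow> card \<sigma> = q \<longrightarrow> \<phi> \<sigma> \<in> Z \<sigma>) \<and>
    (\<forall>\<tau>. \<tau> \<subseteq> W \<longrightarrow> card \<tau> = Suc q \<longrightarrow> vcobd \<phi> \<tau> = (\<lambda>_. 0)) \<and>
    \<not> (\<exists>\<psi>. (\<forall>\<sigma>. \<sigma> \<subseteq> W \<longrightarrow> Suc (card \<sigma>) = q \<longrightarrow> \<psi> \<sigma> \<in> Z \<sigma>) \<and>
       (\<forall>\<sigma>. \<sigma> \<subseteq> W \<longrightarrow> card \<sigma> = q \<longrightarrow> \<phi> \<sigma> = vcobd \<psi> \<sigma>)))"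

lemma koszulI:
  assumes "\<And>\<sigma>. \<sigma> \<subseteq> W \<Longrightarrow> card \<sigma> = q \<Longrightarrow> \<phi> \<sigma> \<in> Z \<sigma>"
    "\<And>\<tau>. \<tau> \<subseteq> W \<Longrightarrow> card \<tau> = Suc q \<Longrightarrow> vcobd \<phi> \<tau> = (\<lambda>_. 0)"
    "\<And>\<psi>. (\<And>\<sigma>. \<sigma> \<subseteq> W \<Longrightarrow> Suc (card \<sigma>) = q \<Longrightarrow> \<psi> \<sigma> \<in> Z \<sigma>) \<Longrightarrow>
      (\<And>\<sigma>. \<sigma> \<subseteq> W \<Longrightarrow> card \<sigma> = q \<Longrightarrow> \<phi> \<sigma> = vcobd \<psi> \<sigma>) \<Longrightarrow> False"
  shows "koszul q Z W"
  unfolding koszul_def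
proof (rule exI[of _ \<phi>], intro conjI allI impI notI)
  assume "\<exists>\<psi>. (\<forall>\<sigma>. \<sigma> \<subseteq> W \<longrightarrow> Suc (card \<sigma>) = q \<longrightarrow> \<psi> \<sigma> \<in> Z \<sigma>) \<and>
       (\<forall>\<sigma>. \<sigma> \<subseteq> W \<longrightarrow> card \<sigma> = q \<longrightarrow> \<phi> \<sigma> = vcobd \<psi> \<sigma>)"
  then obtain \<psi> where "\<forall>\<sigma>. \<sigma> \<subseteq> W \<longrightarrow> Suc (card \<sigma>) = q \<longrightarrow> \<psi> \<sigma> \<in> Z \<sigma>"
    "\<forall>\<sigma>. \<sigma> \<subseteq> W \<longrightarrow> card \<sigma> = q \<longrightarrow> \<phi> \<sigma> = vcobd \<psi> \<sigma>" by (elim exE conjE)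
  then show False by (intro assms(3)[of \<psi>]) simp_all
qed (fact assms(1), fact assms(2))

lemma koszulE:
  assumes "koszul q Z W"
  obtains \<phi> where "\<And>\<sigma>. \<sigma> \<subseteq> W \<Longrightarrow> card \<sigma> = q \<Longrightarrow> \<phi> \<sigma> \<in> Z \<sigma>"
    "\<And>\<tau>. \<tau> \<subseteq> W \<Longrightarrow> card \<tau> = Suc q \<Longrightarrow> vcobd \<phi> \<tau> = (\<lambda>_. 0)"
    "\<And>\<psi>. (\<And>\<sigma>. \<sigma> \<subseteq> W \<Longrightarrow> Suc (card \<sigma>) = q \<Longrightarrow> \<psi> \<sigma> \<in> Z \<sigma>) \<Longrightarrow>
      (\<And>\<sigma>. \<sigma> \<subseteq> W \<Longrightarrow> card \<sigma> = q \<Longrightarrow> \<phi> \<sigma> = vcobd \<psi> \<sigma>) \<Longrightarrow> False"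
proof -
  from assms obtain \<phi> where \<phi>: "\<forall>\<sigma>. \<sigma> \<subseteq> W \<longrightarrow> card \<sigma> = q \<longrightarrow> \<phi> \<sigma> \<in> Z \<sigma>"
    "\<forall>\<tau>. \<tau> \<subseteq> W \<longrightarrow> card \<tau> = Suc q \<longrightarrow> vcobd \<phi> \<tau> = (\<lambda>_. 0)"
    "\<not> (\<exists>\<psi>. (\<forall>\<sigma>. \<sigma> \<subseteq> W \<longrightarrow> Suc (card \<sigma>) = q \<longrightarrow> \<psi> \<sigma> \<in> Z \<sigma>) \<and>
       (\<forall>\<sigma>. \<sigma> \<subseteq> W \<longrightarrow> card \<sigma> = q \<longrightarrow> \<phi> \<sigma> = vcobd \<psi> \<sigma>))"
    unfolding koszul_def by (elim exE conjE)
  show thesis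
  proof (rule that[of \<phi>])
    show "\<phi> \<sigma> \<in> Z \<sigma>" if "\<sigma> \<subseteq> W" "card \<sigma> = q" for \<sigma> using \<phi>(1) that by simp
    show "vcobd \<phi> \<tau> = (\<lambda>_. 0)" if "\<tau> \<subseteq> W" "card \<tau> = Suc q" for \<tau> using \<phi>(2) that by simp
    fix \<psi> assume "\<And>\<sigma>. \<sigma> \<subseteq> W \<Longrightarrow> Suc (card \<sigma>) = q \<Longrightarrow> \<psi> \<sigma> \<in> Z \<sigma>"
      "\<And>\<sigma>. \<sigma> \<subseteq> W \<Longrightarrow> card \<sigma> = q \<Longrightarrow> \<phi> \<sigma> = vcobd \<psi> \<sigma>"
    then show False using \<phi>(3) by (simp only: not_ex) blast
  qed
qed

context squarefree_resolution
begin

lemma subfunctor_Z: "subfunctor V (Z i)"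
proof (cases i)
  case 0
  show ?thesis unfolding 0 by (rule subfunctor_base[OF simp_D Z0])
next
  case (Suc j)
  show ?thesis unfolding Suc by (rule subfunctor_kernel[OF ZSuc])
qed

lemma Z_sub_S: "W \<subseteq> V \<Longrightarrow> Z i W \<subseteq> S i W"
  by (cases i) (auto simp: Z0 ZSuc supp_mod_def)

lemma d_in_Z: "W \<subseteq> V \<Longrightarrow> f \<in> S (Suc i) W \<Longrightarrow> d i f \<in> Z i W"
  by (rule lincomb_subfunctor[OF subfunctor_Z _ _ gen_in])

lemma c_proper:
  assumes "a < r (Suc i)" "c i a b \<noteq> 0"
  shows "b < r i" "L i b \<subset> L (Suc i) a"
proof -
  have LV: "L (Suc i) a \<subseteq> V" using L_V assms by blast
  have "c i a \<in> S i (L (Suc i) a)" using gen_in[OF assms(1)] Z_sub_S[OF LV] by blast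
  then have b: "b < r i" "L i b \<subseteq> L (Suc i) a" using assms by (auto simp: supp_mod_def)
  moreover have "L i b \<noteq> L (Suc i) a"
  proof (cases i)
    case 0
    then have "b = 0" using b r0 by simp
    moreover have "L (Suc i) a \<noteq> {}"
      using gen_in[OF assms(1)] assms(2) empty_D Z0[of "{}"] 0 by auto
    ultimately show ?thesis using 0 L0 by simp
  next
    case (Suc j)
    then show ?thesis using minimal[OF LV, of "c i a" j b] gen_in[OF assms(1)] assms(2) by auto
  qed
  ultimately show "b < r i" "L i b \<subset> L (Suc i) a" by auto
qed

lemma gen_nonzero:
  assumes "a < r (Suc i)" shows "\<exists>b. c i a b \<noteq> 0"
proof (rule ccontr)
  assume "\<not> (\<exists>b. c i a b \<noteq> 0)"
  then have ca: "c i a = (\<lambda>_. 0)" by auto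
  have LV: "L (Suc i) a \<subseteq> V" using L_V assms by blast
  define f where "f = (\<lambda>b. if b = a then 1 else (0::'k))"
  have "f \<in> Z (Suc i) (L (Suc i) a)"
    unfolding ZSuc[OF LV] using lincomb_unit[OF assms, of "c i"] ca assms
    by (auto simp: f_def supp_mod_def)
  then have "f a = 0" using minimal[OF LV] by blast
  then show False by (simp add: f_def)
qed

text \<open>By minimality, the differential strictly decreases multidegrees.\<close>

lemma card_label: "a < r i \<Longrightarrow> i \<le> card (L i a)"
proof (induction i arbitrary: a)
  case (Suc i)
  obtain b where b: "c i a b \<noteq> 0" using gen_nonzero[OF Suc.prems] by blast
  note cb = c_proper[OF Suc.prems b]
  have "card (L i b) < card (L (Suc i) a)"
    using cb(2) finite_subset[OF L_V[OF Suc.prems] finV] by (rule psubset_card_mono[rotated])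
  then show ?case using Suc.IH[OF cb(1)] by simp
qed simp

lemma lift_choice:
  assumes "W \<subseteq> V" "\<And>\<sigma>. \<sigma> \<subseteq> W \<Longrightarrow> P \<sigma> \<Longrightarrow> \<phi> \<sigma> \<in> Z i \<sigma>"
  shows "\<exists>\<psi>. \<forall>\<sigma>. \<sigma> \<subseteq> W \<longrightarrow> P \<sigma> \<longrightarrow> \<psi> \<sigma> \<in> S (Suc i) \<sigma> \<and> \<phi> \<sigma> = d i (\<psi> \<sigma>)"
proof -
  have "\<exists>f. \<sigma> \<subseteq> W \<longrightarrow> P \<sigma> \<longrightarrow> f \<in> S (Suc i) \<sigma> \<and> \<phi> \<sigma> = d i f" for \<sigma>
  proof (cases "\<sigma> \<subseteq> W \<and> P \<sigma>")
    case True
    then have "\<sigma> \<subseteq> V" "\<phi> \<sigma> \<in> Z i \<sigma>" using assms by auto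
    then show ?thesis using gen_span by blast
  qed blast
  then show ?thesis using choice[of "\<lambda>\<sigma> f. \<sigma> \<subseteq> W \<longrightarrow> P \<sigma> \<longrightarrow> f \<in> S (Suc i) \<sigma> \<and> \<phi> \<sigma> = d i f"] by blast
qed

text \<open>
  The long exact sequence of \<open>Z (Suc i) \<rightarrow> S (Suc i) \<rightarrow> Z i\<close>.
  The free functor in the middle has no cohomology in degree \<open>q\<close>, and the classes in
  degree \<open>Suc q\<close> coming from \<open>Z (Suc i)\<close> vanish in it: by minimality if
  \<open>Suc q\<close> is the size of \<open>W\<close>.
\<close>

lemma koszul_shift:
  assumes W: "W \<subseteq> V" and q: "Suc q \<le> card W"
  shows "koszul q (Z i) W \<longleftrightarrow> koszul (Suc q) (Z (Suc i)) W"
proof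
  have fW: "finite W" using W finV finite_subset by blast
  have fin: "finite \<sigma>" "\<sigma> \<subseteq> V" if "\<sigma> \<subseteq> W" for \<sigma> using that W fW finite_subset by auto
  have facet: "\<sigma> - {v} \<subseteq> W" "Suc (card (\<sigma> - {v})) = card \<sigma>" if "\<sigma> \<subseteq> W" "v \<in> \<sigma>" for \<sigma> v
    using that fin[OF that(1)] card_Suc_Diff1[of \<sigma> v] by auto
  {
    assume "koszul q (Z i) W"
    then obtain \<phi> where \<phi>: "\<And>\<sigma>. \<sigma> \<subseteq> W \<Longrightarrow> card \<sigma> = q \<Longrightarrow> \<phi> \<sigma> \<in> Z i \<sigma>"
      "\<And>\<tau>. \<tau> \<subseteq> W \<Longrightarrow> card \<tau> = Suc q \<Longrightarrow> vcobd \<phi> \<tau> = (\<lambda>_. 0)"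
      and no: "\<And>\<psi>. (\<And>\<sigma>. \<sigma> \<subseteq> W \<Longrightarrow> Suc (card \<sigma>) = q \<Longrightarrow> \<psi> \<sigma> \<in> Z i \<sigma>) \<Longrightarrow>
        (\<And>\<sigma>. \<sigma> \<subseteq> W \<Longrightarrow> card \<sigma> = q \<Longrightarrow> \<phi> \<sigma> = vcobd \<psi> \<sigma>) \<Longrightarrow> False"
      by (rule koszulE) blast
    obtain \<psi> where \<psi>: "\<And>\<sigma>. \<sigma> \<subseteq> W \<Longrightarrow> card \<sigma> = q \<Longrightarrow> \<psi> \<sigma> \<in> S (Suc i) \<sigma>"
      "\<And>\<sigma>. \<sigma> \<subseteq> W \<Longrightarrow> card \<sigma> = q \<Longrightarrow> \<phi> \<sigma> = d i (\<psi> \<sigma>)"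
      using lift_choice[OF W, of "\<lambda>\<sigma>. card \<sigma> = q" \<phi> i] \<phi>(1) by blast
    show "koszul (Suc q) (Z (Suc i)) W"
    proof (rule koszulI[of _ _ "vcobd \<psi>"])
      fix \<tau> assume \<tau>: "\<tau> \<subseteq> W" "card \<tau> = Suc q"
      have "vcobd \<psi> \<tau> \<in> S (Suc i) \<tau>"
        by (rule vcobd_mem[OF subfunctor_supp_mod fin(2)[OF \<tau>(1)]]) (use facet[OF \<tau>(1)] \<tau> \<psi>(1) in auto)
      moreover have "d i (vcobd \<psi> \<tau>) = vcobd \<phi> \<tau>"
        unfolding vcobd_lincomb[symmetric] using facet[OF \<tau>(1)] \<tau> \<psi>(2) by (intro vcobd_cong) auto
      ultimately show "vcobd \<psi> \<tau> \<in> Z (Suc i) \<tau>" using \<phi>(2)[OF \<tau>] by (simp add: ZSuc[OF fin(2)[OF \<tau>(1)]])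
    next
      fix \<tau> assume "\<tau> \<subseteq> W"
      then show "vcobd (vcobd \<psi>) \<tau> = (\<lambda>_. 0)" using fin by (intro vcobd_vcobd)
    next
      fix \<chi> assume \<chi>: "\<And>\<sigma>. \<sigma> \<subseteq> W \<Longrightarrow> Suc (card \<sigma>) = Suc q \<Longrightarrow> \<chi> \<sigma> \<in> Z (Suc i) \<sigma>"
        "\<And>\<sigma>. \<sigma> \<subseteq> W \<Longrightarrow> card \<sigma> = Suc q \<Longrightarrow> vcobd \<psi> \<sigma> = vcobd \<chi> \<sigma>"
      define \<eta> where "\<eta> = (\<lambda>\<sigma> b. \<psi> \<sigma> b - \<chi> \<sigma> b)"
      have \<eta>S: "\<eta> \<sigma> \<in> S (Suc i) \<sigma>" if "\<sigma> \<subseteq> W" "card \<sigma> = q" for \<sigma>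
        unfolding \<eta>_def using subfunctor_diff[OF subfunctor_supp_mod fin(2)[OF that(1)] \<psi>(1)[OF that]]
          \<chi>(1)[OF that(1)] Z_sub_S[OF fin(2)[OF that(1)]] that by blast
      have \<eta>d: "d i (\<eta> \<sigma>) = \<phi> \<sigma>" if "\<sigma> \<subseteq> W" "card \<sigma> = q" for \<sigma>
        unfolding \<eta>_def lincomb_diff
        using \<psi>(2)[OF that] \<chi>(1)[OF that(1)] that ZSuc[OF fin(2)[OF that(1)]] by auto
      have "\<exists>\<omega>. (\<forall>\<sigma>. \<sigma> \<subseteq> W \<longrightarrow> Suc (card \<sigma>) = q \<longrightarrow> \<omega> \<sigma> \<in> S (Suc i) \<sigma>) \<and>
          (\<forall>\<sigma>. \<sigma> \<subseteq> W \<longrightarrow> card \<sigma> = q \<longrightarrow> \<eta> \<sigma> = vcobd \<omega> \<sigma>)"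
      proof (rule vcobd_exact_free[OF fW \<eta>S])
        fix \<sigma> b assume \<sigma>: "\<sigma> \<subseteq> W" "card \<sigma> = q" and nz: "\<eta> \<sigma> b \<noteq> 0"
        have "L (Suc i) b \<subseteq> \<sigma>" using \<eta>S[OF \<sigma>] nz by (auto simp: supp_mod_def)
        then show "L (Suc i) b \<noteq> W" using \<sigma> q by auto
      next
        fix \<tau> assume "\<tau> \<subseteq> W" "card \<tau> = Suc q"
        then show "vcobd \<eta> \<tau> = (\<lambda>_. 0)" unfolding \<eta>_def vcobd_diff using \<chi>(2) by simp
      qed
      then obtain \<omega> where \<omega>: "\<And>\<sigma>. \<sigma> \<subseteq> W \<Longrightarrow> Suc (card \<sigma>) = q \<Longrightarrow> \<omega> \<sigma> \<in> S (Suc i) \<sigma>"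
        "\<And>\<sigma>. \<sigma> \<subseteq> W \<Longrightarrow> card \<sigma> = q \<Longrightarrow> \<eta> \<sigma> = vcobd \<omega> \<sigma>" by blast
      show False
      proof (rule no[of "\<lambda>\<sigma>. d i (\<omega> \<sigma>)"])
        show "d i (\<omega> \<sigma>) \<in> Z i \<sigma>" if "\<sigma> \<subseteq> W" "Suc (card \<sigma>) = q" for \<sigma>
          using d_in_Z[OF fin(2)[OF that(1)] \<omega>(1)[OF that]] .
        show "\<phi> \<sigma> = vcobd (\<lambda>\<sigma>. d i (\<omega> \<sigma>)) \<sigma>" if "\<sigma> \<subseteq> W" "card \<sigma> = q" for \<sigma>
          unfolding vcobd_lincomb using \<eta>d[OF that] \<omega>(2)[OF that] by simp
      qed
    qed
  next
    assume "koszul (Suc q) (Z (Suc i)) W"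
    then obtain \<Phi> where \<Phi>: "\<And>\<sigma>. \<sigma> \<subseteq> W \<Longrightarrow> card \<sigma> = Suc q \<Longrightarrow> \<Phi> \<sigma> \<in> Z (Suc i) \<sigma>"
      "\<And>\<tau>. \<tau> \<subseteq> W \<Longrightarrow> card \<tau> = Suc (Suc q) \<Longrightarrow> vcobd \<Phi> \<tau> = (\<lambda>_. 0)"
      and no: "\<And>\<psi>. (\<And>\<sigma>. \<sigma> \<subseteq> W \<Longrightarrow> Suc (card \<sigma>) = Suc q \<Longrightarrow> \<psi> \<sigma> \<in> Z (Suc i) \<sigma>) \<Longrightarrow>
        (\<And>\<sigma>. \<sigma> \<subseteq> W \<Longrightarrow> card \<sigma> = Suc q \<Longrightarrow> \<Phi> \<sigma> = vcobd \<psi> \<sigma>) \<Longrightarrow> False"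
      by (rule koszulE) blast
    have "\<exists>\<psi>. (\<forall>\<sigma>. \<sigma> \<subseteq> W \<longrightarrow> Suc (card \<sigma>) = Suc q \<longrightarrow> \<psi> \<sigma> \<in> S (Suc i) \<sigma>) \<and>
        (\<forall>\<sigma>. \<sigma> \<subseteq> W \<longrightarrow> card \<sigma> = Suc q \<longrightarrow> \<Phi> \<sigma> = vcobd \<psi> \<sigma>)"
    proof (rule vcobd_exact_free[OF fW _ _ \<Phi>(2)])
      fix \<sigma> assume \<sigma>: "\<sigma> \<subseteq> W" "card \<sigma> = Suc q"
      show \<Phi>S: "\<Phi> \<sigma> \<in> S (Suc i) \<sigma>" using \<Phi>(1)[OF \<sigma>] Z_sub_S[OF fin(2)[OF \<sigma>(1)]] by blast
      fix b assume nz: "\<Phi> \<sigma> b \<noteq> 0"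
      show "L (Suc i) b \<noteq> W"
      proof
        assume LW: "L (Suc i) b = W"
        then have "\<sigma> = W" using \<Phi>S nz \<sigma> by (auto simp: supp_mod_def)
        then show False using minimal[OF W, of "\<Phi> \<sigma>" i b] \<Phi>(1)[OF \<sigma>] LW nz by simp
      qed
    qed
    then obtain \<psi> where \<psi>: "\<And>\<sigma>. \<sigma> \<subseteq> W \<Longrightarrow> card \<sigma> = q \<Longrightarrow> \<psi> \<sigma> \<in> S (Suc i) \<sigma>"
      "\<And>\<sigma>. \<sigma> \<subseteq> W \<Longrightarrow> card \<sigma> = Suc q \<Longrightarrow> \<Phi> \<sigma> = vcobd \<psi> \<sigma>" by auto
    show "koszul q (Z i) W"
    proof (rule koszulI[of _ _ "\<lambda>\<sigma>. d i (\<psi> \<sigma>)"])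
      show "d i (\<psi> \<sigma>) \<in> Z i \<sigma>" if "\<sigma> \<subseteq> W" "card \<sigma> = q" for \<sigma>
        using d_in_Z[OF fin(2)[OF that(1)] \<psi>(1)[OF that]] .
      show "vcobd (\<lambda>\<sigma>. d i (\<psi> \<sigma>)) \<tau> = (\<lambda>_. 0)" if "\<tau> \<subseteq> W" "card \<tau> = Suc q" for \<tau>
        unfolding vcobd_lincomb using \<Phi>(1)[OF that] \<psi>(2)[OF that] ZSuc[OF fin(2)[OF that(1)]] by simp
    next
      fix \<omega> assume \<omega>: "\<And>\<sigma>. \<sigma> \<subseteq> W \<Longrightarrow> Suc (card \<sigma>) = q \<Longrightarrow> \<omega> \<sigma> \<in> Z i \<sigma>"
        "\<And>\<sigma>. \<sigma> \<subseteq> W \<Longrightarrow> card \<sigma> = q \<Longrightarrow> d i (\<psi> \<sigma>) = vcobd \<omega> \<sigma>"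
      obtain \<eta> where \<eta>: "\<And>\<sigma>. \<sigma> \<subseteq> W \<Longrightarrow> Suc (card \<sigma>) = q \<Longrightarrow> \<eta> \<sigma> \<in> S (Suc i) \<sigma>"
        "\<And>\<sigma>. \<sigma> \<subseteq> W \<Longrightarrow> Suc (card \<sigma>) = q \<Longrightarrow> \<omega> \<sigma> = d i (\<eta> \<sigma>)"
        using lift_choice[OF W, of "\<lambda>\<sigma>. Suc (card \<sigma>) = q" \<omega> i] \<omega>(1) by blast
      show False
      proof (rule no[of "\<lambda>\<sigma> b. \<psi> \<sigma> b - vcobd \<eta> \<sigma> b"])
        fix \<sigma> assume \<sigma>: "\<sigma> \<subseteq> W" "Suc (card \<sigma>) = Suc q"
        have "vcobd \<eta> \<sigma> \<in> S (Suc i) \<sigma>"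
          by (rule vcobd_mem[OF subfunctor_supp_mod fin(2)[OF \<sigma>(1)]]) (use facet[OF \<sigma>(1)] \<sigma> \<eta>(1) in auto)
        then have "(\<lambda>b. \<psi> \<sigma> b - vcobd \<eta> \<sigma> b) \<in> S (Suc i) \<sigma>"
          using subfunctor_diff[OF subfunctor_supp_mod fin(2)[OF \<sigma>(1)] \<psi>(1)[OF \<sigma>(1)]] \<sigma> by blast
        moreover have "d i (vcobd \<eta> \<sigma>) = vcobd \<omega> \<sigma>"
          unfolding vcobd_lincomb[symmetric] using facet[OF \<sigma>(1)] \<sigma> \<eta>(2) by (intro vcobd_cong) auto
        then have "d i (\<lambda>b. \<psi> \<sigma> b - vcobd \<eta> \<sigma> b) = (\<lambda>_. 0)"
          unfolding lincomb_diff using \<omega>(2)[OF \<sigma>(1)] \<sigma> by simp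
        ultimately show "(\<lambda>b. \<psi> \<sigma> b - vcobd \<eta> \<sigma> b) \<in> Z (Suc i) \<sigma>"
          by (simp add: ZSuc[OF fin(2)[OF \<sigma>(1)]])
      next
        fix \<sigma> assume \<sigma>: "\<sigma> \<subseteq> W" "card \<sigma> = Suc q"
        show "\<Phi> \<sigma> = vcobd (\<lambda>\<sigma> b. \<psi> \<sigma> b - vcobd \<eta> \<sigma> b) \<sigma>"
          unfolding vcobd_diff vcobd_vcobd[OF fin(1)[OF \<sigma>(1)]] using \<psi>(2)[OF \<sigma>] by simp
      qed
    qed
  }
qed

text \<open>
  The same sequence for the ideal, the ring and the Stanley-Reisner ring. As \<open>W\<close> is
  nonempty, contraction with any \<open>w\<close> in \<open>W\<close> shows that the ring has no
  cohomology.
\<close>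

lemma koszul_base:
  assumes W: "W \<subseteq> V" "W \<noteq> {}"
  shows "koszul (Suc q) (Z 0) W \<longleftrightarrow> has_coh TYPE('k) q {\<sigma> \<in> D. \<sigma> \<subseteq> W}"
proof
  have fW: "finite W" using W finV finite_subset by blast
  have fin: "finite \<sigma>" "\<sigma> \<subseteq> V" if "\<sigma> \<subseteq> W" for \<sigma> using that W fW finite_subset by auto
  have S0: "S 0 \<sigma> = {f. \<forall>b. b \<noteq> 0 \<longrightarrow> f b = 0}" for \<sigma>
  proof -
    have "a < r 0 \<and> L 0 a \<subseteq> \<sigma> \<longleftrightarrow> a = 0" for a using r0 L0 by auto
    then show ?thesis unfolding supp_mod_def by auto
  qed
  have Z0': "f \<in> Z 0 \<sigma> \<longleftrightarrow> (\<forall>b. b \<noteq> 0 \<longrightarrow> f b = 0) \<and> (\<sigma> \<in> D \<longrightarrow> f 0 = 0)" if "\<sigma> \<subseteq> W" for f \<sigma>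
  proof (cases "\<sigma> \<in> D")
    case True
    then show ?thesis unfolding Z0[OF fin(2)[OF that]] fun_eq_iff by simp (metis gr0I)
  next
    case False
    then show ?thesis unfolding Z0[OF fin(2)[OF that]] S0 by simp
  qed
  define emb where "emb = (\<lambda>(\<phi> :: 'v set \<Rightarrow> 'k) \<sigma> b. if b = (0::nat) then \<phi> \<sigma> else 0)"
  have v_emb: "vcobd (emb \<phi>) \<sigma> = emb (cobd \<phi>) \<sigma>" for \<phi> \<sigma>
    by (auto simp: vcobd_def emb_def fun_eq_iff)
  {
    assume "koszul (Suc q) (Z 0) W"
    then obtain \<Phi> where \<Phi>: "\<And>\<sigma>. \<sigma> \<subseteq> W \<Longrightarrow> card \<sigma> = Suc q \<Longrightarrow> \<Phi> \<sigma> \<in> Z 0 \<sigma>"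
      "\<And>\<tau>. \<tau> \<subseteq> W \<Longrightarrow> card \<tau> = Suc (Suc q) \<Longrightarrow> vcobd \<Phi> \<tau> = (\<lambda>_. 0)"
      and no: "\<And>\<psi>. (\<And>\<sigma>. \<sigma> \<subseteq> W \<Longrightarrow> Suc (card \<sigma>) = Suc q \<Longrightarrow> \<psi> \<sigma> \<in> Z 0 \<sigma>) \<Longrightarrow>
        (\<And>\<sigma>. \<sigma> \<subseteq> W \<Longrightarrow> card \<sigma> = Suc q \<Longrightarrow> \<Phi> \<sigma> = vcobd \<psi> \<sigma>) \<Longrightarrow> False"
      by (rule koszulE) blast
    obtain w where w: "w \<in> W" using W by auto
    define \<psi> where "\<psi> = contr w (\<lambda>\<sigma>. \<Phi> \<sigma> 0)"
    have \<psi>: "\<Phi> \<sigma> 0 = cobd \<psi> \<sigma>" if \<sigma>: "\<sigma> \<subseteq> W" "card \<sigma> = Suc q" for \<sigma>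
      unfolding \<psi>_def
    proof (rule cobd_contr[OF fin(1)[OF \<sigma>(1)], symmetric])
      assume "w \<notin> \<sigma>"
      then have "insert w \<sigma> \<subseteq> W" "card (insert w \<sigma>) = Suc (Suc q)" using w \<sigma> fin by auto
      then show "cobd (\<lambda>\<sigma>. \<Phi> \<sigma> 0) (insert w \<sigma>) = 0"
        using fun_cong[OF \<Phi>(2), of "insert w \<sigma>" 0] by (simp add: vcobd_def)
    qed
    have "cocycle q {\<sigma> \<in> D. \<sigma> \<subseteq> W} \<psi>"
      unfolding cocycle_def using \<psi> \<Phi>(1) Z0' by fastforce
    moreover have "\<not> coboundary q {\<sigma> \<in> D. \<sigma> \<subseteq> W} \<psi>"
    proof
      assume "coboundary q {\<sigma> \<in> D. \<sigma> \<subseteq> W} \<psi>"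
      then obtain \<chi> where \<chi>: "\<And>\<sigma>. \<sigma> \<in> D \<Longrightarrow> \<sigma> \<subseteq> W \<Longrightarrow> card \<sigma> = q \<Longrightarrow> \<psi> \<sigma> = cobd \<chi> \<sigma>"
        unfolding coboundary_def by blast
      show False
      proof (rule no[of "emb (\<lambda>\<sigma>. \<psi> \<sigma> - cobd \<chi> \<sigma>)"])
        show "emb (\<lambda>\<sigma>. \<psi> \<sigma> - cobd \<chi> \<sigma>) \<sigma> \<in> Z 0 \<sigma>" if "\<sigma> \<subseteq> W" "Suc (card \<sigma>) = Suc q" for \<sigma>
          using \<chi>[of \<sigma>] that unfolding Z0'[OF that(1)] by (auto simp: emb_def)
        show "\<Phi> \<sigma> = vcobd (emb (\<lambda>\<sigma>. \<psi> \<sigma> - cobd \<chi> \<sigma>)) \<sigma>" if \<sigma>: "\<sigma> \<subseteq> W" "card \<sigma> = Suc q" for \<sigma>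
        proof
          fix b
          show "\<Phi> \<sigma> b = vcobd (emb (\<lambda>\<sigma>. \<psi> \<sigma> - cobd \<chi> \<sigma>)) \<sigma> b"
            using \<psi>[OF \<sigma>] \<Phi>(1)[OF \<sigma>] cobd_cobd[OF fin(1)[OF \<sigma>(1)], of \<chi>] unfolding v_emb Z0'[OF \<sigma>(1)]
            by (cases "b = 0") (auto simp: emb_def cobd_diff)
        qed
      qed
    qed
    ultimately show "has_coh TYPE('k) q {\<sigma> \<in> D. \<sigma> \<subseteq> W}" unfolding has_coh_def by blast
  next
    assume "has_coh TYPE('k) q {\<sigma> \<in> D. \<sigma> \<subseteq> W}"
    then obtain \<phi> :: "'v set \<Rightarrow> 'k" where c: "cocycle q {\<sigma> \<in> D. \<sigma> \<subseteq> W} \<phi>" and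
      no: "\<not> coboundary q {\<sigma> \<in> D. \<sigma> \<subseteq> W} \<phi>" unfolding has_coh_def by blast
    have c: "cobd \<phi> \<sigma> = 0" if "\<sigma> \<in> D" "\<sigma> \<subseteq> W" "card \<sigma> = Suc q" for \<sigma>
      using c that unfolding cocycle_def by blast
    show "koszul (Suc q) (Z 0) W"
    proof (rule koszulI[of _ _ "emb (cobd \<phi>)"])
      show "emb (cobd \<phi>) \<sigma> \<in> Z 0 \<sigma>" if "\<sigma> \<subseteq> W" "card \<sigma> = Suc q" for \<sigma>
        using c[of \<sigma>] that unfolding Z0'[OF that(1)] by (auto simp: emb_def)
      show "vcobd (emb (cobd \<phi>)) \<tau> = (\<lambda>_. 0)" if "\<tau> \<subseteq> W" for \<tau>
        unfolding v_emb using cobd_cobd[OF fin(1)[OF that], of \<phi>] by (auto simp: emb_def)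
    next
      fix \<psi> assume \<psi>: "\<And>\<sigma>. \<sigma> \<subseteq> W \<Longrightarrow> Suc (card \<sigma>) = Suc q \<Longrightarrow> \<psi> \<sigma> \<in> Z 0 \<sigma>"
        "\<And>\<sigma>. \<sigma> \<subseteq> W \<Longrightarrow> card \<sigma> = Suc q \<Longrightarrow> emb (cobd \<phi>) \<sigma> = vcobd \<psi> \<sigma>"
      obtain w where w: "w \<in> W" using W by auto
      define \<eta> where "\<eta> = (\<lambda>\<sigma>. \<phi> \<sigma> - \<psi> \<sigma> 0)"
      have \<eta>: "cobd \<eta> \<sigma> = 0" if "\<sigma> \<subseteq> W" "card \<sigma> = Suc q" for \<sigma>
        using fun_cong[OF \<psi>(2)[OF that], of 0] by (simp add: \<eta>_def cobd_diff emb_def vcobd_def)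
      have "\<phi> \<sigma> = cobd (contr w \<eta>) \<sigma>" if \<sigma>: "\<sigma> \<in> D" "\<sigma> \<subseteq> W" "card \<sigma> = q" for \<sigma>
      proof -
        have "\<psi> \<sigma> 0 = 0" using \<psi>(1)[OF \<sigma>(2)] \<sigma> Z0'[OF \<sigma>(2)] by simp
        moreover have "cobd (contr w \<eta>) \<sigma> = \<eta> \<sigma>"
          using \<sigma> w fin by (intro cobd_contr \<eta>) auto
        ultimately show ?thesis by (simp add: \<eta>_def)
      qed
      then have "coboundary q {\<sigma> \<in> D. \<sigma> \<subseteq> W} \<phi>" unfolding coboundary_def by blast
      then show False using no by blast
    qed
  }
qed

text \<open>
  In top degree, Koszul cohomology is \<open>Z i W\<close> modulo the sum of the values at proper
  subsets, the space of generators of multidegree \<open>W\<close>.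
\<close>

lemma koszul_top:
  assumes W: "W \<subseteq> V"
  shows "koszul (card W) (Z i) W \<longleftrightarrow> (\<exists>a<r (Suc i). L (Suc i) a = W)"
proof
  have fW: "finite W" using W finV finite_subset by blast
  have top: "\<sigma> = W" if "\<sigma> \<subseteq> W" "card \<sigma> = card W" for \<sigma> using card_subset_eq[OF fW that] .
  {
    assume "koszul (card W) (Z i) W"
    then obtain \<phi> where \<phi>: "\<phi> W \<in> Z i W"
      and no: "\<And>\<psi>. (\<And>\<sigma>. \<sigma> \<subseteq> W \<Longrightarrow> Suc (card \<sigma>) = card W \<Longrightarrow> \<psi> \<sigma> \<in> Z i \<sigma>) \<Longrightarrow>
        (\<And>\<sigma>. \<sigma> \<subseteq> W \<Longrightarrow> card \<sigma> = card W \<Longrightarrow> \<phi> \<sigma> = vcobd \<psi> \<sigma>) \<Longrightarrow> False"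
      by (rule koszulE) blast
    show "\<exists>a<r (Suc i). L (Suc i) a = W"
    proof (rule ccontr)
      assume none: "\<not> (\<exists>a<r (Suc i). L (Suc i) a = W)"
      obtain f where f: "f \<in> S (Suc i) W" "\<phi> W = d i f" using gen_span[OF W \<phi>] by blast
      have "\<exists>\<psi>. (\<forall>\<sigma>. \<sigma> \<subseteq> W \<longrightarrow> Suc (card \<sigma>) = card W \<longrightarrow> \<psi> \<sigma> \<in> S (Suc i) \<sigma>) \<and>
          (\<forall>\<sigma>. \<sigma> \<subseteq> W \<longrightarrow> card \<sigma> = card W \<longrightarrow> (\<lambda>\<sigma>. f) \<sigma> = vcobd \<psi> \<sigma>)"
      proof (rule vcobd_exact_free[OF fW])
        fix \<sigma> b assume \<sigma>: "\<sigma> \<subseteq> W" "card \<sigma> = card W"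
        show "f \<in> S (Suc i) \<sigma>" using f top[OF \<sigma>] by simp
        assume "f b \<noteq> 0"
        then show "L (Suc i) b \<noteq> W" using none f(1) by (auto simp: supp_mod_def)
      next
        fix \<tau> assume "\<tau> \<subseteq> W" "card \<tau> = Suc (card W)"
        then show "vcobd (\<lambda>\<sigma>. f) \<tau> = (\<lambda>_. 0)" using card_mono[OF fW, of \<tau>] by simp
      qed
      then obtain \<psi> where \<psi>: "\<And>\<sigma>. \<sigma> \<subseteq> W \<Longrightarrow> Suc (card \<sigma>) = card W \<Longrightarrow> \<psi> \<sigma> \<in> S (Suc i) \<sigma>"
        "f = vcobd \<psi> W" by blast
      show False
      proof (rule no[of "\<lambda>\<sigma>. d i (\<psi> \<sigma>)"])
        show "d i (\<psi> \<sigma>) \<in> Z i \<sigma>" if "\<sigma> \<subseteq> W" "Suc (card \<sigma>) = card W" for \<sigma>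
          using d_in_Z[OF _ \<psi>(1)[OF that]] that W by blast
        show "\<phi> \<sigma> = vcobd (\<lambda>\<sigma>. d i (\<psi> \<sigma>)) \<sigma>" if "\<sigma> \<subseteq> W" "card \<sigma> = card W" for \<sigma>
          unfolding vcobd_lincomb top[OF that] using f(2) \<psi>(2) by simp
      qed
    qed
  next
    assume "\<exists>a<r (Suc i). L (Suc i) a = W"
    then obtain a where a: "a < r (Suc i)" "L (Suc i) a = W" by blast
    show "koszul (card W) (Z i) W"
    proof (rule koszulI[of _ _ "\<lambda>_. c i a"])
      show "c i a \<in> Z i \<sigma>" if "\<sigma> \<subseteq> W" "card \<sigma> = card W" for \<sigma>
        using gen_in[OF a(1)] a(2) top[OF that] by simp
      show "vcobd (\<lambda>_. c i a) \<tau> = (\<lambda>_. 0)" if "\<tau> \<subseteq> W" "card \<tau> = Suc (card W)" for \<tau>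
        using that card_mono[OF fW, of \<tau>] by simp
    next
      fix \<psi> assume \<psi>: "\<And>\<sigma>. \<sigma> \<subseteq> W \<Longrightarrow> Suc (card \<sigma>) = card W \<Longrightarrow> \<psi> \<sigma> \<in> Z i \<sigma>"
        "\<And>\<sigma>. \<sigma> \<subseteq> W \<Longrightarrow> card \<sigma> = card W \<Longrightarrow> c i a = vcobd \<psi> \<sigma>"
      obtain \<eta> where \<eta>: "\<And>\<sigma>. \<sigma> \<subseteq> W \<Longrightarrow> Suc (card \<sigma>) = card W \<Longrightarrow> \<eta> \<sigma> \<in> S (Suc i) \<sigma>"
        "\<And>\<sigma>. \<sigma> \<subseteq> W \<Longrightarrow> Suc (card \<sigma>) = card W \<Longrightarrow> \<psi> \<sigma> = d i (\<eta> \<sigma>)"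
        using lift_choice[OF W, of "\<lambda>\<sigma>. Suc (card \<sigma>) = card W" \<psi> i] \<psi>(1) by blast
      have fc: "W - {v} \<subseteq> W" "Suc (card (W - {v})) = card W" if "v \<in> W" for v
        using that card_Suc_Diff1[OF fW that] by auto
      define u where "u = (\<lambda>b. if b = a then 1 else (0::'k))"
      have uS: "u \<in> S (Suc i) W" using a by (auto simp: u_def supp_mod_def)
      have du: "d i u = c i a" unfolding u_def by (rule lincomb_unit[OF a(1)])
      have \<eta>S: "vcobd \<eta> W \<in> S (Suc i) W"
        by (rule vcobd_mem[OF subfunctor_supp_mod W]) (use fc \<eta>(1) in blast)
      have "d i (vcobd \<eta> W) = vcobd \<psi> W"
        unfolding vcobd_lincomb[symmetric] using fc \<eta>(2) by (intro vcobd_cong) simp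
      then have "d i (\<lambda>b. u b - vcobd \<eta> W b) = (\<lambda>_. 0)"
        unfolding lincomb_diff du using \<psi>(2)[of W] by simp
      then have "(\<lambda>b. u b - vcobd \<eta> W b) \<in> Z (Suc i) W"
        using subfunctor_diff[OF subfunctor_supp_mod W uS \<eta>S] by (simp add: ZSuc[OF W])
      then have "u a = vcobd \<eta> W a" using minimal[OF W _ a(2)] by fastforce
      moreover have "vcobd \<eta> W a = 0"
      proof -
        have "\<eta> (W - {v}) a = 0" if "v \<in> W" for v
          using \<eta>(1)[OF fc[OF that]] a that by (auto simp: supp_mod_def)
        then show ?thesis unfolding vcobd_def cobd_def by (simp add: sum.neutral)
      qed
      ultimately show False by (simp add: u_def)
    qed
  }
qed

text \<open>
  Hochster's formula, as a criterion for nonvanishing. The condition \<open>Suc i \<le> card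
  W\<close> makes the subtraction of natural numbers an honest one.
\<close>

theorem generator_iff_coh:
  assumes W: "W \<subseteq> V"
  shows "(\<exists>a<r (Suc i). L (Suc i) a = W) \<longleftrightarrow>
    Suc i \<le> card W \<and> has_coh TYPE('k) (card W - Suc i) {\<sigma> \<in> D. \<sigma> \<subseteq> W}"
proof (cases "Suc i \<le> card W")
  case False
  then show ?thesis using card_label[of _ "Suc i"] by fastforce
next
  case True
  have shift: "koszul (m + j) (Z j) W \<longleftrightarrow> koszul m (Z 0) W" if "m + j \<le> card W" for m j
    using that
  proof (induction j)
    case (Suc j)
    then show ?case using koszul_shift[OF W, of "m + j" j] by simp
  qed simp
  have "(\<exists>a<r (Suc i). L (Suc i) a = W) \<longleftrightarrow> koszul (card W) (Z i) W"
    by (rule koszul_top[OF W, symmetric])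
  also have "\<dots> \<longleftrightarrow> koszul (Suc (card W - Suc i)) (Z 0) W"
    using shift[of "Suc (card W - Suc i)" i] True by simp
  also have "\<dots> \<longleftrightarrow> has_coh TYPE('k) (card W - Suc i) {\<sigma> \<in> D. \<sigma> \<subseteq> W}"
    using True by (intro koszul_base[OF W]) auto
  finally show ?thesis using True by simp
qed

end

section \<open>Polynomials by their coefficients\<close>

abbreviation "lookup \<equiv> Poly_Mapping.lookup"
abbreviation "keys \<equiv> Poly_Mapping.keys"

text \<open>Divisibility of power products.\<close>

definition pdvd :: "('v \<Rightarrow>\<^sub>0 nat) \<Rightarrow> ('v \<Rightarrow>\<^sub>0 nat) \<Rightarrow> bool" where
  "pdvd t m \<longleftrightarrow> (\<forall>v. lookup t v \<le> lookup m v)"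

lemma pdvd_diff_add: "pdvd t m \<Longrightarrow> (m - t) + t = m"
  by (rule poly_mapping_eqI) (simp add: pdvd_def lookup_add lookup_minus)

lemma add_eq_iff_pdvd: "s + t = m \<longleftrightarrow> pdvd t m \<and> s = m - (t :: 'v \<Rightarrow>\<^sub>0 nat)"
  by (auto simp: pdvd_diff_add) (auto simp: pdvd_def lookup_add)

lemma sum_single_keys: "(\<Sum>m\<in>keys p. Poly_Mapping.single m (lookup p m)) = p"
  by (rule poly_mapping_eqI)
    (simp add: lookup_sum lookup_single when_def in_keys_iff)

lemma lookup_times_single:
  fixes p :: "('v, 'k::field) mpoly"
  shows "lookup (p * Poly_Mapping.single t c) m = (if pdvd t m then lookup p (m - t) * c else 0)"
proof -
  have "p * Poly_Mapping.single t c = (\<Sum>s\<in>keys p. Poly_Mapping.single (s + t) (lookup p s * c))"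
    by (subst sum_single_keys[of p, symmetric]) (simp add: sum_distrib_right mult_single)
  then have "lookup (p * Poly_Mapping.single t c) m = (\<Sum>s\<in>keys p. if s + t = m then lookup p s * c else 0)"
    by (simp add: lookup_sum lookup_single when_def)
  also have "\<dots> = (\<Sum>s\<in>keys p. if s = m - t then (if pdvd t m then lookup p (m - t) * c else 0) else 0)"
    by (intro sum.cong refl) (auto simp: add_eq_iff_pdvd)
  also have "\<dots> = (if pdvd t m then lookup p (m - t) * c else 0)"
    by (simp add: in_keys_iff)
  finally show ?thesis .
qed

lemma lookup_times:
  fixes p q :: "('v, 'k::field) mpoly"
  shows "lookup (p * q) m = (\<Sum>s\<in>keys q. if pdvd s m then lookup p (m - s) * lookup q s else 0)"
proof -
  have "p * q = (\<Sum>s\<in>keys q. p * Poly_Mapping.single s (lookup q s))"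
    by (subst sum_single_keys[of q, symmetric]) (simp add: sum_distrib_left)
  then show ?thesis by (simp add: lookup_sum lookup_times_single)
qed

lemma lookup_times_0:
  fixes p q :: "('v, 'k::field) mpoly"
  shows "lookup (p * q) 0 = lookup p 0 * lookup q 0"
proof -
  have "pdvd s 0 \<longleftrightarrow> s = 0" for s :: "'v \<Rightarrow>\<^sub>0 nat" by (auto simp: pdvd_def intro: poly_mapping_eqI)
  then have "lookup (p * q) 0 = (\<Sum>s\<in>keys q. if s = 0 then lookup p 0 * lookup q 0 else 0)"
    unfolding lookup_times by (intro sum.cong) auto
  then show ?thesis by (simp add: in_keys_iff)
qed

lemma total_deg_superset:
  assumes "finite A" "keys m \<subseteq> A" shows "total_deg m = (\<Sum>v\<in>A. lookup m v)"
  unfolding total_deg_def using assms by (intro sum.mono_neutral_left) (auto simp: in_keys_iff)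

lemma total_deg_add: "total_deg (s + t) = total_deg s + total_deg t"
proof -
  let ?A = "keys s \<union> keys t"
  have "total_deg (s + t) = (\<Sum>v\<in>?A. lookup (s + t) v)"
    using Poly_Mapping.keys_add[of s t] by (intro total_deg_superset) auto
  also have "\<dots> = (\<Sum>v\<in>?A. lookup s v) + (\<Sum>v\<in>?A. lookup t v)" by (simp add: lookup_add sum.distrib)
  also have "\<dots> = total_deg s + total_deg t"
    by (simp add: total_deg_superset[of ?A])
  finally show ?thesis .
qed

lemma poly_ring_iff: "p \<in> poly_ring V \<longleftrightarrow> (\<forall>m. lookup p m \<noteq> 0 \<longrightarrow> keys m \<subseteq> V)"
  by (auto simp: poly_ring_def in_keys_iff)

lemma poly_ring_0 [simp]: "0 \<in> poly_ring V" and poly_ring_1 [simp]: "1 \<in> poly_ring V"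
  by (simp_all add: poly_ring_def)

lemma poly_ring_add: "p \<in> poly_ring V \<Longrightarrow> q \<in> poly_ring V \<Longrightarrow> p + q \<in> poly_ring V"
  unfolding poly_ring_def using Poly_Mapping.keys_add[of p q] by blast

lemma poly_ring_uminus: "p \<in> poly_ring V \<Longrightarrow> - p \<in> poly_ring V"
  by (simp add: poly_ring_def)

lemma poly_ring_diff: "p \<in> poly_ring V \<Longrightarrow> q \<in> poly_ring V \<Longrightarrow> p - q \<in> poly_ring V"
  using poly_ring_add[of p V "- q"] poly_ring_uminus[of q V] by simp

lemma poly_ring_mult: "p \<in> poly_ring V \<Longrightarrow> q \<in> poly_ring V \<Longrightarrow> p * q \<in> poly_ring V"
  unfolding poly_ring_def
proof (intro CollectI ballI)
  fix m assume pq: "p \<in> {p. \<forall>m\<in>keys p. keys m \<subseteq> V}" "q \<in> {p. \<forall>m\<in>keys p. keys m \<subseteq> V}" "m \<in> keys (p * q)"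
  then obtain a b where "a \<in> keys p" "b \<in> keys q" "m = a + b" using Poly_Mapping.keys_mult[of p q] by blast
  then show "keys m \<subseteq> V" using pq Poly_Mapping.keys_add[of a b] by blast
qed

lemma poly_ring_sum: "(\<And>a. a \<in> A \<Longrightarrow> f a \<in> poly_ring V) \<Longrightarrow> (\<Sum>a\<in>A. f a) \<in> poly_ring V"
  by (induction A rule: infinite_finite_induct) (auto intro: poly_ring_add)

lemma poly_ring_single: "keys t \<subseteq> V \<Longrightarrow> Poly_Mapping.single t c \<in> poly_ring V"
  by (auto simp: poly_ring_def)

lemma homogeneous_iff: "homogeneous d p \<longleftrightarrow> (\<forall>m. lookup p m \<noteq> 0 \<longrightarrow> int (total_deg m) = d)"
  by (auto simp: homogeneous_def in_keys_iff)

text \<open>The homogeneous component of degree \<open>d\<close>.\<close>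

definition hpart :: "int \<Rightarrow> ('v, 'k::field) mpoly \<Rightarrow> ('v, 'k) mpoly" where
  "hpart d p = (\<Sum>m | m \<in> keys p \<and> int (total_deg m) = d. Poly_Mapping.single m (lookup p m))"

lemma lookup_hpart: "lookup (hpart d p) m = (if int (total_deg m) = d then lookup p m else 0)"
  by (simp add: hpart_def lookup_sum lookup_single when_def in_keys_iff)

lemma hpart_sum: "hpart d (\<Sum>a\<in>A. f a) = (\<Sum>a\<in>A. hpart d (f a))"
  by (rule poly_mapping_eqI) (simp add: lookup_hpart lookup_sum)

lemma hpart_poly_ring: "p \<in> poly_ring V \<Longrightarrow> hpart d p \<in> poly_ring V"
  by (auto simp: poly_ring_iff lookup_hpart)

lemma homogeneous_hpart: "homogeneous d (hpart d p)"
  by (simp add: homogeneous_iff lookup_hpart)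

lemma hpart_times:
  fixes p q :: "('v, 'k::field) mpoly"
  assumes "homogeneous e q" shows "hpart d (p * q) = hpart (d - e) p * q"
proof (rule poly_mapping_eqI)
  fix m
  have "int (total_deg m) = int (total_deg (m - s)) + e" if "s \<in> keys q" "pdvd s m" for s
    using pdvd_diff_add[OF that(2)] total_deg_add[of "m - s" s] assms that(1) by (simp add: homogeneous_def)
  then show "lookup (hpart d (p * q)) m = lookup (hpart (d - e) p * q) m"
    unfolding lookup_hpart lookup_times by (auto intro!: sum.cong sum.neutral[symmetric] sum.neutral)
qed

section \<open>Comparison of minimal graded free resolutions\<close>

text \<open>
  Product of matrices whose inner index runs below \<open>n\<close>. Matrices act on row vectors
  from the right, as in the definition of free complexes.
\<close>

definition mm :: "nat \<Rightarrow> (nat \<Rightarrow> nat \<Rightarrow> 'a::comm_ring_1) \<Rightarrow> (nat \<Rightarrow> nat \<Rightarrow> 'a) \<Rightarrow> nat \<Rightarrow> nat \<Rightarrow> 'a" where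
  "mm n A B = (\<lambda>a b. \<Sum>c<n. A a c * B c b)"

lemma mm_assoc: "mm n (mm m A B) C = mm m A (mm n B C)"
proof (intro ext)
  fix a b
  have "mm n (mm m A B) C a b = (\<Sum>c<n. \<Sum>d<m. A a d * B d c * C c b)"
    by (simp add: mm_def sum_distrib_right)
  also have "\<dots> = (\<Sum>d<m. \<Sum>c<n. A a d * B d c * C c b)" by (rule sum.swap)
  finally show "mm n (mm m A B) C a b = mm m A (mm n B C) a b"
    by (simp add: mm_def sum_distrib_left mult.assoc)
qed

lemma mm_cong_left: "(\<And>c. c < n \<Longrightarrow> A a c = A' a c) \<Longrightarrow> mm n A B a b = mm n A' B a b"
  by (simp add: mm_def)

lemma mm_cong_right: "(\<And>c. c < n \<Longrightarrow> B c b = B' c b) \<Longrightarrow> mm n A B a b = mm n A B' a b"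
  by (simp add: mm_def)

lemma mm_diff_left: "mm n (\<lambda>a b. A a b - A' a b) B = (\<lambda>a b. mm n A B a b - mm n A' B a b)"
  by (simp add: mm_def left_diff_distrib sum_subtractf)

lemma mm_diff_right: "mm n A (\<lambda>a b. B a b - B' a b) = (\<lambda>a b. mm n A B a b - mm n A B' a b)"
  by (simp add: mm_def right_diff_distrib sum_subtractf)

lemma mm_id_left: "a < n \<Longrightarrow> mm n (\<lambda>a b. if a = b then 1 else 0) B a b = B a b"
  by (simp add: mm_def if_distrib[of "\<lambda>x. x * _"] cong: if_cong)

lemma mm_id_right: "b < n \<Longrightarrow> mm n A (\<lambda>a b. if a = b then 1 else 0) a b = A a b"
  by (simp add: mm_def if_distrib[of "\<lambda>x. _ * x"] cong: if_cong)

lemma mm_poly_ring: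
  "(\<And>c. c < n \<Longrightarrow> A a c \<in> poly_ring V) \<Longrightarrow> (\<And>c. c < n \<Longrightarrow> B c b \<in> poly_ring V) \<Longrightarrow> mm n A B a b \<in> poly_ring V"
  unfolding mm_def by (intro poly_ring_sum poly_ring_mult) auto

lemma mm_const: "lookup (mm n A B a b) 0 = (\<Sum>c<n. lookup (A a c) 0 * lookup (B c b :: ('v, 'k::field) mpoly) 0)"
  by (simp add: mm_def lookup_sum lookup_times_0)

text \<open>
  The augmented complex of a graded free resolution of \<open>I\<close>, with all its maps,
  including the augmentation, as matrices: level 0 is the polynomial ring and level \<open>Suc
  i\<close> is the module with index \<open>i\<close> in the resolution. The sequence is exact
  except at level 0, where the image is \<open>I\<close>.
\<close>

locale exact_matrices =
  fixes V :: "'v set" and I :: "('v, 'k::field) mpoly set"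
    and r :: "nat \<Rightarrow> nat" and deg :: "nat \<Rightarrow> nat \<Rightarrow> int"
    and M :: "nat \<Rightarrow> nat \<Rightarrow> nat \<Rightarrow> ('v, 'k) mpoly"
  assumes r0: "r 0 = 1" and deg0: "deg 0 0 = 0"
    and entry: "a < r (Suc j) \<Longrightarrow> b < r j \<Longrightarrow> M j a b \<in> poly_ring V"
    and hom: "a < r (Suc j) \<Longrightarrow> b < r j \<Longrightarrow> homogeneous (deg (Suc j) a - deg j b) (M j a b)"
    and gens: "a < r 1 \<Longrightarrow> M 0 a 0 \<in> I"
    and square: "a < r (Suc (Suc j)) \<Longrightarrow> b < r j \<Longrightarrow> mm (r (Suc j)) (M (Suc j)) (M j) a b = 0"
    and exact0: "p \<in> I \<Longrightarrow> \<exists>g. (\<forall>a<r 1. g a \<in> poly_ring V) \<and> p = (\<Sum>a<r 1. g a * M 0 a 0)"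
    and exactS: "\<And>f. (\<And>b. b < r (Suc j) \<Longrightarrow> f b \<in> poly_ring V) \<Longrightarrow>
        (\<And>b. b < r j \<Longrightarrow> (\<Sum>a<r (Suc j). f a * M j a b) = 0) \<Longrightarrow>
        \<exists>g. (\<forall>a<r (Suc (Suc j)). g a \<in> poly_ring V) \<and>
          (\<forall>b<r (Suc j). f b = (\<Sum>a<r (Suc (Suc j)). g a * M (Suc j) a b))"
begin

lemma lift_rows:
  assumes "\<And>a b. a < n \<Longrightarrow> b < r (Suc j) \<Longrightarrow> A a b \<in> poly_ring V"
    and "\<And>a b. a < n \<Longrightarrow> b < r j \<Longrightarrow> mm (r (Suc j)) A (M j) a b = 0"
  shows "\<exists>B. (\<forall>a<n. \<forall>c<r (Suc (Suc j)). B a c \<in> poly_ring V) \<and>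
    (\<forall>a<n. \<forall>b<r (Suc j). A a b = mm (r (Suc (Suc j))) B (M (Suc j)) a b)"
proof -
  have "\<exists>g. a < n \<longrightarrow> (\<forall>c<r (Suc (Suc j)). g c \<in> poly_ring V) \<and>
      (\<forall>b<r (Suc j). A a b = (\<Sum>c<r (Suc (Suc j)). g c * M (Suc j) c b))" for a
  proof (cases "a < n")
    case True
    have "\<exists>g. (\<forall>c<r (Suc (Suc j)). g c \<in> poly_ring V) \<and>
        (\<forall>b<r (Suc j). A a b = (\<Sum>c<r (Suc (Suc j)). g c * M (Suc j) c b))"
      by (rule exactS) (use assms True in \<open>auto simp: mm_def\<close>)
    then show ?thesis by blast
  qed simp
  then have "\<forall>a. \<exists>g. a < n \<longrightarrow> (\<forall>c<r (Suc (Suc j)). g c \<in> poly_ring V) \<and>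
      (\<forall>b<r (Suc j). A a b = (\<Sum>c<r (Suc (Suc j)). g c * M (Suc j) c b))" by (rule allI)
  from choice[OF this] obtain B where
    "\<And>a. a < n \<Longrightarrow> (\<forall>c<r (Suc (Suc j)). B a c \<in> poly_ring V) \<and>
      (\<forall>b<r (Suc j). A a b = (\<Sum>c<r (Suc (Suc j)). B a c * M (Suc j) c b))" by blast
  then show ?thesis unfolding mm_def by (intro exI[of _ B]) simp
qed

lemma lift_rows0:
  assumes "\<And>a. a < n \<Longrightarrow> A a 0 \<in> I"
  shows "\<exists>B. (\<forall>a<n. \<forall>c<r (Suc 0). B a c \<in> poly_ring V) \<and>
    (\<forall>a<n. \<forall>b<r 0. A a b = mm (r (Suc 0)) B (M 0) a b)"
proof -
  have "\<exists>g. a < n \<longrightarrow> (\<forall>c<r 1. g c \<in> poly_ring V) \<and> A a 0 = (\<Sum>c<r 1. g c * M 0 c 0)" for a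
    using exact0[of "A a 0"] assms[of a] by blast
  then have "\<forall>a. \<exists>g. a < n \<longrightarrow> (\<forall>c<r 1. g c \<in> poly_ring V) \<and> A a 0 = (\<Sum>c<r 1. g c * M 0 c 0)"
    by (rule allI)
  from choice[OF this] obtain B where
    "\<And>a. a < n \<Longrightarrow> (\<forall>c<r 1. B a c \<in> poly_ring V) \<and> A a 0 = (\<Sum>c<r 1. B a c * M 0 c 0)" by blast
  then show ?thesis unfolding mm_def by (intro exI[of _ B]) (simp add: r0)
qed

definition minimal :: bool where
  "minimal \<longleftrightarrow> (\<forall>j. \<forall>a<r (Suc (Suc j)). \<forall>b<r (Suc j). lookup (M (Suc j) a b) 0 = 0)"

text \<open>
  A chain endomorphism that is zero on the ring is null-homotopic, \<open>\<Theta> (Suc j) = M j H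
  + H' M (Suc j)\<close>, and so it is zero modulo the variables at the levels where both matrices
  are. At level 1 the first summand is absent because \<open>\<Theta> 0\<close> is zero, so that
  the augmentation, which need not vanish modulo the variables, does not enter. The homotopies are
  built level by level, and only the last one has to be remembered.
\<close>

lemma null_homotopic_const:
  assumes min: minimal
    and ring: "\<And>j a b. a < r j \<Longrightarrow> b < r j \<Longrightarrow> \<Theta> j a b \<in> poly_ring V"
    and zero: "\<Theta> 0 0 0 = 0"
    and chain: "\<And>j a b. a < r (Suc j) \<Longrightarrow> b < r j \<Longrightarrow>
      mm (r (Suc j)) (\<Theta> (Suc j)) (M j) a b = mm (r j) (M j) (\<Theta> j) a b"
    and ab: "a < r (Suc j)" "b < r (Suc j)"
  shows "lookup (\<Theta> (Suc j) a b) 0 = 0"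
proof -
  have m0: "lookup (M (Suc j) a b) 0 = 0" if "a < r (Suc (Suc j))" "b < r (Suc j)" for j a b
    using min that by (simp add: minimal_def)
  have "(\<forall>a<r (Suc j). \<forall>b<r (Suc j). lookup (\<Theta> (Suc j) a b) 0 = 0) \<and>
    (\<exists>H. (\<forall>a<r (Suc j). \<forall>b<r (Suc (Suc j)). H a b \<in> poly_ring V) \<and>
      (\<forall>a<r (Suc (Suc j)). \<forall>b<r (Suc j).
        mm (r (Suc j)) (M (Suc j)) (\<lambda>a b. \<Theta> (Suc j) a b - mm (r (Suc (Suc j))) H (M (Suc j)) a b) a b = 0))"
  proof (induction j)
    case 0
    have "mm (r (Suc 0)) (\<Theta> (Suc 0)) (M 0) a b = 0" if "a < r (Suc 0)" "b < r 0" for a b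
      using chain[OF that] zero that by (simp add: mm_def r0)
    then obtain H where H: "\<forall>a<r (Suc 0). \<forall>c<r (Suc (Suc 0)). H a c \<in> poly_ring V"
      "\<forall>a<r (Suc 0). \<forall>b<r (Suc 0). \<Theta> (Suc 0) a b = mm (r (Suc (Suc 0))) H (M (Suc 0)) a b"
      using lift_rows[of "r (Suc 0)" 0 "\<Theta> (Suc 0)"] ring by blast
    have "lookup (\<Theta> (Suc 0) a b) 0 = 0" if "a < r (Suc 0)" "b < r (Suc 0)" for a b
      using H(2) that m0 by (simp add: mm_const)
    moreover have "mm (r (Suc 0)) (M (Suc 0)) (\<lambda>a b. \<Theta> (Suc 0) a b - mm (r (Suc (Suc 0))) H (M (Suc 0)) a b) a b = 0"
      if "b < r (Suc 0)" for a b
      using H(2) that by (simp add: mm_def[of "r (Suc 0)"])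
    ultimately show ?case using H(1) by blast
  next
    case (Suc j)
    let ?n = "r (Suc j)" and ?n' = "r (Suc (Suc j))" and ?n'' = "r (Suc (Suc (Suc j)))"
    let ?M = "M (Suc j)" and ?M' = "M (Suc (Suc j))" and ?T = "\<Theta> (Suc j)" and ?T' = "\<Theta> (Suc (Suc j))"
    obtain H where H: "\<forall>a<?n. \<forall>b<?n'. H a b \<in> poly_ring V"
      "\<And>a b. a < ?n' \<Longrightarrow> b < ?n \<Longrightarrow> mm ?n ?M (\<lambda>a b. ?T a b - mm ?n' H ?M a b) a b = 0"
      using Suc.IH by blast
    define X where "X = (\<lambda>a b. ?T' a b - mm ?n ?M H a b)"
    have Xr: "X a b \<in> poly_ring V" if "a < ?n'" "b < ?n'" for a b
      unfolding X_def using that ring H(1) entry by (intro poly_ring_diff mm_poly_ring) auto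
    have "mm ?n' X ?M a b = 0" if "a < ?n'" "b < ?n" for a b
    proof -
      have "mm ?n' X ?M a b = mm ?n ?M ?T a b - mm ?n ?M (mm ?n' H ?M) a b"
        unfolding X_def mm_diff_left mm_assoc using chain[OF that] by simp
      also have "\<dots> = 0" using H(2)[OF that] by (simp add: mm_diff_right)
      finally show ?thesis .
    qed
    then obtain H' where H': "\<forall>a<?n'. \<forall>c<?n''. H' a c \<in> poly_ring V"
      "\<forall>a<?n'. \<forall>b<?n'. X a b = mm ?n'' H' ?M' a b"
      using lift_rows[of ?n' "Suc j" X] Xr by blast
    have T': "?T' a b = mm ?n ?M H a b + mm ?n'' H' ?M' a b" if "a < ?n'" "b < ?n'" for a b
      using H'(2) that unfolding X_def by (simp add: algebra_simps)
    have "lookup (?T' a b) 0 = 0" if "a < ?n'" "b < ?n'" for a b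
      using m0 that by (simp add: T' lookup_add mm_const)
    moreover have "mm ?n' ?M' (\<lambda>a b. ?T' a b - mm ?n'' H' ?M' a b) a b = 0" if "a < ?n''" "b < ?n'" for a b
    proof -
      have "mm ?n' ?M' (\<lambda>a b. ?T' a b - mm ?n'' H' ?M' a b) a b = mm ?n' ?M' (mm ?n ?M H) a b"
        using that by (intro mm_cong_right) (simp add: T')
      also have "\<dots> = mm ?n (mm ?n' ?M' ?M) H a b" by (simp add: mm_assoc)
      also have "\<dots> = mm ?n (\<lambda>_ _. 0) H a b" using square[OF that(1)] by (intro mm_cong_left) simp
      also have "\<dots> = 0" by (simp add: mm_def)
      finally show ?thesis .
    qed
    ultimately show ?case using H'(1) by blast
  qed
  then show ?thesis using ab by blast
qed

end

lemma chain_map_exists: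
  assumes "exact_matrices V I r deg M" "exact_matrices V I r' deg' M'"
  shows "\<exists>\<Phi>. (\<forall>j a b. a < r j \<longrightarrow> b < r' j \<longrightarrow> \<Phi> j a b \<in> poly_ring V) \<and> \<Phi> 0 = (\<lambda>_ _. 1) \<and>
    (\<forall>j a b. a < r (Suc j) \<longrightarrow> b < r' j \<longrightarrow>
      mm (r' (Suc j)) (\<Phi> (Suc j)) (M' j) a b = mm (r j) (M j) (\<Phi> j) a b)"
proof -
  interpret F: exact_matrices V I r deg M by fact
  interpret G: exact_matrices V I r' deg' M' by fact
  define P where "P = (\<lambda>j \<Phi>. (\<forall>a<r j. \<forall>b<r' j. \<Phi> a b \<in> poly_ring V) \<and>
    (case j of 0 \<Rightarrow> \<Phi> = (\<lambda>_ _. 1)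
     | Suc i \<Rightarrow> (\<forall>a<r (Suc j). \<forall>b<r' i. mm (r' j) (mm (r j) (M j) \<Phi>) (M' i) a b = 0)))"
  define Q where "Q = (\<lambda>j \<Phi> \<Phi>'. \<forall>a<r (Suc j). \<forall>b<r' j. mm (r' (Suc j)) \<Phi>' (M' j) a b = mm (r j) (M j) \<Phi> a b)"
  have "\<exists>\<Phi>. \<forall>j. P j (\<Phi> j) \<and> Q j (\<Phi> j) (\<Phi> (Suc j))"
  proof (rule dependent_nat_choice)
    show "\<exists>\<Phi>. P 0 \<Phi>" by (rule exI[of _ "\<lambda>_ _. 1"]) (simp add: P_def)
  next
    fix \<Phi> j assume P: "P j \<Phi>"
    have ring: "\<And>a b. a < r j \<Longrightarrow> b < r' j \<Longrightarrow> \<Phi> a b \<in> poly_ring V" using P by (simp add: P_def)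
    have "\<exists>B. (\<forall>a<r (Suc j). \<forall>c<r' (Suc j). B a c \<in> poly_ring V) \<and>
      (\<forall>a<r (Suc j). \<forall>b<r' j. mm (r j) (M j) \<Phi> a b = mm (r' (Suc j)) B (M' j) a b)"
    proof (cases j)
      case 0
      have "mm (r 0) (M 0) \<Phi> a 0 \<in> I" if "a < r (Suc 0)" for a
        using P F.gens[of a] that by (simp add: mm_def F.r0 P_def 0)
      then show ?thesis unfolding 0 by (rule G.lift_rows0)
    next
      case (Suc i)
      show ?thesis unfolding Suc
      proof (rule G.lift_rows)
        show "mm (r (Suc i)) (M (Suc i)) \<Phi> a b \<in> poly_ring V" if "a < r (Suc (Suc i))" "b < r' (Suc i)" for a b
          using that ring F.entry unfolding Suc by (intro mm_poly_ring) auto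
        show "mm (r' (Suc i)) (mm (r (Suc i)) (M (Suc i)) \<Phi>) (M' i) a b = 0" if "a < r (Suc (Suc i))" "b < r' i" for a b
          using P that unfolding P_def Suc by simp
      qed
    qed
    then obtain B where B: "\<forall>a<r (Suc j). \<forall>c<r' (Suc j). B a c \<in> poly_ring V"
      "\<And>a b. a < r (Suc j) \<Longrightarrow> b < r' j \<Longrightarrow> mm (r j) (M j) \<Phi> a b = mm (r' (Suc j)) B (M' j) a b" by blast
    have "mm (r' (Suc j)) (mm (r (Suc j)) (M (Suc j)) B) (M' j) a b = 0" if "a < r (Suc (Suc j))" "b < r' j" for a b
    proof -
      have "mm (r' (Suc j)) (mm (r (Suc j)) (M (Suc j)) B) (M' j) a b
          = mm (r (Suc j)) (M (Suc j)) (mm (r' (Suc j)) B (M' j)) a b" by (simp add: mm_assoc)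
      also have "\<dots> = mm (r (Suc j)) (M (Suc j)) (mm (r j) (M j) \<Phi>) a b"
        using B(2) that by (intro mm_cong_right) simp
      also have "\<dots> = mm (r j) (mm (r (Suc j)) (M (Suc j)) (M j)) \<Phi> a b" by (simp add: mm_assoc)
      also have "\<dots> = mm (r j) (\<lambda>_ _. 0) \<Phi> a b" using F.square[OF that(1)] by (intro mm_cong_left) simp
      also have "\<dots> = 0" by (simp add: mm_def)
      finally show ?thesis .
    qed
    then have "P (Suc j) B" using B(1) by (simp add: P_def)
    moreover have "Q j \<Phi> B" using B(2) by (simp add: Q_def)
    ultimately show "\<exists>\<Phi>'. P (Suc j) \<Phi>' \<and> Q j \<Phi> \<Phi>'" by blast
  qed
  then obtain \<Phi> where \<Phi>: "\<And>j. P j (\<Phi> j)" "\<And>j. Q j (\<Phi> j) (\<Phi> (Suc j))" by blast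
  have "\<Phi> 0 = (\<lambda>_ _. 1)" using \<Phi>(1)[of 0] by (simp add: P_def)
  then show ?thesis using \<Phi> unfolding P_def Q_def by (intro exI[of _ \<Phi>]) simp
qed

text \<open>
  Since all matrices of the complexes are homogeneous, the homogeneous components of degree 0 of a
  chain map form a chain map again.
\<close>

lemma homogeneous_chain_map_exists:
  assumes "exact_matrices V I r deg M" "exact_matrices V I r' deg' M'"
  shows "\<exists>\<Phi>. (\<forall>j a b. a < r j \<longrightarrow> b < r' j \<longrightarrow> \<Phi> j a b \<in> poly_ring V) \<and> \<Phi> 0 0 0 = 1 \<and>
    (\<forall>j a b. a < r (Suc j) \<longrightarrow> b < r' j \<longrightarrow>
      mm (r' (Suc j)) (\<Phi> (Suc j)) (M' j) a b = mm (r j) (M j) (\<Phi> j) a b) \<and>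
    (\<forall>j a b. homogeneous (deg j a - deg' j b) (\<Phi> j a b))"
proof -
  interpret F: exact_matrices V I r deg M by fact
  interpret G: exact_matrices V I r' deg' M' by fact
  obtain \<Phi> where \<Phi>: "\<forall>j a b. a < r j \<longrightarrow> b < r' j \<longrightarrow> \<Phi> j a b \<in> poly_ring V" "\<Phi> 0 = (\<lambda>_ _. 1)"
    "\<And>j a b. a < r (Suc j) \<Longrightarrow> b < r' j \<Longrightarrow>
      mm (r' (Suc j)) (\<Phi> (Suc j)) (M' j) a b = mm (r j) (M j) (\<Phi> j) a b"
    using chain_map_exists[OF assms] by blast
  define \<Psi> where "\<Psi> = (\<lambda>j a b. hpart (deg j a - deg' j b) (\<Phi> j a b))"
  have "\<Psi> 0 0 0 = 1"
    unfolding \<Psi>_def \<Phi>(2) F.deg0 G.deg0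
    by (rule poly_mapping_eqI) (simp add: lookup_hpart lookup_one when_def total_deg_def)
  moreover have "mm (r' (Suc j)) (\<Psi> (Suc j)) (M' j) a b = mm (r j) (M j) (\<Psi> j) a b"
    if ab: "a < r (Suc j)" "b < r' j" for j a b
  proof -
    let ?d = "deg (Suc j) a - deg' j b"
    have "mm (r' (Suc j)) (\<Psi> (Suc j)) (M' j) a b = hpart ?d (mm (r' (Suc j)) (\<Phi> (Suc j)) (M' j) a b)"
      unfolding mm_def hpart_sum
    proof (rule sum.cong)
      fix c assume "c \<in> {..<r' (Suc j)}"
      then show "\<Psi> (Suc j) a c * M' j c b = hpart ?d (\<Phi> (Suc j) a c * M' j c b)"
        using ab by (simp add: hpart_times[OF G.hom] \<Psi>_def)
    qed simp
    also have "\<dots> = hpart ?d (mm (r j) (M j) (\<Phi> j) a b)" by (simp add: \<Phi>(3)[OF ab])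
    also have "\<dots> = mm (r j) (M j) (\<Psi> j) a b"
      unfolding mm_def hpart_sum
    proof (rule sum.cong)
      fix c assume "c \<in> {..<r j}"
      then show "hpart ?d (M j a c * \<Phi> j c b) = M j a c * \<Psi> j c b"
        using ab hpart_times[OF F.hom, of a j c ?d "\<Phi> j c b"] by (simp add: mult.commute \<Psi>_def)
    qed simp
    finally show ?thesis .
  qed
  ultimately show ?thesis using \<Phi>(1)
    by (intro exI[of _ \<Psi>]) (simp add: \<Psi>_def hpart_poly_ring homogeneous_hpart)
qed

text \<open>
  Lift the identity of the ring to homogeneous chain maps in both directions. Their composite is
  the identity modulo the variables, so some entry of \<open>\<Phi>\<close> in row
  \<open>a\<close> has a constant term, and an entry with a constant term is homogeneous of degree
  0.
\<close>

lemma minimal_degrees_occur: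
  assumes F: "exact_matrices V I r deg M" and G: "exact_matrices V I r' deg' M'"
    and min: "exact_matrices.minimal r M" and a: "a < r (Suc i)"
  shows "\<exists>b<r' (Suc i). deg' (Suc i) b = deg (Suc i) a"
proof -
  interpret F: exact_matrices V I r deg M by fact
  interpret G: exact_matrices V I r' deg' M' by fact
  obtain \<Phi> where \<Phi>: "\<And>j a b. a < r j \<Longrightarrow> b < r' j \<Longrightarrow> \<Phi> j a b \<in> poly_ring V" "\<Phi> 0 0 0 = 1"
    "\<And>j a b. a < r (Suc j) \<Longrightarrow> b < r' j \<Longrightarrow>
      mm (r' (Suc j)) (\<Phi> (Suc j)) (M' j) a b = mm (r j) (M j) (\<Phi> j) a b"
    "\<And>j a b. homogeneous (deg j a - deg' j b) (\<Phi> j a b)"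
    using homogeneous_chain_map_exists[OF F G] by blast
  obtain \<Psi> where \<Psi>: "\<And>j a b. a < r' j \<Longrightarrow> b < r j \<Longrightarrow> \<Psi> j a b \<in> poly_ring V" "\<Psi> 0 0 0 = 1"
    "\<And>j a b. a < r' (Suc j) \<Longrightarrow> b < r j \<Longrightarrow>
      mm (r (Suc j)) (\<Psi> (Suc j)) (M j) a b = mm (r' j) (M' j) (\<Psi> j) a b"
    using homogeneous_chain_map_exists[OF G F] by blast
  let ?id = "\<lambda>a b :: nat. if a = b then 1 else (0 :: ('a, 'b) mpoly)"
  define \<Theta> where "\<Theta> = (\<lambda>j a b. mm (r' j) (\<Phi> j) (\<Psi> j) a b - ?id a b)"
  have "lookup (\<Theta> (Suc i) a a) 0 = 0"
  proof (rule F.null_homotopic_const[where \<Theta> = \<Theta>, OF min _ _ _ a a])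
    show "\<Theta> j a b \<in> poly_ring V" if "a < r j" "b < r j" for j a b
      unfolding \<Theta>_def using that \<Phi>(1) \<Psi>(1) by (intro poly_ring_diff mm_poly_ring) auto
    show "\<Theta> 0 0 0 = 0" by (simp add: \<Theta>_def mm_def G.r0 \<Phi>(2) \<Psi>(2))
    show "mm (r (Suc j)) (\<Theta> (Suc j)) (M j) a b = mm (r j) (M j) (\<Theta> j) a b"
      if ab: "a < r (Suc j)" "b < r j" for j a b
    proof -
      have "mm (r (Suc j)) (mm (r' (Suc j)) (\<Phi> (Suc j)) (\<Psi> (Suc j))) (M j) a b
          = mm (r' (Suc j)) (\<Phi> (Suc j)) (mm (r (Suc j)) (\<Psi> (Suc j)) (M j)) a b" by (simp add: mm_assoc)
      also have "\<dots> = mm (r' (Suc j)) (\<Phi> (Suc j)) (mm (r' j) (M' j) (\<Psi> j)) a b"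
        using \<Psi>(3) ab by (intro mm_cong_right) simp
      also have "\<dots> = mm (r' j) (mm (r' (Suc j)) (\<Phi> (Suc j)) (M' j)) (\<Psi> j) a b" by (simp add: mm_assoc)
      also have "\<dots> = mm (r' j) (mm (r j) (M j) (\<Phi> j)) (\<Psi> j) a b"
        using \<Phi>(3) ab by (intro mm_cong_left) simp
      also have "\<dots> = mm (r j) (M j) (mm (r' j) (\<Phi> j) (\<Psi> j)) a b" by (simp add: mm_assoc)
      finally show ?thesis
        unfolding \<Theta>_def mm_diff_left mm_diff_right using ab by (simp add: mm_id_left mm_id_right)
    qed
  qed
  then have "(\<Sum>b<r' (Suc i). lookup (\<Phi> (Suc i) a b) 0 * lookup (\<Psi> (Suc i) b a) 0) = 1"
    by (simp add: \<Theta>_def lookup_minus mm_const)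
  then obtain b where b: "b < r' (Suc i)" "lookup (\<Phi> (Suc i) a b) 0 \<noteq> 0"
    by (metis (no_types, lifting) lessThan_iff mult_zero_left sum.neutral zero_neq_one)
  then have "deg (Suc i) a - deg' (Suc i) b = 0"
    using \<Phi>(4)[of "Suc i" a b] by (auto simp: homogeneous_iff total_deg_def)
  then show ?thesis using b(1) by auto
qed

definition ext_rk :: "('v, 'k::field) free_complex \<Rightarrow> nat \<Rightarrow> nat" where
  "ext_rk F j = (case j of 0 \<Rightarrow> 1 | Suc i \<Rightarrow> rk F i)"

definition ext_deg :: "('v, 'k::field) free_complex \<Rightarrow> nat \<Rightarrow> nat \<Rightarrow> int" where
  "ext_deg F j = (case j of 0 \<Rightarrow> (\<lambda>_. 0) | Suc i \<Rightarrow> gdeg F i)"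

definition ext_diff :: "('v, 'k::field) free_complex \<Rightarrow> nat \<Rightarrow> nat \<Rightarrow> nat \<Rightarrow> ('v, 'k) mpoly" where
  "ext_diff F j = (case j of 0 \<Rightarrow> (\<lambda>a _. aug F a) | Suc i \<Rightarrow> diff F i)"

lemma exact_matrices_of_resolution:
  assumes "graded_free_resolution V I F"
  shows "exact_matrices V I (ext_rk F) (ext_deg F) (ext_diff F)"
proof -
  note R = assms[unfolded graded_free_resolution_def]
  have augE: "aug F a \<in> poly_ring V" "homogeneous (gdeg F 0 a) (aug F a)" if "a < rk F 0" for a
    using conjunct1[OF R] that by simp_all
  have diffE: "diff F i a b \<in> poly_ring V" "homogeneous (gdeg F (Suc i) a - gdeg F i b) (diff F i a b)"
    if "a < rk F (Suc i)" "b < rk F i" for i a b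
    using conjunct1[OF conjunct2[OF R]] that by simp_all
  have im: "aug_map F ` free_mod V (rk F 0) = I" using R by blast
  have ex0: "{f \<in> free_mod V (rk F 0). aug_map F f = 0} = diff_map F 0 ` free_mod V (rk F 1)" using R by blast
  have exS: "{f \<in> free_mod V (rk F (Suc i)). diff_map F i f = (\<lambda>_. 0)} =
          diff_map F (Suc i) ` free_mod V (rk F (Suc (Suc i)))" for i using R by blast
  define u where "u = (\<lambda>(a::nat) b. if b = a then 1 else (0 :: ('a, 'b) mpoly))"
  have u: "u a \<in> free_mod V n" if "a < n" for a n using that by (auto simp: free_mod_def u_def)
  have u_sum: "(\<Sum>c<n. u a c * x c) = x a" if "a < n" for a n x
    using that by (simp add: u_def if_distrib[of "\<lambda>x. x * _"] cong: if_cong)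
  define cut where "cut = (\<lambda>n f (b::nat). if b < n then f b else (0 :: ('a, 'b) mpoly))"
  have cut: "cut n f \<in> free_mod V n" if "\<And>b. b < n \<Longrightarrow> f b \<in> poly_ring V" for n f
    using that by (auto simp: free_mod_def cut_def)
  show ?thesis
  proof
    show "ext_rk F 0 = 1" "ext_deg F 0 0 = 0" by (simp_all add: ext_rk_def ext_deg_def)
    show "ext_diff F j a b \<in> poly_ring V" if "a < ext_rk F (Suc j)" "b < ext_rk F j" for a j b
      using that augE(1) diffE(1) by (cases j) (auto simp: ext_rk_def ext_diff_def)
    show "homogeneous (ext_deg F (Suc j) a - ext_deg F j b) (ext_diff F j a b)"
      if "a < ext_rk F (Suc j)" "b < ext_rk F j" for a j b
      using that augE(2) diffE(2) by (cases j) (auto simp: ext_rk_def ext_diff_def ext_deg_def)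
    show "ext_diff F 0 a 0 \<in> I" if a: "a < ext_rk F 1" for a
    proof -
      have a: "a < rk F 0" using a by (simp add: ext_rk_def)
      have "aug_map F (u a) \<in> I" using im u[OF a] by blast
      then show ?thesis by (simp add: aug_map_def u_sum[OF a] ext_diff_def)
    qed
    show "mm (ext_rk F (Suc j)) (ext_diff F (Suc j)) (ext_diff F j) a b = 0"
      if ab: "a < ext_rk F (Suc (Suc j))" "b < ext_rk F j" for a j b
    proof (cases j)
      case 0
      have a: "a < rk F 1" using ab 0 by (simp add: ext_rk_def)
      have "diff_map F 0 (u a) \<in> {f \<in> free_mod V (rk F 0). aug_map F f = 0}" unfolding ex0 using u[OF a] by blast
      then show ?thesis
        by (simp add: aug_map_def diff_map_def mm_def ext_rk_def ext_diff_def 0 u_sum[OF a, unfolded One_nat_def])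
    next
      case (Suc i)
      have a: "a < rk F (Suc (Suc i))" and b: "b < rk F i" using ab Suc by (simp_all add: ext_rk_def)
      have "diff_map F (Suc i) (u a) \<in> {f \<in> free_mod V (rk F (Suc i)). diff_map F i f = (\<lambda>_. 0)}"
        unfolding exS using u[OF a] by blast
      then have "diff_map F i (diff_map F (Suc i) (u a)) b = 0" by simp
      then show ?thesis using b
        by (simp add: diff_map_def mm_def ext_rk_def ext_diff_def Suc u_sum[OF a])
    qed
    show "\<exists>g. (\<forall>a<ext_rk F 1. g a \<in> poly_ring V) \<and> p = (\<Sum>a<ext_rk F 1. g a * ext_diff F 0 a 0)" if p: "p \<in> I" for p
    proof -
      obtain g where "g \<in> free_mod V (rk F 0)" "p = aug_map F g" using im p by blast
      then show ?thesis by (intro exI[of _ g]) (auto simp: aug_map_def free_mod_def ext_rk_def ext_diff_def)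
    qed
    fix j f assume ring: "\<And>b. b < ext_rk F (Suc j) \<Longrightarrow> f b \<in> poly_ring V"
      and ker: "\<And>b. b < ext_rk F j \<Longrightarrow> (\<Sum>a<ext_rk F (Suc j). f a * ext_diff F j a b) = 0"
    have f: "cut (rk F j) f \<in> free_mod V (rk F j)" using ring by (intro cut) (simp add: ext_rk_def)
    have "cut (rk F j) f \<in> diff_map F j ` free_mod V (rk F (Suc j))"
    proof (cases j)
      case 0
      have "aug_map F (cut (rk F 0) f) = 0"
        using ker[of 0] by (simp add: 0 aug_map_def cut_def ext_rk_def ext_diff_def)
      then show ?thesis using f ex0 unfolding 0 One_nat_def by blast
    next
      case (Suc i)
      have "diff_map F i (cut (rk F (Suc i)) f) = (\<lambda>_. 0)"
        using ker by (auto simp: Suc diff_map_def cut_def ext_rk_def ext_diff_def fun_eq_iff)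
      then show ?thesis using f exS[of i] unfolding Suc by blast
    qed
    then obtain g where g: "g \<in> free_mod V (rk F (Suc j))" "cut (rk F j) f = diff_map F j g" by blast
    have "f b = (\<Sum>a<rk F (Suc j). g a * diff F j a b)" if "b < rk F j" for b
      using fun_cong[OF g(2), of b] that by (simp add: cut_def diff_map_def)
    then show "\<exists>g. (\<forall>a<ext_rk F (Suc (Suc j)). g a \<in> poly_ring V) \<and>
        (\<forall>b<ext_rk F (Suc j). f b = (\<Sum>a<ext_rk F (Suc (Suc j)). g a * ext_diff F (Suc j) a b))"
      using g(1) by (intro exI[of _ g]) (auto simp: free_mod_def ext_rk_def ext_diff_def)
  qed
qed

lemma minimal_resolution_degrees:
  assumes "minimal_graded_free_resolution V I F" "minimal_graded_free_resolution V I G"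
    and a: "a < rk F i"
  shows "\<exists>b<rk G i. gdeg G i b = gdeg F i a"
proof -
  have F: "exact_matrices V I (ext_rk F) (ext_deg F) (ext_diff F)"
    and G: "exact_matrices V I (ext_rk G) (ext_deg G) (ext_diff G)"
    using assms by (auto simp: minimal_graded_free_resolution_def intro: exact_matrices_of_resolution)
  have "exact_matrices.minimal (ext_rk F) (ext_diff F)"
    using assms(1) unfolding exact_matrices.minimal_def[OF F] minimal_graded_free_resolution_def
    by (simp add: ext_rk_def ext_diff_def)
  then show ?thesis
    using minimal_degrees_occur[OF F G, of a i] a by (simp add: ext_rk_def ext_deg_def)
qed

theorem graded_betti_nonzero_iff:
  assumes "minimal_graded_free_resolution V I G"
  shows "graded_betti V I i d \<noteq> 0 \<longleftrightarrow> (\<exists>a<rk G i. gdeg G i a = d)"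
proof -
  define F where "F = (SOME F. minimal_graded_free_resolution V I F)"
  have F: "minimal_graded_free_resolution V I F" unfolding F_def using assms by (rule someI)
  have "graded_betti V I i d \<noteq> 0 \<longleftrightarrow> (\<exists>a<rk F i. gdeg F i a = d)"
    unfolding graded_betti_def F_def[symmetric] Let_def by auto
  also have "\<dots> \<longleftrightarrow> (\<exists>a<rk G i. gdeg G i a = d)"
    using minimal_resolution_degrees[OF F assms] minimal_resolution_degrees[OF assms F] by metis
  finally show ?thesis .
qed

section \<open>The free resolution of a squarefree resolution\<close>

definition sqf :: "'v set \<Rightarrow> ('v \<Rightarrow>\<^sub>0 nat)" where
  "sqf U = (\<Sum>v\<in>U. Poly_Mapping.single v 1)"

lemma lookup_sqf: "finite U \<Longrightarrow> lookup (sqf U) v = (if v \<in> U then 1 else 0)"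
  by (simp add: sqf_def lookup_sum lookup_single when_def)

lemma keys_sqf: "finite U \<Longrightarrow> keys (sqf U) = U"
  by (auto simp: in_keys_iff lookup_sqf split: if_splits)

lemma sqf_empty [simp]: "sqf {} = 0"
  by (simp add: sqf_def)

lemma total_deg_sqf: "finite U \<Longrightarrow> total_deg (sqf U) = card U"
  by (simp add: total_deg_def keys_sqf lookup_sqf)

lemma sqf_Un_disjoint: "finite U \<Longrightarrow> finite W \<Longrightarrow> U \<inter> W = {} \<Longrightarrow> sqf U + sqf W = sqf (U \<union> W)"
  by (simp add: sqf_def sum.union_disjoint)

lemma pdvd_sqf: "finite U \<Longrightarrow> pdvd (sqf U) m \<longleftrightarrow> U \<subseteq> keys m"
  by (auto simp: pdvd_def lookup_sqf in_keys_iff subset_iff Suc_le_eq)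

lemma keys_plus_nat: "keys (s + t) = keys s \<union> keys (t :: 'v \<Rightarrow>\<^sub>0 nat)"
  by (auto simp: in_keys_iff lookup_add)

context squarefree_resolution
begin

definition mat :: "nat \<Rightarrow> nat \<Rightarrow> nat \<Rightarrow> ('v, 'k) mpoly" where
  "mat i a b = Poly_Mapping.single (sqf (L (Suc i) a - L i b)) (c i a b)"

text \<open>
  The component of \<open>f\<close> in multidegree \<open>m\<close>. Division by power products
  identifies it with an element of the free functor at the support of \<open>m\<close>, and under
  this identification the matrices of the resolution act as \<open>d i\<close>
  (\<open>mdeg_part_apply_mat\<close>).
\<close>

definition mdeg_part :: "nat \<Rightarrow> (nat \<Rightarrow> ('v, 'k) mpoly) \<Rightarrow> ('v \<Rightarrow>\<^sub>0 nat) \<Rightarrow> nat \<Rightarrow> 'k" where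
  "mdeg_part i f m = (\<lambda>a. if a < r i \<and> L i a \<subseteq> keys m then lookup (f a) (m - sqf (L i a)) else 0)"

definition apply_mat :: "nat \<Rightarrow> (nat \<Rightarrow> ('v, 'k) mpoly) \<Rightarrow> nat \<Rightarrow> ('v, 'k) mpoly" where
  "apply_mat i f b = (\<Sum>a<r (Suc i). f a * mat i a b)"

lemma label_V: "a < r i \<Longrightarrow> L i a \<subseteq> V"
  using L_V r0 L0 by (cases i) auto

lemma label_finite: "a < r i \<Longrightarrow> finite (L i a)"
  using label_V finV finite_subset by blast

lemma mdeg_part_supp: "mdeg_part i f m \<in> S i (keys m)"
  by (simp add: mdeg_part_def supp_mod_def)

lemma mdeg_part_cong: "(\<And>a. a < r i \<Longrightarrow> f a = g a) \<Longrightarrow> mdeg_part i f m = mdeg_part i g m"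
  by (auto simp: mdeg_part_def)

lemma mdeg_part_zero: "mdeg_part i (\<lambda>_. 0) m = (\<lambda>_. 0)"
  by (auto simp: mdeg_part_def)

lemma mdeg_part_apply_mat: "mdeg_part i (apply_mat i f) m = d i (mdeg_part (Suc i) f m)"
proof
  fix b
  have zero: "mdeg_part (Suc i) f m a * c i a b = 0" if "\<not> (b < r i \<and> L i b \<subseteq> keys m)" for a
  proof (rule ccontr)
    assume "mdeg_part (Suc i) f m a * c i a b \<noteq> 0"
    then have "a < r (Suc i)" "L (Suc i) a \<subseteq> keys m" "c i a b \<noteq> 0"
      by (auto simp: mdeg_part_def split: if_splits)
    then show False using that c_proper[of a i b] by auto
  qed
  show "mdeg_part i (apply_mat i f) m b = d i (mdeg_part (Suc i) f m) b"
  proof (cases "b < r i \<and> L i b \<subseteq> keys m")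
    case False
    then have "d i (mdeg_part (Suc i) f m) b = 0" unfolding lincomb_def by (intro sum.neutral ballI zero)
    moreover have "mdeg_part i (apply_mat i f) m b = 0" using False by (simp only: mdeg_part_def if_False)
    ultimately show ?thesis by simp
  next
    case True
    then have b: "b < r i" "L i b \<subseteq> keys m" by auto
    have "mdeg_part i (apply_mat i f) m b = (\<Sum>a<r (Suc i). lookup (f a * mat i a b) (m - sqf (L i b)))"
      using b by (simp add: mdeg_part_def apply_mat_def lookup_sum)
    also have "\<dots> = (\<Sum>a<r (Suc i). mdeg_part (Suc i) f m a * c i a b)"
    proof (rule sum.cong)
      fix a assume "a \<in> {..<r (Suc i)}"
      then have a: "a < r (Suc i)" by simp
      show "lookup (f a * mat i a b) (m - sqf (L i b)) = mdeg_part (Suc i) f m a * c i a b"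
      proof (cases "c i a b = 0")
        case True
        then show ?thesis by (simp add: mat_def)
      next
        case False
        have sub: "L i b \<subset> L (Suc i) a" using c_proper[OF a False] by simp
        have fin: "finite (L i b)" "finite (L (Suc i) a)" "finite (L (Suc i) a - L i b)"
          using label_finite a b by auto
        have "sqf (L i b) + sqf (L (Suc i) a - L i b) = sqf (L (Suc i) a)"
          using sqf_Un_disjoint[OF fin(1,3)] sub by (simp add: Un_absorb1 psubset_imp_subset)
        then have "m - sqf (L i b) - sqf (L (Suc i) a - L i b) = m - sqf (L (Suc i) a)"
          by (simp add: diff_diff_add)
        moreover have "pdvd (sqf (L (Suc i) a - L i b)) (m - sqf (L i b)) \<longleftrightarrow> L (Suc i) a \<subseteq> keys m"
          unfolding pdvd_sqf[OF fin(3)] using b(2) sub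
          by (auto simp: in_keys_iff lookup_minus lookup_sqf[OF fin(1)] subset_iff)
        ultimately show ?thesis using a by (simp add: mat_def lookup_times_single mdeg_part_def)
      qed
    qed simp
    finally show ?thesis by (simp add: lincomb_def)
  qed
qed

lemma mdeg_part_inject:
  assumes "\<And>m. mdeg_part i f m = mdeg_part i g m" "a < r i" shows "f a = g a"
proof (rule poly_mapping_eqI)
  fix e
  have "L i a \<subseteq> keys (e + sqf (L i a))"
    by (simp add: keys_plus_nat keys_sqf[OF label_finite[OF assms(2)]])
  then show "lookup (f a) e = lookup (g a) e"
    using fun_cong[OF assms(1)[of "e + sqf (L i a)"], of a] assms(2) by (simp add: mdeg_part_def)
qed

lemma mdeg_part_nonzero_V:
  assumes "\<And>a. a < r i \<Longrightarrow> f a \<in> poly_ring V" "mdeg_part i f m \<noteq> (\<lambda>_. 0)"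
  shows "keys m \<subseteq> V"
proof -
  obtain a where "mdeg_part i f m a \<noteq> 0" using assms(2) by auto
  then have a: "a < r i" "L i a \<subseteq> keys m" "lookup (f a) (m - sqf (L i a)) \<noteq> 0"
    by (auto simp: mdeg_part_def split: if_splits)
  have "keys (m - sqf (L i a)) \<subseteq> V" using assms(1)[OF a(1)] a(3) by (simp add: poly_ring_iff)
  moreover have "m = m - sqf (L i a) + sqf (L i a)"
    using pdvd_diff_add pdvd_sqf[OF label_finite[OF a(1)]] a(2) by metis
  then have "keys m = keys (m - sqf (L i a)) \<union> L i a"
    using keys_plus_nat keys_sqf[OF label_finite[OF a(1)]] by metis
  ultimately show ?thesis using label_V[OF a(1)] by blast
qed

lemma mdeg_part_finite_support: "finite {m. mdeg_part i f m \<noteq> (\<lambda>_. 0)}"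
proof (rule finite_subset)
  show "{m. mdeg_part i f m \<noteq> (\<lambda>_. 0)} \<subseteq> (\<Union>a<r i. (\<lambda>e. e + sqf (L i a)) ` keys (f a))"
  proof
    fix m assume "m \<in> {m. mdeg_part i f m \<noteq> (\<lambda>_. 0)}"
    then obtain a where "mdeg_part i f m a \<noteq> 0" by auto
    then have a: "a < r i" "L i a \<subseteq> keys m" "lookup (f a) (m - sqf (L i a)) \<noteq> 0"
      by (auto simp: mdeg_part_def split: if_splits)
    have "m = m - sqf (L i a) + sqf (L i a)"
      using pdvd_diff_add pdvd_sqf[OF label_finite[OF a(1)]] a(2) by metis
    moreover have "m - sqf (L i a) \<in> keys (f a)" using a(3) by (simp add: in_keys_iff)
    ultimately show "m \<in> (\<Union>a<r i. (\<lambda>e. e + sqf (L i a)) ` keys (f a))" using a(1) by blast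
  qed
qed simp

text \<open>
  A finitely supported family of components, one for each multidegree, comes from an element of
  the free module.
\<close>

lemma assemble:
  assumes fin: "finite {m. h m \<noteq> (\<lambda>_. 0)}" and supp: "\<And>m. h m \<in> S i (keys m)"
    and V: "\<And>m. h m \<noteq> (\<lambda>_. 0) \<Longrightarrow> keys m \<subseteq> V"
  shows "\<exists>f\<in>free_mod V (r i). \<forall>m. mdeg_part i f m = h m"
proof -
  define f where "f = (\<lambda>a. if a < r i then Abs_poly_mapping (\<lambda>e. h (e + sqf (L i a)) a) else 0)"
  have lf: "lookup (f a) e = h (e + sqf (L i a)) a" if "a < r i" for a e
  proof -
    have "(\<lambda>e. e + sqf (L i a)) ` {e. h (e + sqf (L i a)) a \<noteq> 0} \<subseteq> {m. h m \<noteq> (\<lambda>_. 0)}" by auto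
    then have "finite ((\<lambda>e. e + sqf (L i a)) ` {e. h (e + sqf (L i a)) a \<noteq> 0})"
      using fin by (rule finite_subset)
    then have "finite {e. h (e + sqf (L i a)) a \<noteq> 0}"
      by (rule finite_imageD) (simp add: inj_on_def)
    then show ?thesis using that by (simp add: f_def)
  qed
  have "f \<in> free_mod V (r i)"
    unfolding free_mod_def
  proof (intro CollectI conjI allI impI)
    show "f a = 0" if "r i \<le> a" for a using that by (simp add: f_def)
    show "f a \<in> poly_ring V" if a: "a < r i" for a
      unfolding poly_ring_iff
    proof (intro allI impI)
      fix e assume "lookup (f a) e \<noteq> 0"
      then have "h (e + sqf (L i a)) \<noteq> (\<lambda>_. 0)" unfolding lf[OF a] by auto
      then show "keys e \<subseteq> V" using V[of "e + sqf (L i a)"] by (simp add: keys_plus_nat)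
    qed
  qed
  moreover have "mdeg_part i f m = h m" for m
  proof
    fix a
    show "mdeg_part i f m a = h m a"
    proof (cases "a < r i \<and> L i a \<subseteq> keys m")
      case True
      then have "m - sqf (L i a) + sqf (L i a) = m"
        using pdvd_sqf[OF label_finite] by (intro pdvd_diff_add) simp
      then show ?thesis using True by (simp add: mdeg_part_def lf)
    next
      case False
      then show ?thesis using supp[of m] unfolding supp_mod_def mdeg_part_def by auto
    qed
  qed
  ultimately show ?thesis by blast
qed

definition in_Z :: "nat \<Rightarrow> (nat \<Rightarrow> ('v, 'k) mpoly) \<Rightarrow> bool" where
  "in_Z i f \<longleftrightarrow> (\<forall>m. keys m \<subseteq> V \<longrightarrow> mdeg_part i f m \<in> Z i (keys m))"

text \<open>
  Exactness holds in each multidegree; a preimage is assembled from preimages of the components,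
  where zero is chosen as the preimage of zero to keep the support finite.
\<close>

lemma in_Z_iff_image:
  assumes f: "\<And>a. a < r i \<Longrightarrow> f a \<in> poly_ring V"
  shows "in_Z i f \<longleftrightarrow> (\<exists>g\<in>free_mod V (r (Suc i)). \<forall>b<r i. f b = apply_mat i g b)"
proof
  assume Z: "in_Z i f"
  have "\<exists>h. h \<in> S (Suc i) (keys m) \<and> mdeg_part i f m = d i h \<and> (mdeg_part i f m = (\<lambda>_. 0) \<longrightarrow> h = (\<lambda>_. 0))" for m
  proof (cases "mdeg_part i f m = (\<lambda>_. 0)")
    case True
    then show ?thesis by (intro exI[of _ "\<lambda>_. 0"]) (simp add: supp_mod_def lincomb_def)
  next
    case False
    then have "keys m \<subseteq> V" using mdeg_part_nonzero_V[of i f m] f by blast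
    then show ?thesis using gen_span[of "keys m" "mdeg_part i f m" i] Z False by (auto simp: in_Z_def)
  qed
  then have "\<forall>m. \<exists>h. h \<in> S (Suc i) (keys m) \<and> mdeg_part i f m = d i h \<and> (mdeg_part i f m = (\<lambda>_. 0) \<longrightarrow> h = (\<lambda>_. 0))" by blast
  from choice[OF this] obtain h where h: "\<And>m. h m \<in> S (Suc i) (keys m)" "\<And>m. mdeg_part i f m = d i (h m)"
    "\<And>m. mdeg_part i f m = (\<lambda>_. 0) \<Longrightarrow> h m = (\<lambda>_. 0)" by blast
  have "\<exists>g\<in>free_mod V (r (Suc i)). \<forall>m. mdeg_part (Suc i) g m = h m"
  proof (rule assemble[OF _ h(1)])
    show "finite {m. h m \<noteq> (\<lambda>_. 0)}"
      by (rule rev_finite_subset[OF mdeg_part_finite_support[of i f]]) (use h(3) in blast)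
    show "keys m \<subseteq> V" if "h m \<noteq> (\<lambda>_. 0)" for m
      using mdeg_part_nonzero_V[of i f m] f h(3) that by blast
  qed
  then obtain g where g: "g \<in> free_mod V (r (Suc i))" "\<And>m. mdeg_part (Suc i) g m = h m" by blast
  have "mdeg_part i f m = mdeg_part i (apply_mat i g) m" for m unfolding mdeg_part_apply_mat g(2) h(2) ..
  then have "\<forall>b<r i. f b = apply_mat i g b" using mdeg_part_inject by blast
  then show "\<exists>g\<in>free_mod V (r (Suc i)). \<forall>b<r i. f b = apply_mat i g b" using g(1) by blast
next
  assume "\<exists>g\<in>free_mod V (r (Suc i)). \<forall>b<r i. f b = apply_mat i g b"
  then obtain g where g: "\<And>b. b < r i \<Longrightarrow> f b = apply_mat i g b" by blast
  have "mdeg_part i f m = d i (mdeg_part (Suc i) g m)" for m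
    unfolding mdeg_part_apply_mat[symmetric] by (rule mdeg_part_cong) (rule g)
  then show "in_Z i f" unfolding in_Z_def using d_in_Z mdeg_part_supp by metis
qed

lemma in_Z_Suc_iff:
  assumes f: "\<And>a. a < r (Suc i) \<Longrightarrow> f a \<in> poly_ring V"
  shows "in_Z (Suc i) f \<longleftrightarrow> (\<forall>b<r i. apply_mat i f b = 0)"
proof
  assume Z: "in_Z (Suc i) f"
  have "mdeg_part i (apply_mat i f) m = mdeg_part i (\<lambda>_. 0) m" for m
  proof (cases "keys m \<subseteq> V")
    case True
    then have "mdeg_part (Suc i) f m \<in> Z (Suc i) (keys m)" using Z by (simp add: in_Z_def)
    then show ?thesis unfolding ZSuc[OF True] mdeg_part_apply_mat mdeg_part_zero by simp
  next
    case False
    then have "mdeg_part (Suc i) f m = (\<lambda>_. 0)" using mdeg_part_nonzero_V[of "Suc i" f m] f by blast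
    then show ?thesis unfolding mdeg_part_apply_mat mdeg_part_zero by (simp add: lincomb_def)
  qed
  then show "\<forall>b<r i. apply_mat i f b = 0" using mdeg_part_inject[of i "apply_mat i f" "\<lambda>_. 0"] by blast
next
  assume 0: "\<forall>b<r i. apply_mat i f b = 0"
  have "d i (mdeg_part (Suc i) f m) = (\<lambda>_. 0)" for m
  proof -
    have "mdeg_part i (apply_mat i f) m = mdeg_part i (\<lambda>_. 0) m" by (rule mdeg_part_cong) (use 0 in simp)
    then show ?thesis unfolding mdeg_part_apply_mat mdeg_part_zero .
  qed
  then show "in_Z (Suc i) f" unfolding in_Z_def using mdeg_part_supp ZSuc by auto
qed

definition nonface_ideal :: "('v, 'k) mpoly set" where
  "nonface_ideal = {p \<in> poly_ring V. \<forall>m. keys m \<in> D \<longrightarrow> lookup p m = 0}"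

lemma in_Z_0_iff:
  assumes "f 0 \<in> poly_ring V"
  shows "in_Z 0 f \<longleftrightarrow> f 0 \<in> nonface_ideal"
proof -
  have c0: "mdeg_part 0 f m = (\<lambda>a. if a = 0 then lookup (f 0) m else 0)" for m
    by (auto simp: mdeg_part_def r0 L0)
  have S0: "(\<lambda>a. if a = 0 then x else 0) \<in> S 0 W" for x W
    using r0 L0 by (auto simp: supp_mod_def)
  have "mdeg_part 0 f m \<in> Z 0 (keys m) \<longleftrightarrow> (keys m \<in> D \<longrightarrow> lookup (f 0) m = 0)" if "keys m \<subseteq> V" for m
    unfolding Z0[OF that] c0 using S0 by (auto simp: fun_eq_iff)
  then have "in_Z 0 f \<longleftrightarrow> (\<forall>m. keys m \<subseteq> V \<longrightarrow> keys m \<in> D \<longrightarrow> lookup (f 0) m = 0)"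
    unfolding in_Z_def by blast
  also have "\<dots> \<longleftrightarrow> f 0 \<in> nonface_ideal"
    using assms unfolding nonface_ideal_def poly_ring_iff by blast
  finally show ?thesis .
qed

definition resolution :: "('v, 'k) free_complex" where
  "resolution = \<lparr>rk = \<lambda>i. r (Suc i), gdeg = \<lambda>i a. int (card (L (Suc i) a)),
     aug = \<lambda>a. mat 0 a 0, diff = \<lambda>i. mat (Suc i)\<rparr>"

lemma mat_poly_ring: "a < r (Suc i) \<Longrightarrow> mat i a b \<in> poly_ring V"
  unfolding mat_def using label_V[of a "Suc i"] label_finite[of a "Suc i"]
  by (intro poly_ring_single) (auto simp: keys_sqf)

lemma mat_homogeneous:
  assumes "a < r (Suc i)" "b < r i"
  shows "homogeneous (int (card (L (Suc i) a)) - int (card (L i b))) (mat i a b)"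
proof (cases "c i a b = 0")
  case True
  then show ?thesis by (simp add: mat_def homogeneous_def)
next
  case False
  have fin: "finite (L i b)" "finite (L (Suc i) a)" using label_finite assms by auto
  have "L i b \<subseteq> L (Suc i) a" using c_proper[OF assms(1) False] by simp
  then have "int (card (L (Suc i) a - L i b)) = int (card (L (Suc i) a)) - int (card (L i b))"
    using fin by (simp add: card_Diff_subset card_mono of_nat_diff)
  then show ?thesis using fin by (auto simp: mat_def homogeneous_def total_deg_sqf)
qed

lemma mat_const: "a < r (Suc i) \<Longrightarrow> lookup (mat i a b) 0 = 0"
proof (cases "c i a b = 0")
  case False
  assume a: "a < r (Suc i)"
  have "finite (L (Suc i) a - L i b)" "L (Suc i) a - L i b \<noteq> {}"
    using label_finite[OF a] c_proper[OF a False] by auto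
  then have "sqf (L (Suc i) a - L i b) \<noteq> 0" using keys_sqf by force
  then show ?thesis by (simp add: mat_def lookup_single when_def)
qed (simp add: mat_def)

lemma free_mod_ring: "f \<in> free_mod V n \<Longrightarrow> a < n \<Longrightarrow> f a \<in> poly_ring V"
  by (simp add: free_mod_def)

lemma apply_mat_poly_ring: "f \<in> free_mod V (r (Suc i)) \<Longrightarrow> apply_mat i f b \<in> poly_ring V"
  unfolding apply_mat_def by (intro poly_ring_sum poly_ring_mult mat_poly_ring) (auto simp: free_mod_ring)

theorem minimal_resolution: "minimal_graded_free_resolution V nonface_ideal resolution"
proof -
  have rk: "rk resolution i = r (Suc i)" and gd: "gdeg resolution i a = int (card (L (Suc i) a))"
    and au: "aug resolution a = mat 0 a 0" and di: "diff resolution i = mat (Suc i)" for i a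
    by (simp_all add: resolution_def)
  have am: "aug_map resolution f = apply_mat 0 f 0" for f
    by (simp add: aug_map_def rk au apply_mat_def)
  have dm: "diff_map resolution i f = (\<lambda>b. if b < r (Suc i) then apply_mat (Suc i) f b else 0)" for i f
    by (auto simp: diff_map_def rk di apply_mat_def)
  have image: "f \<in> diff_map resolution i ` free_mod V (r (Suc (Suc i))) \<longleftrightarrow> in_Z (Suc i) f"
    if f: "f \<in> free_mod V (r (Suc i))" for f i
  proof -
    have "in_Z (Suc i) f \<longleftrightarrow> (\<exists>g\<in>free_mod V (r (Suc (Suc i))). \<forall>b<r (Suc i). f b = apply_mat (Suc i) g b)"
      by (rule in_Z_iff_image) (rule free_mod_ring[OF f])
    also have "\<dots> \<longleftrightarrow> f \<in> diff_map resolution i ` free_mod V (r (Suc (Suc i)))"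
      unfolding dm image_iff using f by (auto simp: fun_eq_iff free_mod_def)
    finally show ?thesis by simp
  qed
  have diff_free: "diff_map resolution i f \<in> free_mod V (r (Suc i))" if "f \<in> free_mod V (r (Suc (Suc i)))" for i f
    unfolding dm free_mod_def using apply_mat_poly_ring[OF that] by simp
  have 1: "aug_map resolution ` free_mod V (r 1) = nonface_ideal"
  proof (intro equalityI subsetI)
    fix p assume "p \<in> aug_map resolution ` free_mod V (r 1)"
    then obtain g where g: "g \<in> free_mod V (r (Suc 0))" "p = apply_mat 0 g 0" unfolding am by auto
    have "in_Z 0 (\<lambda>_. p)"
      by (subst in_Z_iff_image) (use g apply_mat_poly_ring in \<open>auto simp: r0\<close>)
    then show "p \<in> nonface_ideal" using in_Z_0_iff[of "\<lambda>_. p"] g apply_mat_poly_ring by auto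
  next
    fix p assume p: "p \<in> nonface_ideal"
    then have "p \<in> poly_ring V" by (simp add: nonface_ideal_def)
    then have "in_Z 0 (\<lambda>_. p)" using in_Z_0_iff[of "\<lambda>_. p"] p by simp
    then have "\<exists>g\<in>free_mod V (r (Suc 0)). \<forall>b<r 0. p = apply_mat 0 g b"
      using in_Z_iff_image[of 0 "\<lambda>_. p"] \<open>p \<in> poly_ring V\<close> by simp
    then show "p \<in> aug_map resolution ` free_mod V (r 1)" unfolding am by (auto simp: r0)
  qed
  have 2: "{f \<in> free_mod V (r 1). aug_map resolution f = 0} = diff_map resolution 0 ` free_mod V (r (Suc (Suc 0)))"
  proof -
    have "aug_map resolution f = 0 \<longleftrightarrow> in_Z (Suc 0) f" if "f \<in> free_mod V (r (Suc 0))" for f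
      using in_Z_Suc_iff[of 0 f] free_mod_ring[OF that] by (simp add: am r0)
    then show ?thesis using image[of _ 0] diff_free[of _ 0] by auto
  qed
  have 3: "{f \<in> free_mod V (r (Suc (Suc i))). diff_map resolution i f = (\<lambda>_. 0)} =
      diff_map resolution (Suc i) ` free_mod V (r (Suc (Suc (Suc i))))" for i
  proof -
    have "diff_map resolution i f = (\<lambda>_. 0) \<longleftrightarrow> in_Z (Suc (Suc i)) f" if "f \<in> free_mod V (r (Suc (Suc i)))" for f
      using in_Z_Suc_iff[of "Suc i" f] free_mod_ring[OF that] by (auto simp: dm fun_eq_iff)
    then show ?thesis using image[of _ "Suc i"] diff_free[of _ "Suc i"] by auto
  qed
  have hom0: "homogeneous (int (card (L (Suc 0) a))) (mat 0 a 0)" if "a < r (Suc 0)" for a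
    using mat_homogeneous[OF that, of 0] by (simp add: r0 L0)
  show ?thesis
    unfolding minimal_graded_free_resolution_def graded_free_resolution_def rk gd au di
    using 1 2 3 hom0 mat_poly_ring mat_homogeneous mat_const by simp
qed

theorem graded_betti_nonface_ideal:
  "graded_betti V nonface_ideal i e \<noteq> 0 \<longleftrightarrow>
    (\<exists>W\<subseteq>V. int (card W) = e \<and> Suc i \<le> card W \<and> has_coh TYPE('k) (card W - Suc i) {\<sigma> \<in> D. \<sigma> \<subseteq> W})"
proof -
  have "graded_betti V nonface_ideal i e \<noteq> 0 \<longleftrightarrow> (\<exists>a<r (Suc i). int (card (L (Suc i) a)) = e)"
    unfolding graded_betti_nonzero_iff[OF minimal_resolution] by (simp add: resolution_def)
  also have "\<dots> \<longleftrightarrow> (\<exists>W\<subseteq>V. int (card W) = e \<and> (\<exists>a<r (Suc i). L (Suc i) a = W))"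
    using L_V by blast
  also have "\<dots> \<longleftrightarrow> (\<exists>W\<subseteq>V. int (card W) = e \<and> Suc i \<le> card W \<and> has_coh TYPE('k) (card W - Suc i) {\<sigma> \<in> D. \<sigma> \<subseteq> W})"
    by (simp add: generator_iff_coh cong: conj_cong)
  finally show ?thesis .
qed

end

section \<open>Betti numbers of edge ideals\<close>

text \<open>
  A power product lies in the edge ideal iff its support contains an edge, that is, iff its
  support is not independent.
\<close>

lemma edge_ideal_eq:
  fixes V :: "'v set"
  assumes "finite V" and sym: "\<And>x y. adj x y \<Longrightarrow> adj y x" and irrefl: "\<And>x. \<not> adj x x"
  shows "edge_ideal (V, {{a, b} | a b. a \<in> V \<and> b \<in> V \<and> adj a b}) =
    {p :: ('v, 'k::field) mpoly. p \<in> poly_ring V \<and> (\<forall>m. keys m \<in> indep adj V \<longrightarrow> lookup p m = 0)}"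
    (is "?E = ?N")
proof -
  define X where "X = {Var u * Var v :: ('v, 'k) mpoly | u v. {u, v} \<in> {{a, b} | a b. a \<in> V \<and> b \<in> V \<and> adj a b}}"
  have E: "?E = ideal_gen V X" by (simp add: edge_ideal_def X_def)
  have var: "Var u * Var v = (Poly_Mapping.single (sqf {u, v}) 1 :: ('v, 'k) mpoly)" if "adj u v" for u v
  proof -
    have "u \<noteq> v" using that irrefl by auto
    then show ?thesis by (simp add: Var_def mult_single sqf_def)
  qed
  have X: "X = {Poly_Mapping.single (sqf {u, v}) 1 | u v. u \<in> V \<and> v \<in> V \<and> adj u v}"
  proof (intro equalityI subsetI)
    fix x assume "x \<in> X"
    then obtain u v a b where uv: "x = Var u * Var v" "{u, v} = {a, b}" "a \<in> V" "b \<in> V" "adj a b"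
      unfolding X_def by blast
    then have "u \<in> V \<and> v \<in> V \<and> adj u v" using sym[OF uv(5)] by (auto simp: doubleton_eq_iff)
    then show "x \<in> {Poly_Mapping.single (sqf {u, v}) 1 | u v. u \<in> V \<and> v \<in> V \<and> adj u v}"
      using uv(1) var by auto
  next
    fix x assume "x \<in> {Poly_Mapping.single (sqf {u, v}) 1 :: ('v, 'k) mpoly | u v. u \<in> V \<and> v \<in> V \<and> adj u v}"
    then obtain u v where uv: "x = Poly_Mapping.single (sqf {u, v}) 1" "u \<in> V" "v \<in> V" "adj u v" by blast
    then have "x = Var u * Var v" using var by simp
    then show "x \<in> X" unfolding X_def using uv by blast
  qed
  show ?thesis
  proof (intro equalityI subsetI)
    fix p assume "p \<in> ?E"
    then obtain T c where p: "p = (\<Sum>s\<in>T. c s * s)" "T \<subseteq> X" "\<forall>s\<in>T. c s \<in> poly_ring V"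
      unfolding E ideal_gen_def mem_Collect_eq by (elim exE conjE) (rule that)
    have summand: "c s * s \<in> poly_ring V \<and> (keys m \<in> indep adj V \<longrightarrow> lookup (c s * s) m = 0)" if s: "s \<in> T" for s m
    proof -
      obtain u v where uv: "s = Poly_Mapping.single (sqf {u, v}) 1" "u \<in> V" "v \<in> V" "adj u v"
        using s p(2) X by blast
      have "s \<in> poly_ring V" unfolding uv(1) using uv by (intro poly_ring_single) (simp add: keys_sqf)
      moreover have "\<not> pdvd (sqf {u, v}) m" if "keys m \<in> indep adj V"
        using that uv(4) by (auto simp: pdvd_sqf indep_def)
      ultimately show ?thesis using s p(3) by (auto simp: poly_ring_mult uv(1) lookup_times_single)
    qed
    have "p \<in> poly_ring V" unfolding p(1) by (rule poly_ring_sum) (use summand in blast)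
    moreover have "lookup p m = 0" if "keys m \<in> indep adj V" for m
      unfolding p(1) lookup_sum using summand that by (intro sum.neutral) blast
    ultimately show "p \<in> ?N" by blast
  next
    fix p assume p: "p \<in> ?N"
    have "\<exists>s t. s \<in> X \<and> s = Poly_Mapping.single t 1 \<and> pdvd t m" if m: "m \<in> keys p" for m
    proof -
      have "keys m \<subseteq> V" "keys m \<notin> indep adj V"
        using p m by (auto simp: poly_ring_def in_keys_iff)
      then obtain u v where "u \<in> keys m" "v \<in> keys m" "adj u v" by (auto simp: indep_def)
      then have "Poly_Mapping.single (sqf {u, v}) 1 \<in> X \<and> pdvd (sqf {u, v}) m"
        using X \<open>keys m \<subseteq> V\<close> by (auto simp: pdvd_sqf)
      then show ?thesis by blast
    qed
    then obtain s t where st: "\<And>m. m \<in> keys p \<Longrightarrow> s m \<in> X"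
      "\<And>m. m \<in> keys p \<Longrightarrow> s m = Poly_Mapping.single (t m) 1" "\<And>m. m \<in> keys p \<Longrightarrow> pdvd (t m) m"
      by metis
    define c where "c = (\<lambda>x. \<Sum>m | m \<in> keys p \<and> s m = x. Poly_Mapping.single (m - t m) (lookup p m))"
    have "(\<Sum>x\<in>s ` keys p. c x * x) =
        (\<Sum>x\<in>s ` keys p. \<Sum>m | m \<in> keys p \<and> s m = x. Poly_Mapping.single m (lookup p m))"
      unfolding c_def sum_distrib_right
      by (intro sum.cong refl) (auto simp: st(2) mult_single pdvd_diff_add[OF st(3)])
    also have "\<dots> = (\<Sum>m\<in>keys p. Poly_Mapping.single m (lookup p m))"
      by (rule sum.image_gen[symmetric]) simp
    also have "\<dots> = p" by (rule sum_single_keys)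
    finally have "p = (\<Sum>x\<in>s ` keys p. c x * x)" by simp
    moreover have "c x \<in> poly_ring V" for x
      unfolding c_def
    proof (intro poly_ring_sum poly_ring_single)
      fix m assume "m \<in> {m. m \<in> keys p \<and> s m = x}"
      then have "keys m \<subseteq> V" "pdvd (t m) m" using p st(3) by (auto simp: poly_ring_def)
      then show "keys (m - t m) \<subseteq> V" using keys_plus_nat[of "m - t m" "t m"] by (auto simp: pdvd_diff_add)
    qed
    ultimately show "p \<in> ?E" unfolding E ideal_gen_def using st(1)
      by (intro CollectI exI[of _ "s ` keys p"] exI[of _ c]) auto
  qed
qed

theorem graded_betti_edge_ideal:
  fixes V :: "'v::linorder set" and adj :: "'v \<Rightarrow> 'v \<Rightarrow> bool"
  assumes V: "finite V" and sym: "\<And>x y. adj x y \<Longrightarrow> adj y x" and irrefl: "\<And>x. \<not> adj x x"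
  defines "E \<equiv> {{a, b} | a b. a \<in> V \<and> b \<in> V \<and> adj a b}"
  shows "graded_betti V (edge_ideal (V, E) :: ('v, 'k::field) mpoly set) i e \<noteq> 0 \<longleftrightarrow>
    (\<exists>W\<subseteq>V. int (card W) = e \<and> Suc i \<le> card W \<and> has_coh TYPE('k) (card W - Suc i) (indep adj W))"
proof -
  have "simplicial (indep adj V)" "{} \<in> indep adj V"
    by (auto simp: simplicial_def indep_def finite_subset)
  then obtain r L and c :: "nat \<Rightarrow> nat \<Rightarrow> nat \<Rightarrow> 'k" and Z where "squarefree_resolution V (indep adj V) r L c Z"
    using squarefree_resolution_exists[OF V] by blast
  then interpret squarefree_resolution V "indep adj V" r L c Z .
  have "edge_ideal (V, E) = nonface_ideal"
    unfolding E_def nonface_ideal_def using edge_ideal_eq[of V adj, OF V sym irrefl] by blast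
  moreover have "{\<sigma> \<in> indep adj V. \<sigma> \<subseteq> W} = indep adj W" if "W \<subseteq> V" for W
    using that by (auto simp: indep_def)
  ultimately show ?thesis
    using graded_betti_nonface_ideal[of i e] by (simp del: not_gr_zero neq0_conv cong: conj_cong)
qed

section \<open>Betti numbers of the graph without its exterior cycle\<close>

theorem theorem7p1:
  fixes k :: nat
  assumes "k \<ge> 3"
  shows
    "let G = andrasfai' k;
         \<beta> = graded_betti (fst G) (edge_ideal G :: (int, 'k::field) mpoly set)
     in (\<forall>(i::nat) (j::int). \<beta> i (int i + j) \<noteq> 0 \<longrightarrow> 2 \<le> j \<and> j \<le> 5) \<and>
        (\<forall>i::nat. \<beta> i (int i + 2) \<noteq> 0 \<longleftrightarrow> i \<in> {0..k - 3}) \<and>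
        (\<forall>i::nat. \<beta> i (int i + 3) \<noteq> 0 \<longleftrightarrow> i \<in> {1..2 * k - 5}) \<and>
        (\<forall>i::nat. \<beta> i (int i + 4) \<noteq> 0 \<longleftrightarrow> i \<in> {2..3 * k - 7}) \<and>
        (\<forall>i::nat. \<beta> i (int i + 5) \<noteq> 0 \<longleftrightarrow> i = 3 * k - 6)"
proof -
  interpret andrasfai_cycle_free "int k" "TYPE('k)"
    by unfold_locales (use assms in simp)
  define E where "E = {{a, b} | a b. a \<in> V \<and> b \<in> V \<and> adj a b}"
  have "(\<exists>s\<in>{1 + 3 * j | j. 1 \<le> j \<and> j \<le> int k - 2}. [b - a = s] (mod n)) \<longleftrightarrow> adj a b" for a b
    by (auto simp: and_adj_def)
  then have G: "andrasfai' k = (V, E)" by (simp add: andrasfai'_def circulant_graph_def E_def)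
  define \<beta> where "\<beta> = graded_betti V (edge_ideal (V, E) :: (int, 'k) mpoly set)"
  have betti: "\<beta> i e \<noteq> 0 \<longleftrightarrow>
      (\<exists>W\<subseteq>V. int (card W) = e \<and> Suc i \<le> card W \<and> coh (card W - Suc i) W)" for i e
    unfolding \<beta>_def E_def using adj_sym adj_irrefl by (intro graded_betti_edge_ideal) auto
  have row: "\<beta> i (int i + int (Suc q)) \<noteq> 0 \<longleftrightarrow> (\<exists>W\<subseteq>V. card W = i + Suc q \<and> coh q W)" for i q
  proof -
    have "int (card W) = int i + int (Suc q) \<and> Suc i \<le> card W \<and> coh (card W - Suc i) W \<longleftrightarrow>
        card W = i + Suc q \<and> coh q W" for W
      by (cases "card W = i + Suc q") auto
    then show ?thesis unfolding betti by (simp only:)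
  qed
  have range: "2 \<le> j \<and> j \<le> 5" if nz: "\<beta> i (int i + j) \<noteq> 0" for i j
  proof -
    obtain W where W: "W \<subseteq> V" "int (card W) = int i + j" "Suc i \<le> card W" "coh (card W - Suc i) W"
      using nz unfolding betti by blast
    have "card W - Suc i \<noteq> 0"
    proof
      assume "card W - Suc i = 0"
      then have "W = {}" using W(4) coh_0_imp_empty by simp
      then show False using W(3) by simp
    qed
    moreover have "card W - Suc i < 5" using no_coh_ge_5 W(1,4) not_le by blast
    ultimately show ?thesis using W(2,3) by linarith
  qed
  have row2: "\<beta> i (int i + 2) \<noteq> 0 \<longleftrightarrow> i \<in> {0..k - 3}" for i
  proof -
    have "\<beta> i (int i + 2) \<noteq> 0 \<longleftrightarrow> (\<exists>W\<subseteq>V. card W = i + 2 \<and> coh 1 W)" using row[of i 1] by simp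
    also have "\<dots> \<longleftrightarrow> int (i + 2) \<le> int k - 1"
      using coh_1_card ex_coh_1[of "i + 2", OF le_add2] by metis
    also have "\<dots> \<longleftrightarrow> i \<in> {0..k - 3}" using assms by auto
    finally show ?thesis .
  qed
  have row3: "\<beta> i (int i + 3) \<noteq> 0 \<longleftrightarrow> i \<in> {1..2 * k - 5}" for i
  proof -
    have "\<beta> i (int i + 3) \<noteq> 0 \<longleftrightarrow> (\<exists>W\<subseteq>V. card W = i + 3 \<and> coh 2 W)" using row[of i 2] by simp
    also have "\<dots> \<longleftrightarrow> 4 \<le> i + 3 \<and> int (i + 3) \<le> 2 * int k - 2"
    proof
      assume "\<exists>W\<subseteq>V. card W = i + 3 \<and> coh 2 W"
      then obtain W where W: "W \<subseteq> V" "card W = i + 3" "coh 2 W" by blast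
      then show "4 \<le> i + 3 \<and> int (i + 3) \<le> 2 * int k - 2"
        using coh_card[OF W(3) finite_vertices[OF W(1)]] coh_2_card[OF W(3,1)] by simp
    qed (use ex_coh_2[of "i + 3"] in blast)
    also have "\<dots> \<longleftrightarrow> i \<in> {1..2 * k - 5}" using assms by auto
    finally show ?thesis .
  qed
  have row4: "\<beta> i (int i + 4) \<noteq> 0 \<longleftrightarrow> i \<in> {2..3 * k - 7}" for i
  proof -
    have "\<beta> i (int i + 4) \<noteq> 0 \<longleftrightarrow> (\<exists>W\<subseteq>V. card W = i + 4 \<and> coh 3 W)" using row[of i 3] by simp
    also have "\<dots> \<longleftrightarrow> 6 \<le> i + 4 \<and> int (i + 4) \<le> 3 * int k - 3"
    proof
      assume "\<exists>W\<subseteq>V. card W = i + 4 \<and> coh 3 W"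
      then obtain W where W: "W \<subseteq> V" "card W = i + 4" "coh 3 W" by blast
      then show "6 \<le> i + 4 \<and> int (i + 4) \<le> 3 * int k - 3"
        using coh_card[OF W(3) finite_vertices[OF W(1)]] coh_3_card[OF W(3,1)] by simp
    qed (use ex_coh_3[of "i + 4"] in blast)
    also have "\<dots> \<longleftrightarrow> i \<in> {2..3 * k - 7}" using assms by auto
    finally show ?thesis .
  qed
  have row5: "\<beta> i (int i + 5) \<noteq> 0 \<longleftrightarrow> i = 3 * k - 6" for i
  proof -
    have "\<beta> i (int i + 5) \<noteq> 0 \<longleftrightarrow> (\<exists>W\<subseteq>V. card W = i + 5 \<and> coh 4 W)" using row[of i 4] by simp
    also have "\<dots> \<longleftrightarrow> card V = i + 5" using coh_4_full coh_4_V by blast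
    also have "\<dots> \<longleftrightarrow> i = 3 * k - 6" using assms by auto
    finally show ?thesis .
  qed
  show ?thesis
    unfolding G fst_conv Let_def \<beta>_def[symmetric] using range row2 row3 row4 row5 by blast
qed

end
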